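(* Let $\Omega_1$ be a generalized Jordan domain and $\varphi:\Omega_1\rightarrow\Omega_2\subset\widehat{\mathbb{C}}$ a conformal homeomorphism of $\Omega_1$ onto a domain $\Omega_2$. Suppose that the point components of $\partial\Omega_2$ form a set with $\sigma$-finite linear measure and that $\partial\Omega_2$ has at most countably many non-degenerate components $\{P_n\}$ with $\sum_n\mathrm{diam}(P_n)<\infty$. Then $\varphi$ extends continuously to $\overline{\Omega_1}$ if and only if $\partial\Omega_2$ is a Peano compactum.
   Context: A domain is a connected open subset of the extended complex plane $\widehat{\mathbb{C}}$; diameters, closures and boundaries are taken in $\widehat{\mathbb{C}}$ with the spherical metric. A generalized Jordan domain is a domain $U\subset\widehat{\mathbb{C}}$ every component of whose boundary is a point or a Jordan curve, such that at most countably many boundary components are non-degenerate (i.e. Jordan curves) and the diameters of these form a null sequence (a finite sequence, or an infinite one converging to zero). A point component is a component that is a singleton; a non-degenerate component is one with more than one point. A Peano continuum is the image of $[0,1]$ under a continuous map. A Peano compactum is a compact metrisable space each of whose components is a Peano continuum (possibly a single point), such that for any $C>0$ at most finitely many of the components have diameter $>C$. Linear measure is one-dimensional Hausdorff measure. That $\varphi$ extends continuously to $\overline{\Omega_1}$ means that there is a continuous map $\overline{\varphi}:\overline{\Omega_1}\to\overline{\Omega_2}$ with $\overline{\varphi}|_{\Omega_1}=\varphi$. *)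

theory Defs
  imports "HOL-Complex_Analysis.Complex_Analysis"
begin

section \<open>The extended complex plane with the spherical metric\<close>

datatype ecomplex = Fin (the_complex: complex) | Infty

text \<open>Inverse stereographic projection onto the unit sphere of
  \<open>\<complex> \<times> \<real>\<close>; the north pole corresponds to infinity.\<close>

fun to_sphere :: "ecomplex \<Rightarrow> complex \<times> real" where
  "to_sphere (Fin z) =
     ((2 / (1 + (cmod z)\<^sup>2)) *\<^sub>R z, ((cmod z)\<^sup>2 - 1) / (1 + (cmod z)\<^sup>2))"
| "to_sphere Infty = (0, 1)"

lemma inner_to_sphere_self: "to_sphere x \<bullet> to_sphere x = 1"
proof (cases x)
  case (Fin z)
  define r where "r = (cmod z)\<^sup>2"
  have r: "1 + r > 0" unfolding r_def by (simp add: add_pos_nonneg)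
  have zz: "z \<bullet> z = r" by (simp add: r_def power2_norm_eq_inner)
  have "to_sphere x \<bullet> to_sphere x =
      (2 / (1 + r)) * ((2 / (1 + r)) * r) + ((r - 1) / (1 + r)) * ((r - 1) / (1 + r))"
    using zz by (simp add: Fin inner_prod_def flip: r_def)
  also have "\<dots> = (4 * r + (r - 1)\<^sup>2) / (1 + r)\<^sup>2"
    by (simp add: power2_eq_square add_divide_distrib)
  also have "4 * r + (r - 1)\<^sup>2 = (1 + r)\<^sup>2"
    by (simp add: power2_eq_square algebra_simps)
  finally show ?thesis using r by simp
qed (simp add: inner_prod_def)

lemma norm_to_sphere [simp]: "norm (to_sphere x) = 1"
  by (simp add: norm_eq_sqrt_inner inner_to_sphere_self)

lemma inj_to_sphere: "to_sphere x = to_sphere y \<Longrightarrow> x = y"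
proof -
  have aux: "1 + (cmod z)\<^sup>2 > 0" for z by (simp add: add_pos_nonneg)
  have snd: "snd (to_sphere (Fin z)) = 1 - 2 / (1 + (cmod z)\<^sup>2)" for z
    using aux[of z] by (simp add: field_simps)
  assume eq: "to_sphere x = to_sphere y"
  show "x = y"
  proof (cases x; cases y)
    fix z w assume xy: "x = Fin z" "y = Fin w"
    have "2 / (1 + (cmod z)\<^sup>2) = 2 / (1 + (cmod w)\<^sup>2)"
      using eq snd[of z] snd[of w] unfolding xy by simp
    moreover have "(2 / (1 + (cmod z)\<^sup>2)) *\<^sub>R z = (2 / (1 + (cmod w)\<^sup>2)) *\<^sub>R w"
      using eq unfolding xy by simp
    moreover have "2 / (1 + (cmod w)\<^sup>2) \<noteq> 0" using aux[of w] by simp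
    ultimately show ?thesis using xy by (metis scaleR_left_imp_eq)
  next
    fix z assume xy: "x = Fin z" "y = Infty"
    have "1 - 2 / (1 + (cmod z)\<^sup>2) = 1" using eq snd[of z] unfolding xy by simp
    then show ?thesis using aux[of z] by auto
  next
    fix z assume xy: "x = Infty" "y = Fin z"
    have "1 - 2 / (1 + (cmod z)\<^sup>2) = 1" using eq snd[of z] unfolding xy by simp
    then show ?thesis using aux[of z] by auto
  qed simp
qed

lemma abs_inner_to_sphere: "\<bar>to_sphere x \<bullet> to_sphere y\<bar> \<le> 1"
  using Cauchy_Schwarz_ineq2[of "to_sphere x" "to_sphere y"] by simp

lemma inner_to_sphere_bounds:
  "-1 \<le> to_sphere x \<bullet> to_sphere y" "to_sphere x \<bullet> to_sphere y \<le> 1"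
  using abs_inner_to_sphere[of x y] by linarith+

lemma arccos_inner_triangle:
  fixes u v w :: "'a::real_inner"
  assumes u: "norm u = 1" and v: "norm v = 1" and w: "norm w = 1"
  shows "arccos (u \<bullet> w) \<le> arccos (u \<bullet> v) + arccos (v \<bullet> w)"
proof -
  have b: "-1 \<le> x \<bullet> y \<and> x \<bullet> y \<le> 1" if "norm x = 1" "norm y = 1" for x y :: 'a
    using Cauchy_Schwarz_ineq2[of x y] that by (auto simp: abs_le_iff)
  define a where "a = arccos (u \<bullet> v)"
  define c where "c = arccos (v \<bullet> w)"
  have a: "0 \<le> a" "a \<le> pi" "cos a = u \<bullet> v" and c: "0 \<le> c" "c \<le> pi" "cos c = v \<bullet> w"
    using b[OF u v] b[OF v w] by (auto simp: a_def c_def arccos_lbound arccos_ubound)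
  show ?thesis
  proof (cases "a + c \<le> pi")
    case True
    have vv: "u \<bullet> u = 1" "v \<bullet> v = 1" "w \<bullet> w = 1"
      using u v w by (simp_all add: norm_eq_sqrt_inner)
    define p where "p = u - cos a *\<^sub>R v"
    define q where "q = w - cos c *\<^sub>R v"
    have pp: "p \<bullet> p = 1 - (cos a)\<^sup>2" unfolding p_def a(3)
      by (simp add: inner_diff_left inner_diff_right vv inner_commute power2_eq_square)
    have qq: "q \<bullet> q = 1 - (cos c)\<^sup>2" unfolding q_def c(3)
      by (simp add: inner_diff_left inner_diff_right vv inner_commute power2_eq_square)
    have np: "norm p = sin a" "norm q = sin c"
      using sin_ge_zero[OF a(1,2)] sin_ge_zero[OF c(1,2)]
      by (simp_all only: norm_eq_sqrt_inner pp qq sin_squared_eq[symmetric] real_sqrt_abs abs_of_nonneg)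
    have "p \<bullet> q = u \<bullet> w - cos a * cos c" unfolding p_def q_def a(3) c(3)
      by (simp add: inner_diff_left inner_diff_right vv inner_commute)
    moreover have "- (norm p * norm q) \<le> p \<bullet> q"
      using Cauchy_Schwarz_ineq2[of p q] by linarith
    ultimately have "cos (a + c) \<le> u \<bullet> w" by (simp add: cos_add np)
    then have "arccos (u \<bullet> w) \<le> arccos (cos (a + c))"
      using b[OF u w] by (intro arccos_le_arccos) auto
    also have "\<dots> = a + c" using True a c by (intro arccos_cos) auto
    finally show ?thesis by (simp add: a_def c_def)
  next
    case False
    then show ?thesis using arccos_ubound[of "u \<bullet> w"] b[OF u w] by (simp add: a_def c_def)
  qed
qed

text \<open>The spherical distance is the angle between the corresponding points of the sphere,
  i.e. the geodesic distance for the length element \<open>2 |dz| / (1 + |z|\<^sup>2)\<close>.\<close>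

instantiation ecomplex :: metric_space
begin

definition dist_ecomplex :: "ecomplex \<Rightarrow> ecomplex \<Rightarrow> real" where
  "dist_ecomplex x y = arccos (to_sphere x \<bullet> to_sphere y)"

definition uniformity_ecomplex :: "(ecomplex \<times> ecomplex) filter" where
  "uniformity_ecomplex = (INF e\<in>{0<..}. principal {(x, y). dist x y < e})"

definition open_ecomplex :: "ecomplex set \<Rightarrow> bool" where
  "open_ecomplex U \<longleftrightarrow> (\<forall>x\<in>U. eventually (\<lambda>(x', y). x' = x \<longrightarrow> y \<in> U) uniformity)"

instance
proof
  fix x y z :: ecomplex
  show "dist x y = 0 \<longleftrightarrow> x = y"
  proof
    assume "dist x y = 0"
    then have "to_sphere x \<bullet> to_sphere y = 1"
      unfolding dist_ecomplex_def
      by (metis abs_inner_to_sphere arccos_eq_iff arccos_1 abs_one order_refl)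
    then have "(to_sphere x - to_sphere y) \<bullet> (to_sphere x - to_sphere y) = 0"
      by (simp add: inner_diff_left inner_diff_right inner_to_sphere_self inner_commute)
    then show "x = y" using inj_to_sphere by simp
  qed (simp add: dist_ecomplex_def inner_to_sphere_self)
  show "dist x y \<le> dist x z + dist y z"
    using arccos_inner_triangle[of "to_sphere x" "to_sphere z" "to_sphere y"]
    by (simp add: dist_ecomplex_def inner_commute)
qed (simp_all only: uniformity_ecomplex_def open_ecomplex_def)

end


section \<open>Domains, Jordan curves and Peano compacta\<close>

definition domain :: "ecomplex set \<Rightarrow> bool" where
  "domain U \<longleftrightarrow> open U \<and> connected U"

definition jordan_curve :: "'a::topological_space set \<Rightarrow> bool" where
  "jordan_curve C \<longleftrightarrow>
     (\<exists>g. simple_path g \<and> pathfinish g = pathstart g \<and> path_image g = C)"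

definition point_components :: "'a::topological_space set \<Rightarrow> 'a set set" where
  "point_components S = {C \<in> components S. \<exists>x. C = {x}}"

definition nondegenerate_components :: "'a::topological_space set \<Rightarrow> 'a set set" where
  "nondegenerate_components S = {C \<in> components S. \<exists>x\<in>C. \<exists>y\<in>C. x \<noteq> y}"

definition null_family :: "'a::metric_space set set \<Rightarrow> bool" where
  "null_family F \<longleftrightarrow>
     finite F \<or> (\<exists>P. bij_betw P (UNIV :: nat set) F \<and> (\<lambda>n. diameter (P n)) \<longlonglongrightarrow> 0)"

definition generalized_jordan_domain :: "ecomplex set \<Rightarrow> bool" where
  "generalized_jordan_domain U \<longleftrightarrow>
     domain U \<and>
     (\<forall>C\<in>components (frontier U). (\<exists>x. C = {x}) \<or> jordan_curve C) \<and>
     countable (nondegenerate_components (frontier U)) \<and>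
     null_family (nondegenerate_components (frontier U))"

definition peano_continuum :: "'a::topological_space set \<Rightarrow> bool" where
  "peano_continuum P \<longleftrightarrow> (\<exists>g :: real \<Rightarrow> 'a. continuous_on {0..1} g \<and> P = g ` {0..1})"

definition peano_compactum :: "'a::metric_space set \<Rightarrow> bool" where
  "peano_compactum S \<longleftrightarrow>
     compact S \<and>
     (\<forall>P\<in>components S. peano_continuum P) \<and>
     (\<forall>c>0. finite {P \<in> components S. diameter P > c})"


section \<open>Linear measure\<close>

text \<open>One-dimensional Hausdorff (outer) measure. Covering sets are required to be bounded
  because \<^const>\<open>diameter\<close> is unspecified on unbounded sets; on the sphere this
  is no restriction.\<close>

definition linear_premeasure :: "real \<Rightarrow> 'a::metric_space set \<Rightarrow> ennreal" where
  "linear_premeasure \<delta> A =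
     (INF U \<in> {U :: nat \<Rightarrow> 'a set. A \<subseteq> (\<Union>n. U n) \<and> (\<forall>n. bounded (U n) \<and> diameter (U n) \<le> \<delta>)}.
        \<Sum>n. ennreal (diameter (U n)))"

definition linear_measure :: "'a::metric_space set \<Rightarrow> ennreal" where
  "linear_measure A = (SUP \<delta>\<in>{0<..}. linear_premeasure \<delta> A)"

text \<open>The pieces need not be assumed measurable: Hausdorff measure is Borel regular, so
  each of them lies in a Borel set of the same measure.\<close>

definition sigma_finite_linear_measure :: "'a::metric_space set \<Rightarrow> bool" where
  "sigma_finite_linear_measure A \<longleftrightarrow>
     (\<exists>B :: nat \<Rightarrow> 'a set. A = (\<Union>n. B n) \<and> (\<forall>n. linear_measure (B n) < \<infinity>))"


section \<open>Conformal homeomorphisms and continuous extension\<close>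

fun inversion :: "ecomplex \<Rightarrow> ecomplex" where
  "inversion (Fin z) = (if z = 0 then Infty else Fin (1 / z))"
| "inversion Infty = Fin 0"

text \<open>Holomorphic maps between open subsets of the Riemann sphere: the maps
  \<open>a \<circ> Fin\<close> with \<open>a\<close> the identity or the inversion are the
  two standard parametrisations of the sphere minus a point, and both are used in the source
  and in the target. Continuity makes the domains of the coordinate expressions open.\<close>

definition sphere_holomorphic_on :: "(ecomplex \<Rightarrow> ecomplex) \<Rightarrow> ecomplex set \<Rightarrow> bool" where
  "sphere_holomorphic_on f U \<longleftrightarrow>
     continuous_on U f \<and>
     (\<forall>a\<in>{id, inversion}. \<forall>b\<in>{id, inversion}.
        (\<lambda>z. the_complex (b (f (a (Fin z))))) holomorphic_on
          {z. a (Fin z) \<in> U \<and> b (f (a (Fin z))) \<noteq> Infty})"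

definition conformal_homeomorphism ::
    "ecomplex set \<Rightarrow> ecomplex set \<Rightarrow> (ecomplex \<Rightarrow> ecomplex) \<Rightarrow> bool" where
  "conformal_homeomorphism U V \<phi> \<longleftrightarrow>
     sphere_holomorphic_on \<phi> U \<and> (\<exists>\<psi>. homeomorphism U V \<phi> \<psi>)"

definition extends_continuously ::
    "ecomplex set \<Rightarrow> ecomplex set \<Rightarrow> (ecomplex \<Rightarrow> ecomplex) \<Rightarrow> bool" where
  "extends_continuously U V \<phi> \<longleftrightarrow>
     (\<exists>\<Phi>. continuous_on (closure U) \<Phi> \<and> \<Phi> ` closure U \<subseteq> closure V \<and> (\<forall>x\<in>U. \<Phi> x = \<phi> x))"

end

theory Submission
  imports Defs
begin

text \<open>Sending a point of each domain to infinity turns \<open>\<phi>\<close> into a homeomorphism between the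
  complements of two plane compacta \<open>K\<close> and \<open>L\<close>. By Janiszewski's theorem, compact subsets of the
  domains that separate components correspond under \<open>\<phi>\<close>, so components of \<open>K\<close> and of \<open>L\<close> are matched
  bijectively, and the closed relation consisting of the graph of \<open>\<phi>\<close> and this matching maps continua
  to continua. An extension of \<open>\<phi>\<close> therefore maps each boundary component, a point or a Jordan curve,
  onto a boundary component of the image.

  Conversely, for a boundary point \<open>x\<close> on the component \<open>C\<close>, the length-area method gives uncountably
  many circles about \<open>x\<close> whose images are short. All but countably many of them meet only components
  of \<open>K\<close> whose partners form a set of small content: the non-degenerate partners other than that of
  \<open>C\<close> have small total diameter, and the sets of degenerate partners met by different circles are
  disjoint up to countably many components, so that by \<open>\<sigma>\<close>-finiteness they are null for all but
  countably many radii. Hence an arc of such a circle that separates the points near \<open>x\<close> from infinity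
  outside \<open>C\<close> has a relational image of small diameter. As the partner of \<open>C\<close> has a locally connected
  frontier, Janiszewski's theorem confines the images of all points near \<open>x\<close> to a small disc.\<close>

section \<open>Separation in the plane\<close>

text \<open>The obstacle is that \<open>f\<close> says nothing on \<open>K\<close>: a circle about
  \<open>x\<close> may cross uncountably many components of \<open>K\<close>, so the length of its
  image cannot be added up along the circle. Diameters are measured by projection instead. The image
  of an arc under the relation is connected, so its projection to a line is an interval, and the
  length of that interval is at most the sum of the outer measures of the projections of any
  countable cover, in whatever order the pieces occur. The partner of \<open>C\<close> escapes this
  count, since it may be large while every small circle meets \<open>C\<close>; hence an arc off
  \<open>C\<close> is used and not the full circle. The arc separates only together with
  \<open>C\<close>, and the image of the union is large again. Janiszewski's theorem discards the
  partner of \<open>C\<close> provided that it meets the suitably enlarged image of the arc in a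
  small connected set. Here the Peano property of the partner's frontier enters; the Jordan property
  does the corresponding service for \<open>C\<close> itself.\<close>

lemma connected_component_diff_compact:
  fixes K J :: "complex set"
  assumes K: "compact K" "connected (- K)" and J: "closed J" "J \<inter> K = {}"
    and W: "W \<in> components (- J)"
  shows "connected (W - K)"
proof -
  have fW: "frontier W \<subseteq> J"
    using frontier_of_components_closed_complement[OF J(1) W] .
  have oW: "open W" using open_components[of "-J" W] J(1) W by auto
  have cW: "connected W" using W in_components_connected by blast
  have eq: "K \<inter> W = K \<inter> closure W"
    using fW J(2) closure_Un_frontier[of W] by blast
  have S: "compact (K \<inter> W)" unfolding eq using K(1) by (simp add: compact_Int_closed)
  \<comment> \<open>\<open>K \<inter> W\<close> and \<open>- W\<close> are disjoint, so the
    connectedness required of their intersection is trivial, and neither of them separates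
    \<open>a\<close> from \<open>b\<close>. \<open>K \<inter> W\<close> is compact because the
    frontier of \<open>W\<close> lies in \<open>J\<close> and thus misses \<open>K\<close>.\<close>
  have "connected_component (- ((K \<inter> W) \<union> - W)) a b" if ab: "a \<in> W - K" "b \<in> W - K" for a b
  proof (rule Janiszewski[OF S])
    show "closed (- W)" using oW by auto
    have e: "K \<inter> W \<inter> - W = {}" by auto
    show "connected (K \<inter> W \<inter> - W)" unfolding e by simp
    show "connected_component (- (K \<inter> W)) a b"
      using ab K(2) unfolding connected_component_def by (intro exI[of _ "- K"]) auto
    show "connected_component (- (- W)) a b"
      using ab cW unfolding connected_component_def by (intro exI[of _ W]) auto
  qed
  moreover have "- ((K \<inter> W) \<union> - W) = W - K" by auto
  ultimately show ?thesis by (auto simp: connected_iff_connected_component)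
qed

text \<open>Sura-Bura's theorem encloses the component of \<open>a\<close> in a relatively clopen
  part \<open>H\<close> of \<open>K\<close> that misses \<open>b\<close>. The wall \<open>J\<close>
  is the level set of the distance to \<open>H\<close> at half the gap between \<open>H\<close> and
  the rest of \<open>K\<close>; on the way to \<open>b\<close> this distance must pass that
  value.\<close>

lemma compact_components_separated:
  fixes K :: "'a::euclidean_space set"
  assumes K: "compact K" and a: "a \<in> K" and b: "b \<in> K" and ab: "\<not> connected_component K a b"
  obtains J where "compact J" "J \<inter> K = {}" "\<not> connected_component (- J) a b"
proof -
  let ?C = "connected_component_set K a"
  have C: "?C \<in> components K" using a by (simp add: componentsI)
  have "compact ?C" using C K compact_components by blast
  moreover have "?C \<subseteq> - {b}" using ab by auto
  ultimately obtain H where H: "openin (top_of_set K) H" "compact H" "?C \<subseteq> H" "H \<subseteq> - {b}"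
    using Sura_Bura_clopen_subset[of K ?C "-{b}"] K C
    by (metis closed_imp_locally_compact compact_imp_closed open_delete open_UNIV Compl_eq_Diff_UNIV)
  have "closedin (top_of_set K) (K - H)" using H(1) by auto
  then have cK: "closed (K - H)" using K closedin_closed_trans compact_imp_closed by blast
  obtain d where d: "d > 0" "\<And>x y. x \<in> H \<Longrightarrow> y \<in> K - H \<Longrightarrow> d \<le> dist x y"
    using separate_compact_closed[OF H(2) cK] by auto
  have aH: "a \<in> H" using H(3) a by auto
  have bH: "b \<in> K - H" using H(4) b by auto
  define J where "J = {y. infdist y H = d/2}"
  have "closed J" unfolding J_def
    by (intro closed_Collect_eq continuous_intros)
  have far: "infdist y H \<ge> d" if "y \<in> K - H" for y
    using d(2)[OF _ that] aH by (auto simp: infdist_def dist_commute intro!: cINF_greatest)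
  have "bounded J"
  proof -
    obtain B where B: "\<And>x. x \<in> H \<Longrightarrow> norm x \<le> B" using compact_imp_bounded[OF H(2)] bounded_iff by blast
    have "norm y \<le> B + d/2" if "y \<in> J" for y
    proof -
      obtain h where "h \<in> H" "infdist y H = dist y h"
        using infdist_attains_inf[of H y] H(2) aH compact_imp_closed by blast
      then show ?thesis using that B[of h] norm_triangle_sub[of y h]
        by (simp add: J_def dist_norm)
    qed
    then show ?thesis using bounded_iff by blast
  qed
  then have "compact J" using \<open>closed J\<close> compact_eq_bounded_closed by blast
  moreover have "J \<inter> K = {}"
  proof -
    have "y \<notin> J" if "y \<in> K" for y
      using that far[of y] d(1) by (cases "y \<in> H") (auto simp: J_def)
    then show ?thesis by auto
  qed
  moreover have "\<not> connected_component (- J) a b"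
  proof
    assume "connected_component (- J) a b"
    then obtain T where T: "connected T" "T \<subseteq> - J" "a \<in> T" "b \<in> T"
      unfolding connected_component_def by auto
    have "connected ((\<lambda>y. infdist y H) ` T)"
      by (intro connected_continuous_image T(1) continuous_intros)
    moreover have "0 \<in> (\<lambda>y. infdist y H) ` T" using aH T(3) by force
    moreover have "infdist b H \<in> (\<lambda>y. infdist y H) ` T" using T by auto
    moreover have "d \<le> infdist b H" using far bH by auto
    ultimately have "d/2 \<in> (\<lambda>y. infdist y H) ` T"
      using d(1) connectedD_interval[of "(\<lambda>y. infdist y H) ` T" 0 "infdist b H" "d/2"] by auto
    then show False using T(2) by (auto simp: J_def)
  qed
  ultimately show ?thesis using that by blast
qed

text \<open>The frontier of \<open>C\<close> is connected because the complement of \<open>K\<close>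
  is, and a larger connected subset of \<open>frontier K\<close> would lie in \<open>K\<close> and
  so stay in \<open>C\<close>. This links the components of the boundary, to which the hypotheses
  refer, with the components of \<open>K\<close>, on which the boundary correspondence acts.\<close>

lemma frontier_component_compact:
  fixes K :: "complex set"
  assumes K: "compact K" "connected (- K)" and C: "C \<in> components K"
  shows "frontier C = C \<inter> frontier K" "frontier C \<in> components (frontier K)" "frontier C \<noteq> {}"
proof -
  have cC: "compact C" using C K compact_components by blast
  have CK: "C \<subseteq> K" using C in_components_subset by blast
  have conC: "connected C" using C in_components_connected by blast
  have "frontier C \<subseteq> C" using cC compact_imp_closed frontier_subset_closed by blast
  moreover have "frontier C \<subseteq> frontier K" using frontier_of_components_subset[OF C] .
  moreover have "C \<inter> frontier K \<subseteq> frontier C"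
    using CK cC interior_mono[OF CK] by (auto simp: frontier_def compact_imp_closed)
  ultimately show eq: "frontier C = C \<inter> frontier K" by blast
  show ne: "frontier C \<noteq> {}"
    using C cC frontier_eq_empty[of C] in_components_nonempty[OF C] not_compact_UNIV by metis
  have con: "connected (frontier C)"
    using connected_frontier_component_complement[of "- K" C] K C by simp
  show "frontier C \<in> components (frontier K)"
    unfolding in_components_maximal
  proof (intro conjI allI impI)
    fix D assume D: "D \<noteq> {} \<and> frontier C \<subseteq> D \<and> D \<subseteq> frontier K \<and> connected D"
    have "frontier K \<subseteq> K" using K(1) compact_imp_closed frontier_subset_closed by blast
    then have "D \<subseteq> C"
      using components_maximal[OF C, of D] D ne \<open>frontier C \<subseteq> C\<close> by blast
    then show "D = frontier C" using D eq by blast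
  qed (use ne eq con in auto)
qed

lemma component_frontier_compact:
  fixes K :: "complex set"
  assumes K: "compact K" "connected (- K)" and P: "P \<in> components (frontier K)"
  obtains C where "C \<in> components K" "P = frontier C"
proof -
  obtain p where p: "p \<in> P" using P in_components_nonempty by blast
  have sub: "frontier K \<subseteq> K" using K(1) compact_imp_closed frontier_subset_closed by blast
  have PF: "P \<subseteq> frontier K" using P in_components_subset by blast
  define C where "C = connected_component_set K p"
  have C: "C \<in> components K" using p PF sub by (auto simp: C_def componentsI)
  have "p \<in> C" using p PF sub by (auto simp: C_def)
  then have "p \<in> frontier C" using frontier_component_compact(1)[OF K C] p PF by auto
  then have "P = frontier C"
    using components_eq[OF P frontier_component_compact(2)[OF K C]] p by blast
  with C show ?thesis using that by blast
qed

section \<open>The boundary correspondence of a homeomorphism\<close>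

abbreviation cc :: "'a::topological_space set \<Rightarrow> 'a \<Rightarrow> 'a set" where
  "cc S x \<equiv> connected_component_set S x"

text \<open>Two boundary points are related if they lie on corresponding sides of every compact subset
  \<open>J\<close> of the domain.\<close>

definition end_rel :: "complex set \<Rightarrow> complex set \<Rightarrow> (complex \<Rightarrow> complex) \<Rightarrow> complex \<Rightarrow> complex \<Rightarrow> bool" where
  "end_rel K L f k p \<longleftrightarrow> k \<in> K \<and> p \<in> L \<and>
     (\<forall>J. compact J \<and> J \<inter> K = {} \<longrightarrow>
        (\<exists>z. z \<notin> K \<and> z \<in> cc (- J) k \<and> f z \<in> cc (- f ` J) p))"

text \<open>A set-valued extension of \<open>f\<close> to the whole plane that exists for any
  boundary: a point of \<open>K\<close> receives the full component of \<open>L\<close> matched with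
  its own component. It proves to be closed and total with connected fibres.\<close>

definition end_graph :: "complex set \<Rightarrow> complex set \<Rightarrow> (complex \<Rightarrow> complex) \<Rightarrow> (complex \<times> complex) set" where
  "end_graph K L f = {(z, p). (z \<notin> K \<and> p = f z) \<or> end_rel K L f z p}"

text \<open>\<open>K\<close> and \<open>L\<close> are the complements of the two domains after a
  point of each has been sent to infinity. The two boundedness conditions say that \<open>f\<close>
  and \<open>g\<close> fix infinity; they also supply convergent subsequences of image
  points.\<close>

locale end_pair =
  fixes K L :: "complex set" and f g :: "complex \<Rightarrow> complex"
  assumes K: "compact K" "connected (- K)"
    and L: "compact L" "connected (- L)"
    and homeo: "homeomorphism (- K) (- L) f g"
    and bounded_f: "\<And>B. bounded B \<Longrightarrow> bounded (f ` (B - K))"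
    and bounded_g: "\<And>B. bounded B \<Longrightarrow> bounded (g ` (B - L))"
begin

lemma gf [simp]: "z \<notin> K \<Longrightarrow> g (f z) = z"
  and fg [simp]: "w \<notin> L \<Longrightarrow> f (g w) = w"
  and f_in [simp]: "z \<notin> K \<Longrightarrow> f z \<notin> L"
  and g_in [simp]: "w \<notin> L \<Longrightarrow> g w \<notin> K"
  and cont_f: "continuous_on (- K) f"
  and cont_g: "continuous_on (- L) g"
proof -
  have h: "f ` (- K) = - L" "g ` (- L) = - K" using homeo by (auto simp: homeomorphism_def)
  show "z \<notin> K \<Longrightarrow> g (f z) = z" "w \<notin> L \<Longrightarrow> f (g w) = w" "continuous_on (- K) f" "continuous_on (- L) g"
    using homeo by (auto simp: homeomorphism_def)
  show "z \<notin> K \<Longrightarrow> f z \<notin> L" "w \<notin> L \<Longrightarrow> g w \<notin> K" using h by blast+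
qed

lemma image_J:
  assumes "compact J" "J \<inter> K = {}"
  shows "compact (f ` J)" "f ` J \<inter> L = {}" "g ` f ` J = J"
proof -
  have JK: "J \<subseteq> - K" using assms by auto
  show "compact (f ` J)"
    using assms(1) continuous_on_subset[OF cont_f JK] by (rule compact_continuous_image[rotated])
  show "f ` J \<inter> L = {}" using JK by auto
  have "(\<lambda>z. g (f z)) ` J = (\<lambda>z. z) ` J" using JK by (intro image_cong) auto
  then show "g ` f ` J = J" by (simp add: image_image)
qed

text \<open>A side of \<open>J\<close> may contain parts of \<open>K\<close>, where \<open>f\<close>
  says nothing. What remains of it after removal of \<open>K\<close> is still connected, so
  \<open>f\<close> carries it into one side of the image of \<open>J\<close>.\<close>

lemma component_image_subset:
  assumes J: "compact J" "J \<inter> K = {}" and z: "z \<notin> K" and y: "y \<notin> K" and zy: "y \<in> cc (- J) z"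
  shows "f y \<in> cc (- f ` J) (f z)"
proof -
  have zJ: "z \<in> - J" using zy connected_component_in by blast
  have "cc (- J) z \<in> components (- J)" using zJ by (simp add: componentsI)
  then have "connected (cc (- J) z - K)"
    using connected_component_diff_compact[OF K _ J(2)] J(1) compact_imp_closed by blast
  then have con: "connected (f ` (cc (- J) z - K))"
    by (rule connected_continuous_image[rotated]) (rule continuous_on_subset[OF cont_f], auto)
  have sub: "f ` (cc (- J) z - K) \<subseteq> - f ` J"
  proof -
    have "f x \<noteq> f j" if "x \<in> cc (- J) z - K" "j \<in> J" for x j
    proof
      assume e: "f x = f j"
      have "j \<notin> K" "x \<notin> K" using that J(2) by auto
      then have "x = j" using e gf by metis
      then show False using that connected_component_subset[of "-J" z] by auto
    qed
    then show ?thesis by auto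
  qed
  have "z \<in> cc (- J) z - K" using zJ z by simp
  then show ?thesis
    using connected_component_maximal[OF _ con sub, of "f z"] zy y by blast
qed

end

lemma (in end_pair) swap: "end_pair L K g f"
proof -
  have "homeomorphism (- L) (- K) g f" using homeo homeomorphism_sym by blast
  then show ?thesis using K L bounded_f bounded_g by unfold_locales auto
qed

context end_pair begin

lemma component_image_iff:
  assumes J: "compact J" "J \<inter> K = {}" and z: "z \<notin> K" and y: "y \<notin> K"
  shows "f y \<in> cc (- f ` J) (f z) \<longleftrightarrow> y \<in> cc (- J) z"
proof
  interpret s: end_pair L K g f by (rule swap)
  assume "f y \<in> cc (- f ` J) (f z)"
  then show "y \<in> cc (- J) z"
    using s.component_image_subset[OF image_J(1,2)[OF J], of "f z" "f y"] z y by (simp add: image_J[OF J])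
qed (rule component_image_subset[OF assms])

text \<open>One witness per \<open>J\<close> is enough: by \<open>component_image_iff\<close> the
  points of one side of \<open>J\<close> have their images on one side of the image of
  \<open>J\<close>, so a single witness decides every other point.\<close>

lemma end_rel_iff:
  assumes E: "end_rel K L f k p" and J: "compact J" "J \<inter> K = {}" and z: "z \<notin> K"
  shows "z \<in> cc (- J) k \<longleftrightarrow> f z \<in> cc (- f ` J) p"
proof -
  obtain y where y: "y \<notin> K" "y \<in> cc (- J) k" "f y \<in> cc (- f ` J) p"
    using E J unfolding end_rel_def by blast
  have "cc (- J) k = cc (- J) y" "cc (- f ` J) p = cc (- f ` J) (f y)"
    using y by (metis connected_component_eq)+
  then show ?thesis using component_image_iff[OF J y(1) z] by simp
qed

lemma end_rel_swap: "end_rel K L f k p \<longleftrightarrow> end_rel L K g p k"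
proof -
  have *: "end_rel L K g p k" if "end_pair K L f g" and E: "end_rel K L f k p" for K L f g k p
  proof -
    interpret e: end_pair K L f g by fact
    interpret s: end_pair L K g f by (rule e.swap)
    have "\<exists>w. w \<notin> L \<and> w \<in> cc (- J) p \<and> g w \<in> cc (- g ` J) k" if J: "compact J" "J \<inter> L = {}" for J
    proof -
      obtain z where "z \<notin> K" "z \<in> cc (- g ` J) k" "f z \<in> cc (- f ` g ` J) p"
        using E s.image_J[OF J] unfolding end_rel_def by blast
      then show ?thesis using s.image_J(3)[OF J] by (intro exI[of _ "f z"]) auto
    qed
    then show ?thesis using E unfolding end_rel_def by blast
  qed
  show ?thesis using *[OF end_pair_axioms] *[OF swap] by blast
qed

lemma end_graph_swap: "(z, p) \<in> end_graph K L f \<longleftrightarrow> (p, z) \<in> end_graph L K g"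
  unfolding end_graph_def using end_rel_swap by auto

lemma end_rel_component_right:
  assumes "end_rel K L f k p" "connected_component L p q"
  shows "end_rel K L f k q"
  unfolding end_rel_def
proof (intro conjI allI impI)
  fix J assume J: "compact J \<and> J \<inter> K = {}"
  have "L \<subseteq> - f ` J" using image_J(2) J by auto
  then have "connected_component (- f ` J) p q"
    using assms(2) connected_component_of_subset by blast
  then have "cc (- f ` J) p = cc (- f ` J) q" by (simp add: connected_component_eq)
  moreover obtain z where "z \<notin> K" "z \<in> cc (- J) k" "f z \<in> cc (- f ` J) p"
    using assms(1) J unfolding end_rel_def by blast
  ultimately show "\<exists>z. z \<notin> K \<and> z \<in> cc (- J) k \<and> f z \<in> cc (- f ` J) q" by metis
qed (use assms connected_component_in end_rel_def in blast)+

text \<open>If \<open>p\<close> and \<open>q\<close> lay in different components, a wall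
  \<open>J\<close> in the target would separate them. Pulled back by \<open>g\<close> it is a wall
  in the source, and a witness on its side at \<open>k\<close> would have its image on both sides of
  \<open>J\<close>.\<close>

lemma end_rel_unique_right:
  assumes p: "end_rel K L f k p" and q: "end_rel K L f k q"
  shows "connected_component L p q"
proof (rule ccontr)
  assume "\<not> ?thesis"
  then obtain J where J: "compact J" "J \<inter> L = {}" "\<not> connected_component (- J) p q"
    using compact_components_separated[of L p q] L p q unfolding end_rel_def by blast
  interpret s: end_pair L K g f by (rule swap)
  have J': "compact (g ` J)" "g ` J \<inter> K = {}" "f ` g ` J = J" using s.image_J[OF J(1,2)] by auto
  obtain z where z: "z \<notin> K" "z \<in> cc (- g ` J) k" "f z \<in> cc (- J) p"
    using p J' unfolding end_rel_def by metis
  have "f z \<in> cc (- J) q" using end_rel_iff[OF q J'(1,2) z(1)] z J'(3) by simp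
  then show False using z(3) J(3) connected_component_sym connected_component_trans by (metis mem_Collect_eq)
qed

lemma end_rel_right: "end_rel K L f k p \<Longrightarrow> {q. end_rel K L f k q} = cc L p"
  using end_rel_component_right end_rel_unique_right by blast

lemma end_rel_left: "end_rel K L f k p \<Longrightarrow> {j. end_rel K L f j p} = cc K k"
  using end_pair.end_rel_right[OF swap, of p k] end_rel_swap by simp

lemma end_graph_notin: "z \<notin> K \<Longrightarrow> (z, p) \<in> end_graph K L f \<longleftrightarrow> p = f z"
  and end_graph_in: "z \<in> K \<Longrightarrow> (z, p) \<in> end_graph K L f \<longleftrightarrow> end_rel K L f z p"
  by (auto simp: end_graph_def end_rel_def)

lemma end_graph_in_iff: "(z, p) \<in> end_graph K L f \<Longrightarrow> z \<in> K \<longleftrightarrow> p \<in> L"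
  by (auto simp: end_graph_def end_rel_def)

lemma end_graph_limit_notin:
  assumes G: "\<And>n::nat. (z n, p n) \<in> end_graph K L f" and z: "z \<longlonglongrightarrow> a" and p: "p \<longlonglongrightarrow> b" and a: "a \<notin> K"
  shows "b = f a"
proof -
  have oK: "open (- K)" using K compact_imp_closed by auto
  have ev: "eventually (\<lambda>n. z n \<in> - K) sequentially"
    using topological_tendstoD[OF z oK] a by auto
  have "isCont f a" using cont_f oK a continuous_on_eq_continuous_at by blast
  then have "(\<lambda>n. f (z n)) \<longlonglongrightarrow> f a" using z by (rule isCont_tendsto_compose)
  moreover have "eventually (\<lambda>n. f (z n) = p n) sequentially"
    using ev
  proof eventually_elim
    case (elim n)
    then show ?case using end_graph_notin[of "z n" "p n"] G[of n] by simp
  qed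
  ultimately have "p \<longlonglongrightarrow> f a" using Lim_transform_eventually by blast
  then show ?thesis using p LIMSEQ_unique by blast
qed

end

context end_pair begin

text \<open>The sides of a wall are open, so late terms of both sequences lie on the sides of their
  limits; a term on \<open>K\<close> is replaced by a witness of its own relation. That
  \<open>b\<close> lies on \<open>L\<close> is the case of a limit off the compact set, applied to
  \<open>g\<close>.\<close>

lemma end_graph_limit:
  assumes G: "\<And>n::nat. (z n, p n) \<in> end_graph K L f" and z: "z \<longlonglongrightarrow> a" and p: "p \<longlonglongrightarrow> b"
  shows "(a, b) \<in> end_graph K L f"
proof (cases "a \<in> K")
  case False
  then show ?thesis using end_graph_limit_notin[OF G z p] end_graph_notin by auto
next
  case True
  interpret s: end_pair L K g f by (rule swap)
  have bL: "b \<in> L"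
  proof (rule ccontr)
    assume "b \<notin> L"
    then have "a = g b"
      using s.end_graph_limit_notin[of p z, OF _ p z] G end_graph_swap by blast
    then show False using \<open>b \<notin> L\<close> True by simp
  qed
  have "\<exists>y. y \<notin> K \<and> y \<in> cc (- J) a \<and> f y \<in> cc (- f ` J) b" if J: "compact J" "J \<inter> K = {}" for J
  proof -
    have J': "compact (f ` J)" "f ` J \<inter> L = {}" using image_J J by auto
    have "open (cc (- J) a)" "open (cc (- f ` J) b)"
      using J(1) J'(1) compact_imp_closed by (auto intro!: open_connected_component)
    moreover have "a \<in> cc (- J) a" "b \<in> cc (- f ` J) b" using True bL J J' by auto
    ultimately have "eventually (\<lambda>n. z n \<in> cc (- J) a \<and> p n \<in> cc (- f ` J) b) sequentially"
      using topological_tendstoD[OF z] topological_tendstoD[OF p] eventually_conj by blast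
    then obtain n where n: "z n \<in> cc (- J) a" "p n \<in> cc (- f ` J) b"
      using eventually_happens'[OF sequentially_bot] by blast
    show ?thesis
    proof (cases "z n \<in> K")
      case False
      then have "p n = f (z n)" using G[of n] end_graph_notin by blast
      then show ?thesis using n False by (intro exI[of _ "z n"]) auto
    next
      case True
      then have "end_rel K L f (z n) (p n)" using G end_graph_in by blast
      then obtain y where "y \<notin> K" "y \<in> cc (- J) (z n)" "f y \<in> cc (- f ` J) (p n)"
        using J unfolding end_rel_def by blast
      moreover have "cc (- J) (z n) = cc (- J) a" "cc (- f ` J) (p n) = cc (- f ` J) b"
        using n by (metis connected_component_eq)+
      ultimately show ?thesis by auto
    qed
  qed
  then have "end_rel K L f a b" using True bL unfolding end_rel_def by blast
  then show ?thesis using True end_graph_in by blast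
qed

lemma closed_end_graph: "closed (end_graph K L f)"
  unfolding closed_sequential_limits
proof (intro allI impI, elim conjE)
  fix s l assume s: "\<forall>n. s n \<in> end_graph K L f" "s \<longlonglongrightarrow> l"
  show "l \<in> end_graph K L f"
    using end_graph_limit[of "\<lambda>n. fst (s n)" "\<lambda>n. snd (s n)" "fst l" "snd l"] s
      tendsto_fst[OF s(2)] tendsto_snd[OF s(2)] by simp
qed

lemma bounded_end_graph_image:
  assumes "bounded B" shows "bounded (end_graph K L f `` B)"
proof (rule bounded_subset)
  show "bounded (f ` (B - K) \<union> L)" using bounded_f[OF assms] L compact_imp_bounded by auto
  show "end_graph K L f `` B \<subseteq> f ` (B - K) \<union> L" by (auto simp: end_graph_def end_rel_def)
qed

lemma end_graph_total: "\<exists>p. (z, p) \<in> end_graph K L f"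
proof (cases "z \<in> K")
  case False then show ?thesis using end_graph_notin by blast
next
  case True
  let ?C = "cc K z"
  have C: "?C \<in> components K" using True by (simp add: componentsI)
  obtain k where k: "k \<in> frontier ?C" using frontier_component_compact(3)[OF K C] by blast
  then have kC: "k \<in> ?C" "k \<in> frontier K" using frontier_component_compact(1)[OF K C] by auto
  then have kK: "k \<in> K" using connected_component_subset by blast
  have "k \<in> closure (- K)" using kC(2) by (simp add: frontier_closures)
  then obtain y where y: "\<And>n. y n \<notin> K" "y \<longlonglongrightarrow> k" unfolding closure_sequential by auto
  have "bounded (f ` (range y - K))" using bounded_f convergent_imp_bounded y(2) by blast
  moreover have "range (f \<circ> y) \<subseteq> f ` (range y - K)" using y(1) by auto
  ultimately have "bounded (range (f \<circ> y))" using bounded_subset by blast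
  then obtain l r where r: "strict_mono r" "(f \<circ> y \<circ> r) \<longlonglongrightarrow> l"
    using bounded_imp_convergent_subsequence by metis
  have "(k, l) \<in> end_graph K L f"
  proof (rule end_graph_limit)
    show "(y (r n), f (y (r n))) \<in> end_graph K L f" for n using end_graph_notin y(1) by blast
    show "(\<lambda>n. y (r n)) \<longlonglongrightarrow> k" using LIMSEQ_subseq_LIMSEQ[OF y(2) r(1)] by (simp add: o_def)
    show "(\<lambda>n. f (y (r n))) \<longlonglongrightarrow> l" using r(2) by (simp add: o_def)
  qed
  then have "end_rel K L f k l" using kK end_graph_in by blast
  moreover have "connected_component K k z" using kC(1) by (simp add: connected_component_sym)
  ultimately have "end_rel K L f z l"
    using end_rel_left by (metis mem_Collect_eq)
  then show ?thesis using True end_graph_in by blast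
qed

lemma connected_end_graph_fibre: "connected {p. (z, p) \<in> end_graph K L f}"
proof (cases "z \<in> K")
  case False
  then have "{p. (z, p) \<in> end_graph K L f} = {f z}" using end_graph_notin by auto
  then show ?thesis by simp
next
  case True
  obtain p where "end_rel K L f z p" using end_graph_total True end_graph_in by blast
  then have "{p. (z, p) \<in> end_graph K L f} = cc L p" using end_rel_right True end_graph_in by auto
  then show ?thesis by simp
qed

text \<open>Over \<open>T\<close> the graph is compact, so its projection to \<open>T\<close> is a
  closed map with connected fibres. Under such a monotone map the preimage of a connected set is
  connected; the image in question is its other projection.\<close>

lemma compact_end_graph_image:
  assumes "compact T"
  shows "compact (end_graph K L f `` T)" "connected T \<Longrightarrow> connected (end_graph K L f `` T)"
proof -
  define G where "G = end_graph K L f \<inter> T \<times> UNIV"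
  have bG: "bounded G"
  proof (rule bounded_subset)
    show "bounded (T \<times> (end_graph K L f `` T))"
      using assms compact_imp_bounded bounded_end_graph_image bounded_Times by blast
  qed (auto simp: G_def)
  have "closed G" unfolding G_def
    using closed_end_graph assms compact_imp_closed by (intro closed_Int closed_Times) auto
  then have cG: "compact G" using bG compact_eq_bounded_closed by blast
  have sndG: "end_graph K L f `` T = snd ` G" by (force simp: G_def)
  show "compact (end_graph K L f `` T)" unfolding sndG
    by (intro compact_continuous_image cG continuous_intros)
  assume con: "connected T"
  have fstG: "fst ` G = T" using end_graph_total unfolding G_def by (auto simp: image_iff Bex_def)
  have "connected (G \<inter> fst -` T)"
  proof (rule connected_closed_monotone_preimage[OF _ fstG])
    show "continuous_on G fst" by (intro continuous_intros)
    show "closedin (top_of_set T) (fst ` C)" if "closedin (top_of_set G) C" for C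
    proof -
      have "compact C" using that cG closedin_compact by blast
      then have "compact (fst ` C)" by (intro compact_continuous_image continuous_intros)
      moreover have "fst ` C \<subseteq> T" using that closedin_imp_subset fstG by blast
      ultimately show ?thesis by (simp add: closed_subset compact_imp_closed)
    qed
    show "connected (G \<inter> fst -` {y})" if "y \<in> T" for y
    proof -
      have "G \<inter> fst -` {y} = Pair y ` {p. (y, p) \<in> end_graph K L f}" using that by (auto simp: G_def)
      then show ?thesis
        using connected_end_graph_fibre[of y] by (auto intro!: connected_continuous_image continuous_intros)
    qed
  qed (use con in auto)
  moreover have "G \<inter> fst -` T = G" by (auto simp: G_def)
  ultimately have "connected G" by simp
  then show "connected (end_graph K L f `` T)" unfolding sndG
    by (intro connected_continuous_image continuous_intros)
qed

end

section \<open>Crosscuts\<close>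

text \<open>With the loop based at \<open>x\<close>, the arc \<open>B\<close> consists of the
  parameters at least \<open>d\<close> away from both ends, and continuity at the two ends controls
  what is left out. \<open>B\<close> becomes the connected intersection in the next use of
  Janiszewski's theorem.\<close>

lemma jordan_curve_punctured_arc:
  fixes C :: "'a::metric_space set"
  assumes "jordan_curve C" "x \<in> C" "r > 0"
  obtains B where "closed B" "connected B" "B \<subseteq> C" "x \<notin> B" "C - B \<subseteq> ball x r"
proof -
  obtain h0 where h0: "simple_path h0" "pathfinish h0 = pathstart h0" "path_image h0 = C"
    using assms(1) unfolding jordan_curve_def by blast
  obtain t0 where t0: "t0 \<in> {0..1}" "h0 t0 = x" using assms(2) h0(3) by (auto simp: path_image_def)
  define h where "h = shiftpath t0 h0"
  have h: "simple_path h" "path_image h = C" "h 0 = x" "h 1 = x"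
    using simple_path_shiftpath[OF h0(1,2)] path_image_shiftpath[OF t0(1) h0(2)] h0 t0
      pathstart_shiftpath[of t0 h0] pathfinish_shiftpath[of t0 h0]
    by (auto simp: h_def pathstart_def pathfinish_def)
  have ch: "continuous_on {0..1} h" using h(1) by (simp add: simple_path_def path_def)
  obtain d0 where d0: "d0 > 0" "\<And>t. t \<in> {0..1} \<Longrightarrow> dist t 0 < d0 \<Longrightarrow> dist (h t) (h 0) < r"
    using ch[unfolded continuous_on_iff] assms(3) by (metis atLeastAtMost_iff order_refl zero_le_one)
  obtain d1 where d1: "d1 > 0" "\<And>t. t \<in> {0..1} \<Longrightarrow> dist t 1 < d1 \<Longrightarrow> dist (h t) (h 1) < r"
    using ch[unfolded continuous_on_iff] assms(3) by (metis atLeastAtMost_iff order_refl zero_le_one)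
  define d where "d = min (min d0 d1) (1/2) / 2"
  have d: "d > 0" "d < d0" "d < d1" "d < 1/2" using d0(1) d1(1) by (auto simp: d_def)
  define B where "B = h ` {d..1-d}"
  have cB: "continuous_on {d..1-d} h" by (rule continuous_on_subset[OF ch]) (use d in auto)
  have "compact B" "connected B" unfolding B_def
    using cB by (auto intro: compact_continuous_image connected_continuous_image)
  moreover have "B \<subseteq> C" using h(2) d unfolding B_def path_image_def by auto
  moreover have "x \<notin> B"
  proof
    assume "x \<in> B"
    then obtain t where t: "t \<in> {d..1-d}" "h t = h 0" using h(3) by (auto simp: B_def)
    have lf: "loop_free h" using h(1) simple_path_def by blast
    have "t = 0 \<or> t = 1"
      using lf[unfolded loop_free_def, rule_format, of t 0] t d by auto
    then show False using t d by auto
  qed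
  moreover have "C - B \<subseteq> ball x r"
  proof
    fix y assume "y \<in> C - B"
    then obtain t where t: "t \<in> {0..1}" "y = h t" using h(2) by (auto simp: path_image_def)
    then have "t \<notin> {d..1-d}" using \<open>y \<in> C - B\<close> by (auto simp: B_def)
    then have "dist t 0 < d0 \<or> dist t 1 < d1" using d t by (auto simp: dist_real_def)
    then show "y \<in> ball x r" using d0(2)[of t] d1(2)[of t] t h(3,4) by (auto simp: dist_commute)
  qed
  ultimately show ?thesis using that compact_imp_closed by blast
qed

text \<open>Janiszewski's theorem for the frontier of \<open>C\<close> and the union of the arc \<open>B\<close> with the
  outside of the disc: their intersection is \<open>B\<close>.\<close>

lemma locally_connected_complement_at:
  fixes C :: "complex set"
  assumes C: "compact C" "connected (- C)" and x: "r > 0"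
    and B: "closed B" "connected B" "B \<subseteq> frontier C" "x \<notin> B" "frontier C - B \<subseteq> ball x r"
  obtains d where "0 < d" "d \<le> r"
    "\<And>a b. a \<in> ball x d - C \<Longrightarrow> b \<in> ball x d - C \<Longrightarrow> connected_component (ball x r - C) a b"
proof -
  have fC: "frontier C \<subseteq> C" using C(1) compact_imp_closed frontier_subset_closed by blast
  have cf: "compact (frontier C)" using C(1) compact_frontier by blast
  obtain d0 where d0: "d0 > 0" "ball x d0 \<subseteq> - B"
    using B(1,4) open_contains_ball[of "-B"] by auto
  define d where "d = min d0 r"
  have "connected_component (ball x r - C) a b" if ab: "a \<in> ball x d - C" "b \<in> ball x d - C" for a b
  proof -
    have "connected_component (- (frontier C \<union> (B \<union> - ball x r))) a b"
    proof (rule Janiszewski[OF cf])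
      show "closed (B \<union> - ball x r)" using B(1) by (intro closed_Un) auto
      have "frontier C \<inter> (B \<union> - ball x r) = B" using B by blast
      then show "connected (frontier C \<inter> (B \<union> - ball x r))" using B(2) by simp
      show "connected_component (- frontier C) a b"
        unfolding connected_component_def using C(2) ab fC by (intro exI[of _ "- C"]) auto
      have "ball x d \<subseteq> - (B \<union> - ball x r)" using d0(2) by (auto simp: d_def)
      then show "connected_component (- (B \<union> - ball x r)) a b"
        unfolding connected_component_def using ab by (intro exI[of _ "ball x d"]) auto
    qed
    then obtain T where T: "connected T" "T \<subseteq> - (frontier C \<union> (B \<union> - ball x r))" "a \<in> T" "b \<in> T"
      unfolding connected_component_def by blast
    have "T \<inter> C = {}"
    proof (rule ccontr)
      assume "T \<inter> C \<noteq> {}"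
      then have "T \<inter> frontier C \<noteq> {}" using connected_Int_frontier[OF T(1)] T(3) ab by blast
      then show False using T(2) by blast
    qed
    then show ?thesis unfolding connected_component_def using T by (intro exI[of _ T]) auto
  qed
  moreover have "0 < d" "d \<le> r" using d0 x by (auto simp: d_def)
  ultimately show ?thesis using that by blast
qed

text \<open>\<open>C\<close> with the whole circle separates \<open>z\<close> from \<open>w\<close>;
  one arc must already do so. There may be infinitely many arcs, but a path from \<open>z\<close> to
  \<open>w\<close> off \<open>C\<close> meets the circle in a compact set, which finitely many arcs
  \<open>F\<close> cover because arcs are open in the circle. If no arc separated, neither would
  \<open>C\<close> with all arcs of \<open>F\<close>, and the path itself shows that
  \<open>C\<close> with the rest of the circle does not. Janiszewski's theorem would then give a
  connected set from \<open>z\<close> to \<open>w\<close> off the circle.\<close>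

lemma separating_circle_component:
  fixes C :: "complex set"
  assumes C: "compact C" "connected C" "connected (- C)"
    and z: "z \<in> ball x r - C" and w: "w \<notin> cball x r" "w \<notin> C"
  obtains A where "A \<in> components (sphere x r - C)" "compact (C \<union> A)"
    "\<not> connected_component (- (C \<union> A)) z w"
proof -
  let ?S = "sphere x r"
  have oC: "open (- C)" using C(1) compact_imp_closed by auto
  have "path_connected (- C)" using C(3) oC connected_open_path_connected by blast
  then obtain \<gamma> where \<gamma>: "path \<gamma>" "path_image \<gamma> \<subseteq> - C" "pathstart \<gamma> = z" "pathfinish \<gamma> = w"
    unfolding path_connected_def using z w by blast
  let ?Q = "path_image \<gamma> \<inter> ?S"
  have "compact ?Q" using compact_path_image[OF \<gamma>(1)] by (intro compact_Int_closed) auto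
  have opS: "openin (top_of_set ?S) (?S - C)"
    using oC by (metis Diff_eq openin_open_Int)
  have opA: "openin (top_of_set ?S) A" if "A \<in> components (?S - C)" for A
    using locally_connected_open_component[of ?S] locally_connected_sphere opS that by blast
  have ex: "\<exists>W. open W \<and> A = ?S \<inter> W" if "A \<in> components (?S - C)" for A
    using opA[OF that] openin_open by auto
  define W where "W A = (SOME W. open W \<and> A = ?S \<inter> W)" for A
  have W: "open (W A)" "A = ?S \<inter> W A" if "A \<in> components (?S - C)" for A
    using someI_ex[OF ex[OF that]] by (auto simp: W_def)
  have "?Q \<subseteq> (\<Union>A\<in>components (?S - C). W A)"
  proof
    fix q assume q: "q \<in> ?Q"
    then have "q \<in> ?S - C" using \<gamma>(2) by auto
    then obtain A where "A \<in> components (?S - C)" "q \<in> A" using Union_components[of "?S - C"] by blast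
    then show "q \<in> (\<Union>A\<in>components (?S - C). W A)" using W(2) by blast
  qed
  then obtain F where F: "F \<subseteq> components (?S - C)" "finite F" "?Q \<subseteq> (\<Union>A\<in>F. W A)"
    using compactE_image[OF \<open>compact ?Q\<close>, of "components (?S - C)" W] W(1) by metis
  have QF: "?Q \<subseteq> \<Union>F" using F W(2) by blast
  have clA: "compact (C \<union> A)" if A: "A \<in> components (?S - C)" for A
  proof -
    have "A \<subseteq> ?S - C" using A in_components_subset by blast
    then have "closure A \<subseteq> ?S" by (intro closure_minimal) auto
    moreover obtain T where "closed T" "A = (?S - C) \<inter> T"
      using closedin_component[OF A] unfolding closedin_closed by blast
    then have "(?S - C) \<inter> closure A \<subseteq> A" using closure_minimal[of A T] by blast
    ultimately have "C \<union> A = C \<union> closure A" using closure_subset by blast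
    moreover have "compact (closure A)" using \<open>A \<subseteq> ?S - C\<close> bounded_subset[of ?S A] by (auto simp: compact_closure)
    ultimately show ?thesis using C(1) by (simp add: compact_Un)
  qed
  note obt = that
  show ?thesis
  proof (rule ccontr)
    assume "\<not> thesis"
    then have cc: "connected_component (- (C \<union> A)) z w" if "A \<in> components (?S - C)" for A
      using obt clA[OF that] that by blast
    (* Janiszewski's theorem adds one component at a time, since C \<union> A and C \<union> A' meet in C. *)
    have fin: "finite H \<Longrightarrow> H \<subseteq> components (?S - C) \<Longrightarrow>
       compact (C \<union> \<Union>H) \<and> connected_component (- (C \<union> \<Union>H)) z w" for H
    proof (induction H rule: finite_induct)
      case empty
      have "connected_component (- C) z w"
        unfolding connected_component_def using C(3) z w by (intro exI[of _ "- C"]) auto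
      then show ?case using C(1) by simp
    next
      case (insert A H)
      have "A \<in> components (?S - C)" using insert by auto
      have disj: "A \<inter> \<Union>H = {}"
      proof -
        have "A \<inter> A' = {}" if "A' \<in> H" for A'
          using that insert components_nonoverlap[of A "?S - C" A'] by auto
        then show ?thesis by auto
      qed
      have "connected_component (- ((C \<union> A) \<union> (C \<union> \<Union>H))) z w"
      proof (rule Janiszewski)
        show "compact (C \<union> A)" using clA insert by auto
        show "closed (C \<union> \<Union>H)" using insert compact_imp_closed by auto
        have "(C \<union> A) \<inter> (C \<union> \<Union>H) = C" using disj by blast
        then show "connected ((C \<union> A) \<inter> (C \<union> \<Union>H))" using C(2) by simp
        show "connected_component (- (C \<union> A)) z w" using cc insert by auto
        show "connected_component (- (C \<union> \<Union>H)) z w" using insert by auto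
      qed
      moreover have "(C \<union> A) \<union> (C \<union> \<Union>H) = C \<union> \<Union>(insert A H)" by auto
      moreover have "compact ((C \<union> A) \<union> (C \<union> \<Union>H))" 
        using compact_Un[OF clA[of A], of "C \<union> \<Union>H"] insert by blast
      ultimately show ?case by simp
    qed
    have "connected_component (- ((C \<union> \<Union>F) \<union> (C \<union> (?S - \<Union>F)))) z w"
    proof (rule Janiszewski)
      show "compact (C \<union> \<Union>F)" "connected_component (- (C \<union> \<Union>F)) z w" using fin[OF F(2,1)] by auto
      have "openin (top_of_set ?S) (\<Union>F)" using opA F by blast
      then have "closedin (top_of_set ?S) (?S - \<Union>F)" by auto
      then have "closed (?S - \<Union>F)" using closedin_closed_trans closed_sphere by blast
      then show "closed (C \<union> (?S - \<Union>F))" using C(1) compact_imp_closed by auto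
      have "(C \<union> \<Union>F) \<inter> (C \<union> (?S - \<Union>F)) = C" by blast
      then show "connected ((C \<union> \<Union>F) \<inter> (C \<union> (?S - \<Union>F)))" using C(2) by simp
      show "connected_component (- (C \<union> (?S - \<Union>F))) z w"
        unfolding connected_component_def
        using \<gamma> QF connected_path_image[OF \<gamma>(1)] pathstart_in_path_image[of \<gamma>] pathfinish_in_path_image[of \<gamma>]
        by (intro exI[of _ "path_image \<gamma>"]) auto
    qed
    then obtain T where T: "connected T" "T \<subseteq> - ((C \<union> \<Union>F) \<union> (C \<union> (?S - \<Union>F)))" "z \<in> T" "w \<in> T"
      unfolding connected_component_def by blast
    have "w \<notin> ball x r" using w(1) by auto
    then have "T \<inter> frontier (ball x r) \<noteq> {}"
      using connected_Int_frontier[OF T(1), of "ball x r"] T(3,4) z by blast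
    moreover have "frontier (ball x r) = ?S" using z by (intro frontier_ball) (auto simp: not_le intro: le_less_trans[OF zero_le_dist])
    ultimately show False using T(2) by auto
  qed
qed

section \<open>Images of crosscuts under the boundary correspondence\<close>

context end_pair begin

text \<open>All points of \<open>C\<close> share one partner, and by symmetry only they have it. The
  second part is the injectivity of the matching; it keeps images of points off \<open>C\<close>
  apart from the partner of \<open>C\<close>.\<close>

lemma image_component:
  assumes C: "C \<in> components K"
  shows "end_graph K L f `` C \<in> components L"
    "(z, p) \<in> end_graph K L f \<Longrightarrow> p \<in> end_graph K L f `` C \<longleftrightarrow> z \<in> C"
proof -
  obtain k where k: "k \<in> K" "C = cc K k" using C by (auto simp: components_def)
  obtain p0 where p0: "end_rel K L f k p0" using end_graph_total k end_graph_in by blast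
  have CK: "C \<subseteq> K" using k connected_component_subset by blast
  have all: "end_rel K L f j p0" if "j \<in> C" for j using end_rel_left[OF p0] k that by blast
  have E: "end_graph K L f `` C = cc L p0"
  proof
    show "end_graph K L f `` C \<subseteq> cc L p0"
      using all end_rel_unique_right CK end_graph_in by fastforce
    show "cc L p0 \<subseteq> end_graph K L f `` C"
      using end_rel_component_right[OF p0] k end_graph_in by (metis Image_iff connected_component_refl_eq mem_Collect_eq subsetI)
  qed
  have "p0 \<in> L" using p0 end_rel_def by blast
  then show "end_graph K L f `` C \<in> components L" unfolding E by (simp add: componentsI)
  show "p \<in> end_graph K L f `` C \<longleftrightarrow> z \<in> C" if zp: "(z, p) \<in> end_graph K L f" for z p
  proof
    assume "p \<in> end_graph K L f `` C"
    then have p: "connected_component L p0 p" using E by blast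
    then have "end_rel K L f k p" using end_rel_component_right p0 by blast
    moreover have "p \<in> L" using p connected_component_in by blast
    then have "end_rel K L f z p" using zp end_graph_in_iff end_graph_in by blast
    ultimately show "z \<in> C" using end_rel_left k by blast
  qed (use zp in blast)
qed

text \<open>A connected set avoiding the image \<open>X\<close> may run through \<open>L\<close>,
  where \<open>g\<close> gives no pull-back. Hence \<open>L\<close> is added first: \<open>Y\<close>
  separates, because \<open>g\<close> pulls a connection back. Then some component \<open>D\<close>
  of \<open>Y\<close> separates. It meets \<open>X\<close>, since a component of \<open>L\<close>
  has connected complement; and it lies in \<open>X\<close>, since \<open>X\<close> contains every
  component of \<open>L\<close> that it meets and the other components of \<open>L\<close> can be
  split off from \<open>Y\<close>.\<close>

lemma crosscut_image_separates:
  assumes C: "C \<in> components K" and A: "A \<inter> C = {}" "compact (C \<union> A)"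
    and z: "z \<notin> K" and w: "w \<notin> K"
    and sep: "\<not> connected_component (- (C \<union> A)) z w"
  shows "\<not> connected_component (- (end_graph K L f `` (C \<union> A))) (f z) (f w)"
proof -
  define X where "X = end_graph K L f `` (C \<union> A)"
  have cX: "compact X" unfolding X_def using compact_end_graph_image(1)[OF A(2)] .
  define Y where "Y = L \<union> X"
  have cY: "closed Y" unfolding Y_def using cX L(1) compact_imp_closed by blast
  have Xsub: "p \<in> f ` (A - K)" if p: "p \<in> X" "p \<notin> L" for p
  proof -
    obtain y where y: "y \<in> C \<union> A" "(y, p) \<in> end_graph K L f" using p X_def by auto
    then have "y \<notin> K" using p end_graph_in_iff by blast
    moreover from this have "y \<in> A" using y C in_components_subset by blast
    ultimately show ?thesis using y end_graph_notin by blast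
  qed
  have Xsup: "f y \<in> X" if "y \<in> A" "y \<notin> K" for y
    using that end_graph_notin unfolding X_def by blast
  have "\<not> connected_component (- Y) (f z) (f w)"
  proof
    assume "connected_component (- Y) (f z) (f w)"
    then obtain T where T: "connected T" "T \<subseteq> - Y" "f z \<in> T" "f w \<in> T"
      unfolding connected_component_def by auto
    have TL: "T \<subseteq> - L" using T(2) Y_def by auto
    have "connected (g ` T)" using T(1) continuous_on_subset[OF cont_g TL] connected_continuous_image by blast
    moreover have "g ` T \<subseteq> - (C \<union> A)"
    proof -
      have "g t \<notin> C \<union> A" if t: "t \<in> T" for t
      proof -
        have tL: "t \<notin> L" using t TL by blast
        then have "g t \<notin> C" using C in_components_subset g_in by blast
        moreover have "g t \<notin> A" using Xsup[of "g t"] tL t T(2) by (auto simp: Y_def)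
        ultimately show ?thesis by simp
      qed
      then show ?thesis by auto
    qed
    moreover have "z \<in> g ` T" "w \<in> g ` T" using T z w by (metis gf image_eqI)+
    ultimately show False using sep unfolding connected_component_def by blast
  qed
  then obtain D where D: "D \<in> components Y" "\<not> connected_component (- D) (f z) (f w)"
    using separation_by_component_closed_pointwise[OF cY] by blast
  have DY: "D \<subseteq> Y" and conD: "connected D" and Dne: "D \<noteq> {}"
    using D(1) in_components_subset in_components_connected in_components_nonempty by blast+
  have "D \<inter> X \<noteq> {}"
  proof
    assume "D \<inter> X = {}"
    then have "D \<subseteq> L" using DY Y_def by auto
    then obtain P where P: "P \<in> components L" "D \<subseteq> P"
      using exists_component_superset[of D L] conD Dne by blast
    have "connected (- P)" using component_complement_connected[of "- L" P] L(2) P(1) by simp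
    moreover have "- L \<subseteq> - P" using P(1) in_components_subset by blast
    ultimately have "connected_component (- D) (f z) (f w)"
      unfolding connected_component_def using P(2) z w by (intro exI[of _ "- P"]) auto
    then show False using D(2) by blast
  qed
  moreover have "D \<subseteq> X"
  proof (rule ccontr)
    assume "\<not> D \<subseteq> X"
    then obtain y where y: "y \<in> D" "y \<notin> X" by blast
    then have yL: "y \<in> L" using DY Y_def by blast
    let ?E = "cc L y"
    have E: "?E \<in> components L" using yL by (simp add: componentsI)
    have EX: "?E \<subseteq> - X"
    proof
      fix q assume q: "q \<in> ?E"
      show "q \<in> - X"
      proof
        assume "q \<in> X"
        then obtain j where j: "j \<in> C \<union> A" "(j, q) \<in> end_graph K L f" using X_def by auto
        have "q \<in> L" using q connected_component_subset by blast
        then have jK: "j \<in> K" using j end_graph_in_iff by blast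
        then have "end_rel K L f j q" using j end_graph_in by blast
        then have "end_rel K L f j y" using end_rel_component_right q connected_component_sym
          by (metis mem_Collect_eq)
        then show False using y(2) j(1) jK end_graph_in unfolding X_def by blast
      qed
    qed
    have "compact ?E" using E L(1) compact_components by blast
    then obtain H where H: "openin (top_of_set L) H" "compact H" "?E \<subseteq> H" "H \<subseteq> - X"
      using Sura_Bura_clopen_subset[of L ?E "- X"] E EX cX L(1)
      by (metis closed_imp_locally_compact compact_imp_closed open_Compl)
    have HL: "H \<subseteq> L" using H(1) openin_imp_subset by blast
    have "closedin (top_of_set L) (L - H)" using H(1) by auto
    then have "closed (L - H)" using L(1) closedin_closed_trans compact_imp_closed by blast
    then have c2: "closed ((L - H) \<union> X)" using cX compact_imp_closed by blast
    have yH: "y \<in> H" using H(3) yL by auto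
    have "D \<subseteq> H \<union> ((L - H) \<union> X)" using DY Y_def by auto
    moreover have "H \<inter> ((L - H) \<union> X) \<inter> D = {}" using H(4) by auto
    ultimately have "H \<inter> D = {} \<or> ((L - H) \<union> X) \<inter> D = {}"
      using connected_closedD[OF conD, of H "(L - H) \<union> X"] H(2) c2 compact_imp_closed by auto
    then show False using yH y(1) \<open>D \<inter> X \<noteq> {}\<close> by blast
  qed
  ultimately have "\<not> connected_component (- X) (f z) (f w)"
    using D(2) connected_component_of_subset[of "- X" "f z" "f w" "- D"] by blast
  then show ?thesis unfolding X_def .
qed

text \<open>Suppose \<open>f z\<close> were outside the disc. Then \<open>T\<close>, which lies in
  the disc, does not separate it from \<open>f w\<close>, and neither does the partner
  \<open>P\<close> of \<open>C\<close>, as the complement of \<open>L\<close> is connected. Their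
  intersection is \<open>M\<close>, so their union would not separate either, against
  \<open>crosscut_image_separates\<close>. The size of \<open>P\<close> never enters. The closure is
  taken because the image of the arc may accumulate at \<open>P\<close>.\<close>

lemma crosscut_image_bound:
  assumes C: "C \<in> components K" and A: "A \<inter> C = {}" "compact (C \<union> A)"
    and z: "z \<notin> K" and w: "w \<notin> K"
    and sep: "\<not> connected_component (- (C \<union> A)) z w"
    and M: "closed M" "connected M" "M \<subseteq> end_graph K L f `` C"
      "end_graph K L f `` C \<inter> closure (end_graph K L f `` A) \<subseteq> M"
    and B: "closure (end_graph K L f `` A) \<union> M \<subseteq> cball p \<rho>" "f w \<notin> cball p \<rho>"
  shows "f z \<in> cball p \<rho>"
proof (rule ccontr)
  assume nz: "f z \<notin> cball p \<rho>"
  define P where "P = end_graph K L f `` C"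
  define T where "T = closure (end_graph K L f `` A) \<union> M"
  have P: "P \<in> components L" unfolding P_def using image_component(1)[OF C] .
  have "connected_component (- (P \<union> T)) (f z) (f w)"
  proof (rule Janiszewski)
    show "compact P" using P L(1) compact_components by blast
    show "closed T" unfolding T_def using M(1) by auto
    have "P \<inter> T = M" using M unfolding P_def T_def by blast
    then show "connected (P \<inter> T)" using M(2) by simp
    show "connected_component (- P) (f z) (f w)"
      unfolding connected_component_def using L(2) z w P in_components_subset
      by (intro exI[of _ "- L"]) auto
    have "connected (- cball p \<rho>)" by (intro connected_complement_bounded_convex) auto
    then show "connected_component (- T) (f z) (f w)"
      unfolding connected_component_def using nz B by (intro exI[of _ "- cball p \<rho>"]) (auto simp: T_def)
  qed
  moreover have "end_graph K L f `` (C \<union> A) \<subseteq> P \<union> T"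
    unfolding P_def T_def using closure_subset by blast
  ultimately have "connected_component (- (end_graph K L f `` (C \<union> A))) (f z) (f w)"
    by (meson Compl_subset_Compl_iff connected_component_of_subset)
  then show False using crosscut_image_separates[OF C A z w sep] by blast
qed

end

section \<open>Area and length\<close>

lemma lborel_complex_eq_prod:
  "lborel = distr (lborel \<Otimes>\<^sub>M lborel) borel (\<lambda>(x, y). Complex x y)"
proof (rule lborel_eqI)
  have m: "(\<lambda>(x, y). Complex x y) \<in> (lborel \<Otimes>\<^sub>M lborel) \<rightarrow>\<^sub>M borel"
    by (simp add: lborel_prod case_prod_unfold borel_measurable_continuous_onI continuous_intros)
  fix l u :: complex assume lu: "\<And>b. b \<in> Basis \<Longrightarrow> l \<bullet> b \<le> u \<bullet> b"
  have le: "Re l \<le> Re u" "Im l \<le> Im u" using lu[of 1] lu[of \<i>] by (auto simp: Basis_complex_def)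
  have "(\<lambda>(x, y). Complex x y) -` box l u = {Re l<..<Re u} \<times> {Im l<..<Im u}"
    by (auto simp: in_box_complex_iff)
  then have "emeasure (distr (lborel \<Otimes>\<^sub>M lborel) borel (\<lambda>(x, y). Complex x y)) (box l u) =
      emeasure (lborel \<Otimes>\<^sub>M lborel) ({Re l<..<Re u} \<times> {Im l<..<Im u})"
    by (simp add: emeasure_distr[OF m] space_pair_measure)
  also have "\<dots> = ennreal (Re u - Re l) * ennreal (Im u - Im l)"
    using le by (simp add: lborel.emeasure_pair_measure_Times)
  also have "\<dots> = (\<Prod>b\<in>Basis. (u - l) \<bullet> b)"
    using le by (simp add: Basis_complex_def ennreal_mult)
  finally show "emeasure (distr (lborel \<Otimes>\<^sub>M lborel) borel (\<lambda>(x, y). Complex x y)) (box l u) =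
    (\<Prod>b\<in>Basis. (u - l) \<bullet> b)" .
qed simp

lemma nn_integral_complex:
  assumes [measurable]: "F \<in> borel_measurable borel"
  shows "(\<integral>\<^sup>+z. F z \<partial>lborel) = (\<integral>\<^sup>+x. \<integral>\<^sup>+y. F (Complex x y) \<partial>lborel \<partial>lborel)"
proof -
  have m[measurable]: "(\<lambda>(x, y). Complex x y) \<in> (lborel \<Otimes>\<^sub>M lborel) \<rightarrow>\<^sub>M borel"
    by (simp add: lborel_prod case_prod_unfold borel_measurable_continuous_onI continuous_intros)
  have "(\<integral>\<^sup>+z. F z \<partial>lborel) = (\<integral>\<^sup>+p. F (case p of (x, y) \<Rightarrow> Complex x y) \<partial>(lborel \<Otimes>\<^sub>M lborel))"
    by (subst lborel_complex_eq_prod, subst nn_integral_distr) auto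
  also have "\<dots> = (\<integral>\<^sup>+x. \<integral>\<^sup>+y. F (Complex x y) \<partial>lborel \<partial>lborel)"
    by (subst lborel.nn_integral_fst[symmetric]) auto
  finally show ?thesis .
qed

text \<open>Complex numbers are moved to \<open>real^2\<close>, where the change of variables is
  expressed by the determinant of the derivative matrix.\<close>

definition vec_of_complex :: "complex \<Rightarrow> real^2" where "vec_of_complex z = vector [Re z, Im z]"
definition complex_of_vec :: "real^2 \<Rightarrow> complex" where "complex_of_vec v = Complex (v $ 1) (v $ 2)"

lemma vec_of_complex_inverse [simp]: "vec_of_complex (complex_of_vec v) = v" "complex_of_vec (vec_of_complex z) = z"
  by (auto simp: vec_of_complex_def complex_of_vec_def vec_eq_iff forall_2)

lemma vec_of_complex_inject [simp]: "vec_of_complex z = vec_of_complex w \<longleftrightarrow> z = w" and complex_of_vec_inject [simp]: "complex_of_vec a = complex_of_vec b \<longleftrightarrow> a = b"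
  by (metis vec_of_complex_inverse)+

lemma bounded_linear_complex_of_vec: "bounded_linear complex_of_vec" and bounded_linear_vec_of_complex: "bounded_linear vec_of_complex"
  unfolding linear_conv_bounded_linear[symmetric]
  by (auto intro!: linearI simp: complex_of_vec_def vec_of_complex_def complex_eq_iff vec_eq_iff forall_2)

lemmas continuous_complex_of_vec = linear_continuous_on[OF bounded_linear_complex_of_vec]
  and continuous_vec_of_complex = linear_continuous_on[OF bounded_linear_vec_of_complex]

lemma lborel_complex_eq_vec: "lborel = distr lborel borel complex_of_vec"
proof (rule lborel_eqI)
  have m: "complex_of_vec \<in> lborel \<rightarrow>\<^sub>M borel"
    using borel_measurable_continuous_onI[OF continuous_complex_of_vec] by simp
  fix l u :: complex assume lu: "\<And>b. b \<in> Basis \<Longrightarrow> l \<bullet> b \<le> u \<bullet> b"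
  have le: "Re l \<le> Re u" "Im l \<le> Im u" using lu[of 1] lu[of \<i>] by (auto simp: Basis_complex_def)
  have B: "(Basis :: (real^2) set) = {axis 1 1, axis 2 1}" by (auto simp: Basis_vec_def UNIV_2)
  have "complex_of_vec -` box l u = box (vec_of_complex l) (vec_of_complex u)"
    by (auto simp: in_box_complex_iff mem_box_cart complex_of_vec_def vec_of_complex_def forall_2)
  moreover have "emeasure lborel (box (vec_of_complex l) (vec_of_complex u)) = (\<Prod>b\<in>Basis. (u - l) \<bullet> b)"
    using le by (subst emeasure_lborel_box)
      (auto simp: B inner_axis vec_of_complex_def Basis_complex_def axis_eq_axis)
  ultimately show "emeasure (distr lborel borel complex_of_vec) (box l u) = (\<Prod>b\<in>Basis. (u - l) \<bullet> b)"
    by (simp add: emeasure_distr[OF m])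
qed simp

lemma nn_integral_complex_vec:
  assumes [measurable]: "F \<in> borel_measurable borel"
  shows "(\<integral>\<^sup>+z. F z \<partial>lborel) = (\<integral>\<^sup>+v. F (complex_of_vec v) \<partial>lborel)"
proof -
  have m[measurable]: "complex_of_vec \<in> lborel \<rightarrow>\<^sub>M borel"
    using borel_measurable_continuous_onI[OF continuous_complex_of_vec] by simp
  show ?thesis by (subst lborel_complex_eq_vec, subst nn_integral_distr) auto
qed

text \<open>The Jacobian determinant of a holomorphic map is the squared modulus of its derivative,
  so by change of variables the integral is the area of an injective image, which is open and
  bounded.\<close>

lemma area_holomorphic_image:
  fixes h :: "complex \<Rightarrow> complex"
  assumes h: "h holomorphic_on E" and E: "open E" and inj: "inj_on h E" and bd: "bounded (h ` E)"
  shows "(\<integral>\<^sup>+z. ennreal ((cmod (deriv h z))\<^sup>2) * indicator E z \<partial>lborel) < \<infinity>"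
proof -
  define S where "S = vec_of_complex ` E"
  define G where "G = (\<lambda>v. vec_of_complex (h (complex_of_vec v)))"
  have S: "S = complex_of_vec -` E" by (auto simp: S_def image_iff) (metis vec_of_complex_inverse)
  have oS: "open S" unfolding S using E continuous_complex_of_vec by (rule open_vimage)
  have injG: "inj_on G S"
    unfolding G_def S by (rule inj_onI) (use inj inj_onD in fastforce)
  have GS: "G ` S = vec_of_complex ` h ` E" unfolding G_def S_def by (simp add: image_image)
  have "open (h ` E)" using open_mapping_thm3[OF h E inj] .
  have "G ` S = complex_of_vec -` (h ` E)" unfolding GS by (auto simp: image_iff) (metis vec_of_complex_inverse)
  then have "open (G ` S)" using open_vimage[OF \<open>open (h ` E)\<close> continuous_complex_of_vec] by simp
  moreover have "bounded (G ` S)" unfolding GS using bd bounded_linear_image bounded_linear_vec_of_complex by blast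
  ultimately have lm: "G ` S \<in> lmeasurable" by (rule lmeasurable_open[rotated])
  define G' where "G' v w = vec_of_complex (deriv h (complex_of_vec v) * complex_of_vec w)" for v w
  have der: "(G has_derivative G' v) (at v within S)" if "v \<in> S" for v
  proof -
    have "(h has_field_derivative deriv h (complex_of_vec v)) (at (complex_of_vec v))"
      using h E that S holomorphic_derivI by (metis vimageD)
    then have d: "(h has_derivative (\<lambda>w. deriv h (complex_of_vec v) * w)) (at (complex_of_vec v))"
      by (simp add: has_field_derivative_def)
    have "(complex_of_vec has_derivative complex_of_vec) (at v)" using bounded_linear_complex_of_vec by (rule bounded_linear_imp_has_derivative)
    then have "((\<lambda>v. h (complex_of_vec v)) has_derivative (\<lambda>w. deriv h (complex_of_vec v) * complex_of_vec w)) (at v)"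
      using has_derivative_compose d by blast
    then have "((\<lambda>v. vec_of_complex (h (complex_of_vec v))) has_derivative (\<lambda>w. vec_of_complex (deriv h (complex_of_vec v) * complex_of_vec w))) (at v)"
      by (rule bounded_linear.has_derivative[OF bounded_linear_vec_of_complex])
    then show ?thesis unfolding G_def G'_def using has_derivative_at_withinI by blast
  qed
  have det: "\<bar>det (matrix (G' v))\<bar> = (cmod (deriv h (complex_of_vec v)))\<^sup>2" for v
    unfolding cmod_power2
    by (simp add: det_2 matrix_def G'_def vec_of_complex_def complex_of_vec_def axis_def power2_eq_square)
  have "(\<lambda>v. \<bar>det (matrix (G' v))\<bar>) integrable_on S"
    using measurable_differentiable_image_eq[OF _ der injG] lm oS by auto
  then obtain I where I: "((\<lambda>v. (cmod (deriv h (complex_of_vec v)))\<^sup>2) has_integral I) S"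
    unfolding det by blast
  have m: "(\<lambda>z. ennreal ((cmod (deriv h z))\<^sup>2) * indicator E z) \<in> borel_measurable borel"
  proof -
    have "(\<lambda>z. if z \<in> E then (cmod (deriv h z))\<^sup>2 else 0) \<in> borel_measurable borel"
    proof (rule borel_measurable_continuous_on_if)
      show "continuous_on E (\<lambda>z. (cmod (deriv h z))\<^sup>2)"
        by (intro continuous_intros holomorphic_on_imp_continuous_on holomorphic_deriv h E)
    qed (use E in auto)
    then have "(\<lambda>z. ennreal (if z \<in> E then (cmod (deriv h z))\<^sup>2 else 0)) \<in> borel_measurable borel" by simp
    moreover have "(\<lambda>z. ennreal (if z \<in> E then (cmod (deriv h z))\<^sup>2 else 0)) =
        (\<lambda>z. ennreal ((cmod (deriv h z))\<^sup>2) * indicator E z)"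
      by (auto simp: fun_eq_iff)
    ultimately show ?thesis by simp
  qed
  have "(\<integral>\<^sup>+z. ennreal ((cmod (deriv h z))\<^sup>2) * indicator E z \<partial>lborel) =
     (\<integral>\<^sup>+v. ennreal ((cmod (deriv h (complex_of_vec v)))\<^sup>2) * indicator E (complex_of_vec v) \<partial>lborel)"
    by (rule nn_integral_complex_vec[OF m])
  also have "\<dots> = (\<integral>\<^sup>+v. ennreal ((cmod (deriv h (complex_of_vec v)))\<^sup>2) * indicator S v \<partial>lborel)"
    unfolding S by (simp add: indicator_def)
  also have "\<dots> = ennreal I"
    using nn_integral_has_integral_lebesgue[OF _ I] by (simp add: indicator_mult_ennreal mult.commute)
  finally show ?thesis by simp
qed

section \<open>Outer measure and countable covers\<close>

lemma outer_measure_of_UN_nat_le: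
  assumes "\<And>n. A n \<subseteq> space M"
  shows "outer_measure_of M (\<Union>n::nat. A n) \<le> (\<Sum>n. outer_measure_of M (A n))"
proof -
  have "\<forall>n. \<exists>E\<in>sets M. A n \<subseteq> E \<and> outer_measure_of M (A n) = emeasure M E"
    using outer_measure_of_attain[OF assms] by simp
  then obtain E where E: "\<And>n. E n \<in> sets M" "\<And>n. A n \<subseteq> E n" "\<And>n. outer_measure_of M (A n) = emeasure M (E n)"
    by metis
  have "outer_measure_of M (\<Union>n. A n) \<le> outer_measure_of M (\<Union>n. E n)"
    using E(2) by (intro outer_measure_of_mono) blast
  also have "\<dots> = emeasure M (\<Union>n. E n)" using E(1) by (intro outer_measure_of_eq) auto
  also have "\<dots> \<le> (\<Sum>n. emeasure M (E n))" using E(1) by (intro emeasure_subadditive_countably) auto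
  finally show ?thesis using E(3) by simp
qed

text \<open>Outer measure is used since the projected images are not shown to be measurable. A bound
  on all finite partial sums takes the place of an infinite sum, which suits countable families of
  components that come without an enumeration.\<close>

lemma outer_measure_of_UN_le:
  fixes c :: "'i \<Rightarrow> ennreal"
  assumes I: "countable I" and A: "\<And>i. i \<in> I \<Longrightarrow> A i \<subseteq> space M"
    and c: "\<And>i. i \<in> I \<Longrightarrow> outer_measure_of M (A i) \<le> c i"
    and fin: "\<And>F. finite F \<Longrightarrow> F \<subseteq> I \<Longrightarrow> sum c F \<le> C"
  shows "outer_measure_of M (\<Union>i\<in>I. A i) \<le> C"
proof -
  define e where "e = to_nat_on I"
  have inj: "inj_on e I" unfolding e_def using I by (rule inj_on_to_nat_on)
  define b where "b n = (\<Union>i\<in>{i \<in> I. e i = n}. A i)" for n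
  have "(\<Union>i\<in>I. A i) = (\<Union>n. b n)" by (auto simp: b_def)
  then have "outer_measure_of M (\<Union>i\<in>I. A i) \<le> (\<Sum>n. outer_measure_of M (b n))"
    using outer_measure_of_UN_nat_le[of b M] A by (auto simp: b_def)
  also have "\<dots> \<le> C" unfolding suminf_eq_SUP
  proof (rule SUP_least)
    fix N
    define F where "F = {i \<in> I. e i < N}"
    have "finite (e ` F)" by (rule finite_subset[of _ "{..<N}"]) (auto simp: F_def)
    moreover have "inj_on e F" using inj by (rule inj_on_subset) (auto simp: F_def)
    ultimately have F: "finite F" by (rule finite_imageD)
    have b1: "outer_measure_of M (b n) \<le> (\<Sum>i\<in>{i\<in>F. e i = n}. c i)" if "n < N" for n
    proof (cases "\<exists>i\<in>I. e i = n")
      case True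
      then obtain i where i: "i \<in> I" "e i = n" by blast
      then have "{j \<in> I. e j = n} = {i}" "{j\<in>F. e j = n} = {i}"
        using inj that by (auto simp: F_def inj_on_def)
      then show ?thesis using c[OF i(1)] by (simp add: b_def)
    next
      case False
      then have "b n = {}" by (auto simp: b_def)
      then show ?thesis by (simp add: outer_measure_of_eq)
    qed
    have "(\<Sum>n<N. outer_measure_of M (b n)) \<le> (\<Sum>n<N. \<Sum>i\<in>{i\<in>F. e i = n}. c i)"
      using b1 by (intro sum_mono) auto
    also have "\<dots> = sum c F" using F by (subst sum.group) (auto simp: F_def)
    also have "\<dots> \<le> C" using fin F by (auto simp: F_def)
    finally show "(\<Sum>n<N. outer_measure_of M (b n)) \<le> C" .
  qed
  finally show ?thesis .
qed

section \<open>Projected length of curves and circles\<close>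

lemma dist_le_nn_integral_deriv:
  fixes u u' :: "real \<Rightarrow> real"
  assumes S: "\<And>t. t \<in> closed_segment a b \<Longrightarrow> (u has_real_derivative u' t) (at t)"
    and c: "continuous_on (closed_segment a b) u'" and I: "closed_segment a b \<subseteq> I"
  shows "ennreal \<bar>u b - u a\<bar> \<le> (\<integral>\<^sup>+t. ennreal \<bar>u' t\<bar> * indicator I t \<partial>lborel)"
proof -
  have *: "ennreal \<bar>u b - u a\<bar> \<le> (\<integral>\<^sup>+t. ennreal \<bar>u' t\<bar> * indicator {a..b} t \<partial>lborel)"
    if ab: "a \<le> b" and der: "\<And>t. t \<in> {a..b} \<Longrightarrow> (u has_real_derivative u' t) (at t)"
      and c: "continuous_on {a..b} u'" for a b
  proof -
    have i: "(u' has_integral (u b - u a)) {a..b}"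
      using der ab has_real_derivative_iff_has_vector_derivative has_vector_derivative_at_within
      by (intro fundamental_theorem_of_calculus) blast+
    have ci: "(\<lambda>t. \<bar>u' t\<bar>) integrable_on {a..b}"
      using c by (intro integrable_continuous_real continuous_intros)
    have "\<bar>u b - u a\<bar> \<le> integral {a..b} (\<lambda>t. \<bar>u' t\<bar>)"
      using integral_norm_bound_integral[of u' "{a..b}" "\<lambda>t. \<bar>u' t\<bar>"] i ci
      by (auto simp: has_integral_iff)
    moreover have "(\<integral>\<^sup>+t. ennreal \<bar>u' t\<bar> * indicator {a..b} t \<partial>lborel) = ennreal (integral {a..b} (\<lambda>t. \<bar>u' t\<bar>))"
    proof -
      have "(\<lambda>t. ennreal \<bar>u' t\<bar> * indicator {a..b} t) = (\<lambda>t. ennreal (indicator {a..b} t * \<bar>u' t\<bar>))"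
        by (auto simp: fun_eq_iff indicator_def)
      then show ?thesis using nn_integral_has_integral_lebesgue[OF _ integrable_integral[OF ci]] by simp
    qed
    ultimately show ?thesis by (simp add: ennreal_leI)
  qed
  have "ennreal \<bar>u b - u a\<bar> \<le> (\<integral>\<^sup>+t. ennreal \<bar>u' t\<bar> * indicator (closed_segment a b) t \<partial>lborel)"
  proof (cases "a \<le> b")
    case True
    then have "closed_segment a b = {a..b}" by (simp add: closed_segment_eq_real_ivl)
    then show ?thesis using *[OF True] S c by simp
  next
    case False
    then have e: "closed_segment a b = {b..a}" by (simp add: closed_segment_eq_real_ivl)
    then show ?thesis using *[of b a] False S c by (simp add: abs_minus_commute)
  qed
  also have "\<dots> \<le> (\<integral>\<^sup>+t. ennreal \<bar>u' t\<bar> * indicator I t \<partial>lborel)"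
    using I by (intro nn_integral_mono mult_left_mono) (auto simp: indicator_def)
  finally show ?thesis .
qed

text \<open>Each component \<open>I\<close> of \<open>D\<close> is an interval on which
  \<open>u\<close> moves by at most the integral of \<open>\<bar>u' t\<bar>\<close>, so
  \<open>u\<close> maps it into a ball with that radius; the factor 2 is the length of such a ball.
  The integrals over the components add up to at most the integral over \<open>D\<close>.\<close>

lemma outer_measure_image_le:
  fixes u u' :: "real \<Rightarrow> real"
  assumes D: "open D" and u: "\<And>t. t \<in> D \<Longrightarrow> (u has_real_derivative u' t) (at t)"
    and c: "continuous_on D u'"
  shows "outer_measure_of lborel (u ` D) \<le> 2 * (\<integral>\<^sup>+t. ennreal \<bar>u' t\<bar> * indicator D t \<partial>lborel)"
proof -
  define \<nu> where "\<nu> A = (\<integral>\<^sup>+t. ennreal \<bar>u' t\<bar> * indicator A t \<partial>lborel)" for A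
  have m: "(\<lambda>t. ennreal \<bar>u' t\<bar> * indicator I t) \<in> borel_measurable borel" if "open I" "I \<subseteq> D" for I
  proof -
    have "(\<lambda>t. if t \<in> I then \<bar>u' t\<bar> else 0) \<in> borel_measurable borel"
      using that continuous_on_subset[OF c that(2)]
      by (intro borel_measurable_continuous_on_if) (auto intro!: continuous_intros)
    then have "(\<lambda>t. ennreal (if t \<in> I then \<bar>u' t\<bar> else 0)) \<in> borel_measurable borel" by simp
    moreover have "(\<lambda>t. ennreal (if t \<in> I then \<bar>u' t\<bar> else 0)) = (\<lambda>t. ennreal \<bar>u' t\<bar> * indicator I t)"
      by (auto simp: fun_eq_iff)
    ultimately show ?thesis by simp
  qed
  have "u ` D = (\<Union>I\<in>components D. u ` I)" using Union_components[of D] by blast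
  moreover have "outer_measure_of lborel (\<Union>I\<in>components D. u ` I) \<le> 2 * \<nu> D"
  proof (rule outer_measure_of_UN_le)
    show "countable (components D)" 
      using open_components[OF D] pairwise_disjoint_components[of D]
      by (intro countable_disjoint_open_subsets) (auto simp: pairwise_def disjnt_def)
    show "outer_measure_of lborel (u ` I) \<le> 2 * \<nu> I" if I: "I \<in> components D" for I
    proof (cases "\<nu> I = \<infinity>")
      case False
      then have fin: "\<nu> I = ennreal (enn2real (\<nu> I))" by (simp add: less_top)
      obtain t0 where t0: "t0 \<in> I" using I in_components_nonempty by blast
      have ID: "I \<subseteq> D" and cI: "convex I"
        using I in_components_subset in_components_connected is_interval_connected_1 is_interval_convex_1 by blast+
      have "u ` I \<subseteq> cball (u t0) (enn2real (\<nu> I))"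
      proof
        fix y assume "y \<in> u ` I"
        then obtain t where t: "t \<in> I" "y = u t" by blast
        have "closed_segment t0 t \<subseteq> I" using cI t0 t convex_contains_segment by blast
        then have seg: "closed_segment t0 t \<subseteq> I" "closed_segment t0 t \<subseteq> D" using ID by auto
        have "ennreal \<bar>u t - u t0\<bar> \<le> \<nu> I" unfolding \<nu>_def
          by (rule dist_le_nn_integral_deriv[OF _ continuous_on_subset[OF c seg(2)] seg(1)])
            (use u seg(2) in auto)
        then have "\<bar>u t - u t0\<bar> \<le> enn2real (\<nu> I)" using fin by (metis ennreal_le_iff enn2real_nonneg)
        then show "y \<in> cball (u t0) (enn2real (\<nu> I))" using t by (simp add: dist_real_def abs_minus_commute)
      qed
      then have "outer_measure_of lborel (u ` I) \<le> outer_measure_of lborel (cball (u t0) (enn2real (\<nu> I)))"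
        by (rule outer_measure_of_mono)
      also have "\<dots> = emeasure lborel (cball (u t0) (enn2real (\<nu> I)))" by (intro outer_measure_of_eq) auto
      also have "\<dots> = ennreal (2 * enn2real (\<nu> I))"
        unfolding cball_eq_atLeastAtMost by (subst emeasure_lborel_Icc) auto
      also have "\<dots> = 2 * \<nu> I" by (subst (2) fin) (simp add: ennreal_mult)
      finally show ?thesis .
    qed (simp add: ennreal_mult_top)
    show "sum (\<lambda>I. 2 * \<nu> I) F \<le> 2 * \<nu> D" if F: "finite F" "F \<subseteq> components D" for F
    proof -
      have FD: "open I \<and> I \<subseteq> D" if "I \<in> F" for I
        using that F open_components[OF D] in_components_subset by blast
      have "(\<Sum>I\<in>F. \<nu> I) = (\<integral>\<^sup>+t. (\<Sum>I\<in>F. ennreal \<bar>u' t\<bar> * indicator I t) \<partial>lborel)"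
        unfolding \<nu>_def using m FD by (subst nn_integral_sum) auto
      also have "\<dots> \<le> \<nu> D" unfolding \<nu>_def
      proof (rule nn_integral_mono)
        fix t
        have "(\<Sum>I\<in>F. indicator I t :: ennreal) = indicator (\<Union>F) t"
        proof (rule indicator_UN_disjoint[of F id, simplified, symmetric])
          show "disjoint_family_on id F"
            using F(2) components_nonoverlap by (fastforce simp: disjoint_family_on_def)
        qed fact
        also have "\<dots> \<le> indicator D t" using FD by (auto simp: indicator_def)
        finally show "(\<Sum>I\<in>F. ennreal \<bar>u' t\<bar> * indicator I t) \<le> ennreal \<bar>u' t\<bar> * indicator D t"
          unfolding sum_distrib_left[symmetric] by (rule mult_left_mono) simp
      qed
      finally show ?thesis unfolding sum_distrib_left[symmetric] by (rule mult_left_mono) simp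
    qed
  qed auto
  ultimately show ?thesis unfolding \<nu>_def by simp
qed


text \<open>The length of the image of the part of the circle in \<open>U\<close>, possibly
  infinite. The open parameter interval leaves out one point of the circle and matches the strip on
  which \<open>exp\<close> is injective.\<close>

definition circle_length :: "(complex \<Rightarrow> complex) \<Rightarrow> complex set \<Rightarrow> complex \<Rightarrow> real \<Rightarrow> ennreal" where
  "circle_length f U x r =
     (\<integral>\<^sup>+t. ennreal (cmod (deriv f (x + of_real r * cis t)) * r) *
        indicator {t. 0 < t \<and> t < 2 * pi \<and> x + of_real r * cis t \<in> U} t \<partial>lborel)"

lemma inj_on_exp_strip: "inj_on exp {z. 0 < Im z \<and> Im z < 2 * pi}"
proof (rule inj_onI)
  fix a b assume a: "a \<in> {z. 0 < Im z \<and> Im z < 2 * pi}" and b: "b \<in> {z. 0 < Im z \<and> Im z < 2 * pi}"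
    and eq: "exp a = exp b"
  obtain n :: int where n: "a = b + of_int (2 * n) * pi * \<i>" using eq exp_eq by metis
  then have "Im a - Im b = 2 * pi * n" by simp
  then have "\<bar>2 * pi * real_of_int n\<bar> < 2 * pi * 1" using a b by auto
  then have "2 * pi * \<bar>real_of_int n\<bar> < 2 * pi * 1" by (simp add: abs_mult)
  then have "\<bar>real_of_int n\<bar> < 1" by (subst (asm) mult_less_cancel_left_pos) auto
  then have "n = 0" by linarith
  then show "a = b" using n by simp
qed

lemma emeasure_lborel_lessThan: "emeasure lborel {..<a::real} = \<infinity>"
proof (rule ccontr)
  assume "emeasure lborel {..<a} \<noteq> \<infinity>"
  then obtain c where c: "c \<ge> 0" "emeasure lborel {..<a} = ennreal c"
    by (metis ennreal_cases infinity_ennreal_def)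
  have "emeasure lborel {a - (c + 1)..<a} \<le> emeasure lborel {..<a}" by (intro emeasure_mono) auto
  then have "ennreal (c + 1) \<le> ennreal c" using c by simp
  then show False using c by (simp add: ennreal_le_iff)
qed

text \<open>The length-area argument in the variable \<open>s = ln r\<close>. The integral of
  \<open>Q\<close> over all circles is the area of an injective image inside a bounded set, while a
  Cauchy-Schwarz type bound keeps \<open>Q\<close> above a positive constant on every circle that is
  not short. If the short radii were countable, this would hold for almost every \<open>s\<close>
  below \<open>ln R\<close>, a half-line of infinite length.\<close>

lemma uncountable_short_circles:
  assumes f: "f holomorphic_on U" and U: "open U" and inj: "inj_on f U"
    and bd: "bounded (f ` (U \<inter> ball x R))" and R: "R > 0" and e: "\<epsilon> > 0"
  shows "uncountable {r \<in> {0<..<R}. circle_length f U x r \<le> ennreal \<epsilon>}"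
proof
  assume cnt: "countable {r \<in> {0<..<R}. circle_length f U x r \<le> ennreal \<epsilon>}"
  (* In logarithmic polar coordinates the circles about x become vertical segments. *)
  define E where "E = {z. Re z < ln R \<and> 0 < Im z \<and> Im z < 2 * pi} \<inter> (\<lambda>z. x + exp z) -` U"
  define h where "h = (\<lambda>z. f (x + exp z))"
  have oE: "open E" unfolding E_def
    by (intro open_Int open_vimage U open_Collect_conj open_Collect_less continuous_intros)
  have expR: "cmod (exp z) < R" if "z \<in> E" for z
  proof -
    have "exp (Re z) < exp (ln R)" using that by (simp add: E_def)
    then show ?thesis using R by simp
  qed
  have "(\<lambda>z. x + exp z) holomorphic_on E" by (intro holomorphic_intros)
  moreover have "(\<lambda>z. x + exp z) ` E \<subseteq> U" by (auto simp: E_def)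
  ultimately have hol: "h holomorphic_on E"
    using holomorphic_on_compose_gen[of "\<lambda>z. x + exp z" E f U] f unfolding h_def by (simp add: o_def)
  have injh: "inj_on h E"
  proof (rule inj_onI)
    fix a b assume ab: "a \<in> E" "b \<in> E" "h a = h b"
    then have "x + exp a \<in> U" "x + exp b \<in> U" by (auto simp: E_def)
    then have "x + exp a = x + exp b" using inj_onD[OF inj] ab(3) unfolding h_def by blast
    then have "exp a = exp b" by simp
    then show "a = b" by (rule inj_onD[OF inj_on_exp_strip]) (use ab in \<open>auto simp: E_def\<close>)
  qed
  have "h ` E \<subseteq> f ` (U \<inter> ball x R)" using expR by (auto simp: h_def E_def dist_norm)
  then have "bounded (h ` E)" using bd bounded_subset by blast
  then have area: "(\<integral>\<^sup>+z. ennreal ((cmod (deriv h z))\<^sup>2) * indicator E z \<partial>lborel) < \<infinity>"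
    using area_holomorphic_image[OF hol oE injh] by blast
  have cd: "continuous_on E (\<lambda>z. cmod (deriv h z))"
    by (intro continuous_intros holomorphic_on_imp_continuous_on holomorphic_deriv hol oE)
  define F where "F z = (if z \<in> E then cmod (deriv h z) else 0)" for z
  have mF[measurable]: "F \<in> borel_measurable borel" unfolding F_def
    by (intro borel_measurable_continuous_on_if cd) (use oE in auto)
  have Fsq: "ennreal ((cmod (deriv h z))\<^sup>2) * indicator E z = ennreal ((F z)\<^sup>2)" for z
    by (simp add: F_def)
  define Q where "Q s = (\<integral>\<^sup>+t. ennreal ((F (Complex s t))\<^sup>2) \<partial>lborel)" for s
  have mC: "(\<lambda>(s, t). Complex s t) \<in> lborel \<Otimes>\<^sub>M lborel \<rightarrow>\<^sub>M borel"
    by (simp add: lborel_prod case_prod_unfold borel_measurable_continuous_onI continuous_intros)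
  have "(\<lambda>p. ennreal ((F (case p of (s, t) \<Rightarrow> Complex s t))\<^sup>2)) \<in> borel_measurable (lborel \<Otimes>\<^sub>M lborel)"
    using mC by measurable
  then have "(\<lambda>(s, t). ennreal ((F (Complex s t))\<^sup>2)) \<in> borel_measurable (lborel \<Otimes>\<^sub>M lborel)"
    by (simp add: case_prod_unfold)
  then have mQ[measurable]: "Q \<in> borel_measurable lborel" unfolding Q_def
    by (rule lborel.borel_measurable_nn_integral)
  have areaQ: "(\<integral>\<^sup>+s. Q s \<partial>lborel) < \<infinity>"
    using area unfolding Fsq Q_def by (subst (asm) nn_integral_complex) auto
  \<comment> \<open>The modulus of the inner derivative of \<open>h\<close> is the radius
    \<open>exp s\<close>, so \<open>F\<close> is exactly the integrand of
    \<open>circle_length\<close>.\<close>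
  have CL: "circle_length f U x (exp s) = (\<integral>\<^sup>+t. ennreal (F (Complex s t)) \<partial>lborel)" if s: "s < ln R" for s
    unfolding circle_length_def
  proof (rule nn_integral_cong)
    fix t
    have ex: "exp (Complex s t) = of_real (exp s) * cis t" by (simp add: exp_eq_polar)
    show "ennreal (cmod (deriv f (x + of_real (exp s) * cis t)) * exp s) *
        indicator {t. 0 < t \<and> t < 2 * pi \<and> x + of_real (exp s) * cis t \<in> U} t = ennreal (F (Complex s t))"
    proof (cases "Complex s t \<in> E")
      case True
      then have "x + exp (Complex s t) \<in> U" by (simp add: E_def)
      then have "(f has_field_derivative deriv f (x + exp (Complex s t))) (at (x + exp (Complex s t)))"
        using f U holomorphic_derivI by blast
      then have "(h has_field_derivative deriv f (x + exp (Complex s t)) * exp (Complex s t)) (at (Complex s t))"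
        unfolding h_def by (rule DERIV_chain2) (auto intro!: derivative_eq_intros)
      then have "deriv h (Complex s t) = deriv f (x + exp (Complex s t)) * exp (Complex s t)"
        by (rule DERIV_imp_deriv)
      then show ?thesis using True by (simp add: F_def E_def ex norm_mult)
    next
      case False
      then have "t \<notin> {t. 0 < t \<and> t < 2 * pi \<and> x + of_real (exp s) * cis t \<in> U}"
        using s by (auto simp: E_def ex)
      then show ?thesis using False by (simp add: F_def)
    qed
  qed
  \<comment> \<open>Weight in the inequality \<open>F \<le> \<eta> / 2 + F^2 / (2 * \<eta>)\<close>,
    which avoids square roots of possibly infinite integrals. Over the interval of length 2 pi the
    first term integrates to \<epsilon> / 2.\<close>
  define \<eta> where "\<eta> = \<epsilon> / (2 * pi)"
  have \<eta>: "\<eta> > 0" using e by (simp add: \<eta>_def)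
  have amgm: "(\<integral>\<^sup>+t. ennreal (F (Complex s t)) \<partial>lborel) \<le> ennreal (\<epsilon> / 2) + ennreal (1 / (2 * \<eta>)) * Q s" for s
  proof -
    have pt: "ennreal (F (Complex s t)) \<le> ennreal (\<eta> / 2) * indicator {0..2*pi} t + ennreal (1 / (2 * \<eta>)) * ennreal ((F (Complex s t))\<^sup>2)" for t
    proof (cases "Complex s t \<in> E")
      case True
      then have t: "t \<in> {0..2*pi}" by (simp add: E_def)
      have "0 \<le> (F (Complex s t) - \<eta>)\<^sup>2" by simp
      then have "2 * \<eta> * F (Complex s t) \<le> \<eta>\<^sup>2 + (F (Complex s t))\<^sup>2"
        by (simp add: power2_eq_square algebra_simps)
      then have "F (Complex s t) \<le> \<eta> / 2 + 1 / (2 * \<eta>) * (F (Complex s t))\<^sup>2"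
        using \<eta> by (simp add: field_simps power2_eq_square)
      then have "ennreal (F (Complex s t)) \<le> ennreal (\<eta> / 2 + 1 / (2 * \<eta>) * (F (Complex s t))\<^sup>2)"
        by (rule ennreal_leI)
      also have "\<dots> = ennreal (\<eta> / 2) + ennreal (1 / (2 * \<eta>)) * ennreal ((F (Complex s t))\<^sup>2)"
        using \<eta> by (simp only: ennreal_mult'[symmetric] ennreal_plus zero_le_power2 zero_le_mult_iff
          zero_le_divide_iff less_imp_le zero_le_one zero_le_numeral simp_thms)
      finally show ?thesis using t by simp
    qed (simp add: F_def)
    have "(\<integral>\<^sup>+t. ennreal (F (Complex s t)) \<partial>lborel) \<le>
        (\<integral>\<^sup>+t. ennreal (\<eta> / 2) * indicator {0..2*pi} t + ennreal (1 / (2 * \<eta>)) * ennreal ((F (Complex s t))\<^sup>2) \<partial>lborel)"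
      by (rule nn_integral_mono) (rule pt)
    also have "\<dots> = ennreal (\<eta> / 2) * emeasure lborel {0..2*pi} + ennreal (1 / (2 * \<eta>)) * Q s"
    proof -
      have [measurable]: "(\<lambda>t. Complex s t) \<in> borel \<rightarrow>\<^sub>M borel"
        by (intro borel_measurable_continuous_onI continuous_intros)
      show ?thesis unfolding Q_def
        by (subst nn_integral_add) (auto simp: nn_integral_cmult nn_integral_cmult_indicator)
    qed
    also have "ennreal (\<eta> / 2) * emeasure lborel {0..2*pi} = ennreal (\<epsilon> / 2)"
      using e by (simp add: \<eta>_def ennreal_mult'[symmetric] )
    finally show ?thesis .
  qed
  \<comment> \<open>With \<open>Q s\<close> at most this threshold, the second term stays within
    \<epsilon> / 2 as well.\<close>
  define c where "c = \<eta> * \<epsilon>"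
  have c: "c > 0" using \<eta> e by (simp add: c_def)
  define N where "N = ln ` {r \<in> {0<..<R}. circle_length f U x r \<le> ennreal \<epsilon>}"
  have "countable N" unfolding N_def using cnt by blast
  then have N: "N \<in> null_sets lborel" by (rule countable_imp_null_set_lborel)
  have low: "ennreal c \<le> Q s" if s: "s < ln R" "s \<notin> N" for s
  proof (rule ccontr)
    assume "\<not> ennreal c \<le> Q s"
    then have "Q s \<le> ennreal c" by simp
    then have "ennreal (1 / (2 * \<eta>)) * Q s \<le> ennreal (1 / (2 * \<eta>)) * ennreal c" by (rule mult_left_mono) simp
    also have "\<dots> = ennreal (\<epsilon> / 2)" using \<eta> e by (simp add: ennreal_mult'[symmetric] c_def)
    finally have "(\<integral>\<^sup>+t. ennreal (F (Complex s t)) \<partial>lborel) \<le> ennreal (\<epsilon> / 2) + ennreal (\<epsilon> / 2)"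
      using amgm[of s] by (meson add_left_mono order_trans)
    also have "\<dots> = ennreal \<epsilon>" using e by (subst ennreal_plus[symmetric]) auto
    finally have "circle_length f U x (exp s) \<le> ennreal \<epsilon>" using CL[OF s(1)] by simp
    moreover have "exp s < R" using s(1) R by (metis exp_less_cancel_iff exp_ln)
    ultimately have "exp s \<in> {r \<in> {0<..<R}. circle_length f U x r \<le> ennreal \<epsilon>}" by simp
    then have "ln (exp s) \<in> N" unfolding N_def by (rule imageI)
    then show False using s(2) by simp
  qed
  have "\<infinity> = ennreal c * emeasure lborel {..<ln R}" using c by (simp add: emeasure_lborel_lessThan ennreal_mult_top)
  also have "\<dots> = (\<integral>\<^sup>+s. ennreal c * indicator {..<ln R} s \<partial>lborel)" by (simp add: nn_integral_cmult_indicator)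
  also have "\<dots> \<le> (\<integral>\<^sup>+s. Q s \<partial>lborel)"
  proof (rule nn_integral_mono_AE)
    show "AE s in lborel. ennreal c * indicator {..<ln R} s \<le> Q s"
      using AE_not_in[OF N]
    proof eventually_elim
      case (elim s)
      then show ?case using low[of s] by (cases "s < ln R") auto
    qed
  qed
  finally show False using areaQ by simp
qed

lemma outer_measure_circle_image:
  assumes f: "f holomorphic_on U" and U: "open U" and e: "norm e = 1" and r: "r > 0"
  shows "outer_measure_of lborel ((\<lambda>z. f z \<bullet> e) ` (U \<inter> sphere x r)) \<le> 2 * circle_length f U x r"
proof -
  define D where "D = {t. 0 < t \<and> t < 2 * pi \<and> x + of_real r * cis t \<in> U}"
  define u where "u t = f (x + of_real r * cis t) \<bullet> e" for t
  define u' where "u' t = (deriv f (x + of_real r * cis t) * (of_real r * (\<i> * cis t))) \<bullet> e" for t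
  have D_eq: "D = {0<..<2*pi} \<inter> (\<lambda>t. x + of_real r * cis t) -` U" by (auto simp: D_def)
  have oD: "open D" unfolding D_eq by (intro open_Int open_vimage U continuous_intros open_greaterThanLessThan)
  have der: "(u has_real_derivative u' t) (at t)" if "t \<in> D" for t
  proof -
    have "x + of_real r * cis t \<in> U" using that by (simp add: D_def)
    then have d: "(f has_field_derivative deriv f (x + of_real r * cis t)) (at (x + of_real r * cis t))"
      using f U holomorphic_derivI by blast
    have "((\<lambda>t. x + of_real r * cis t) has_vector_derivative of_real r * (\<i> * cis t)) (at t)"
      unfolding cis_conv_exp
      by (auto intro!: derivative_eq_intros has_vector_derivative_real_field simp: mult_ac)
    then have "((\<lambda>t. f (x + of_real r * cis t)) has_vector_derivative
        of_real r * (\<i> * cis t) * deriv f (x + of_real r * cis t)) (at t)"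
      using field_vector_diff_chain_at[of "\<lambda>t. x + of_real r * cis t" "of_real r * (\<i> * cis t)" t f] d by (simp add: o_def)
    then have "((\<lambda>t. f (x + of_real r * cis t) \<bullet> e) has_vector_derivative
        (of_real r * (\<i> * cis t) * deriv f (x + of_real r * cis t)) \<bullet> e) (at t)"
      by (rule bounded_linear.has_vector_derivative[OF bounded_linear_inner_left])
    then show ?thesis unfolding u_def u'_def has_real_derivative_iff_has_vector_derivative by (simp add: mult_ac)
  qed
  have cu: "continuous_on D u'" unfolding u'_def
  proof (intro continuous_intros)
    have "continuous_on U (deriv f)" by (intro holomorphic_on_imp_continuous_on holomorphic_deriv f U)
    moreover have "continuous_on D (\<lambda>t. x + of_real r * cis t)" by (intro continuous_intros)
    moreover have "(\<lambda>t. x + of_real r * cis t) ` D \<subseteq> U" by (auto simp: D_def)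
    ultimately show "continuous_on D (\<lambda>t. deriv f (x + of_real r * cis t))"
      using continuous_on_compose2 by blast
  qed
  \<comment> \<open>The parameter 0 is missing in \<open>circle_length\<close>; the one point that
    belongs to it is inserted here and has measure zero.\<close>
  have sub: "(\<lambda>z. f z \<bullet> e) ` (U \<inter> sphere x r) \<subseteq> insert (f (x + of_real r) \<bullet> e) (u ` D)"
  proof
    fix y assume "y \<in> (\<lambda>z. f z \<bullet> e) ` (U \<inter> sphere x r)"
    then obtain z where z: "z \<in> U" "dist x z = r" "y = f z \<bullet> e" by auto
    define t where "t = Arg2pi (z - x)"
    have "cmod (z - x) = r" using z(2) by (simp add: dist_norm norm_minus_commute)
    then have zt: "z = x + of_real r * cis t"
      using Arg2pi_eq[of "z - x"] unfolding t_def cis_conv_exp by (simp add: mult_ac)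
    have t: "0 \<le> t" "t < 2 * pi" unfolding t_def by (simp_all add: Arg2pi_ge_0 Arg2pi_lt_2pi)
    show "y \<in> insert (f (x + of_real r) \<bullet> e) (u ` D)"
    proof (cases "t = 0")
      case True then show ?thesis using z zt by simp
    next
      case False
      then have "t \<in> D" "y = u t" using t z zt by (auto simp: D_def u_def)
      then show ?thesis by blast
    qed
  qed
  define A where "A n = (if n = 0 then u ` D else if n = 1 then {f (x + of_real r) \<bullet> e} else {})" for n :: nat
  have "insert (f (x + of_real r) \<bullet> e) (u ` D) = (\<Union>n. A n)"
    by (auto simp: A_def split: if_splits)
  then have "outer_measure_of lborel ((\<lambda>z. f z \<bullet> e) ` (U \<inter> sphere x r)) \<le> outer_measure_of lborel (\<Union>n. A n)"
    using outer_measure_of_mono[OF sub] by simp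
  also have "\<dots> \<le> (\<Sum>n. outer_measure_of lborel (A n))" by (rule outer_measure_of_UN_nat_le) simp
  also have "\<dots> = (\<Sum>n<2. outer_measure_of lborel (A n))"
    by (rule suminf_finite) (auto simp: A_def outer_measure_of_eq)
  also have "\<dots> = outer_measure_of lborel (u ` D)" by (simp add: A_def numeral_2_eq_2 outer_measure_of_eq)
  also have "\<dots> \<le> 2 * (\<integral>\<^sup>+t. ennreal \<bar>u' t\<bar> * indicator D t \<partial>lborel)"
    by (rule outer_measure_image_le[OF oD der cu])
  also have "\<dots> \<le> 2 * circle_length f U x r" unfolding circle_length_def D_def[symmetric]
  proof (intro mult_left_mono nn_integral_mono mult_right_mono ennreal_leI)
    fix t
    have "\<bar>u' t\<bar> \<le> norm (deriv f (x + of_real r * cis t) * (of_real r * (\<i> * cis t))) * norm e"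
      unfolding u'_def by (rule Cauchy_Schwarz_ineq2)
    then show "\<bar>u' t\<bar> \<le> cmod (deriv f (x + of_real r * cis t)) * r" using e r by (simp add: norm_mult)
  qed auto
  finally show ?thesis .
qed

section \<open>Linear measure\<close>

lemma linear_premeasure_le:
  assumes "A \<subseteq> (\<Union>n. U n)" "\<And>n::nat. bounded (U n)" "\<And>n. diameter (U n) \<le> \<delta>"
  shows "linear_premeasure \<delta> A \<le> (\<Sum>n. ennreal (diameter (U n)))"
  unfolding linear_premeasure_def by (rule INF_lower) (use assms in auto)

lemma linear_premeasure_mono: "A \<subseteq> B \<Longrightarrow> linear_premeasure \<delta> A \<le> linear_premeasure \<delta> B"
  unfolding linear_premeasure_def by (rule INF_superset_mono) auto

lemma linear_premeasure_antimono: "\<delta> \<le> \<delta>' \<Longrightarrow> linear_premeasure \<delta>' A \<le> linear_premeasure \<delta> A"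
  unfolding linear_premeasure_def by (rule INF_superset_mono) (auto intro: order_trans)

lemma linear_measure_mono: "A \<subseteq> B \<Longrightarrow> linear_measure A \<le> linear_measure B"
  unfolding linear_measure_def by (intro SUP_mono') (rule linear_premeasure_mono)

lemma linear_premeasure_le_measure: "\<delta> > 0 \<Longrightarrow> linear_premeasure \<delta> A \<le> linear_measure A"
  unfolding linear_measure_def by (rule SUP_upper) auto

lemma linear_premeasure_cover:
  assumes "linear_premeasure \<delta> A < c"
  obtains U where "A \<subseteq> (\<Union>n. U n)" "\<And>n::nat. bounded (U n)" "\<And>n. diameter (U n) \<le> \<delta>"
    "(\<Sum>n. ennreal (diameter (U n))) < c"
  using assms unfolding linear_premeasure_def INF_less_iff by blast

lemma linear_measure_empty: "linear_measure ({} :: 'a::metric_space set) = 0"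
proof -
  have "linear_premeasure \<delta> ({} :: 'a set) = 0" if "\<delta> > 0" for \<delta>
    using linear_premeasure_le[of "{}" "\<lambda>_. {}" \<delta>] that by simp
  then show ?thesis unfolding linear_measure_def by (simp add: SUP_eq_const)
qed

lemma linear_premeasure_UN:
  "linear_premeasure \<delta> (\<Union>i::nat. A i) \<le> (\<Sum>i. linear_premeasure \<delta> (A i))"
proof (rule ennreal_le_epsilon)
  fix e :: real assume fin: "(\<Sum>i. linear_premeasure \<delta> (A i)) < top" and e: "0 < e"
  have "\<exists>U. A i \<subseteq> (\<Union>n. U n) \<and> (\<forall>n::nat. bounded (U n)) \<and> (\<forall>n. diameter (U n) \<le> \<delta>) \<and>
      (\<Sum>n. ennreal (diameter (U n))) \<le> linear_premeasure \<delta> (A i) + ennreal (e * (1/2) ^ Suc i)" for i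
  proof -
    have "linear_premeasure \<delta> (A i) < top"
      using ennreal_suminf_lessD[OF fin] by simp
    then have "linear_premeasure \<delta> (A i) < linear_premeasure \<delta> (A i) + ennreal (e * (1/2) ^ Suc i)"
      using e by (cases "linear_premeasure \<delta> (A i)") (auto simp: ennreal_plus[symmetric] ennreal_less_iff simp del: ennreal_plus)
    then show ?thesis
      using linear_premeasure_cover[of \<delta> "A i" "linear_premeasure \<delta> (A i) + ennreal (e * (1/2) ^ Suc i)"]
      by (metis less_imp_le)
  qed
  then obtain U where U: "\<And>i. A i \<subseteq> (\<Union>n. U i n)" "\<And>i n::nat. bounded (U i n)"
    "\<And>i n. diameter (U i n) \<le> \<delta>"
    "\<And>i. (\<Sum>n. ennreal (diameter (U i n))) \<le> linear_premeasure \<delta> (A i) + ennreal (e * (1/2) ^ Suc i)"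
    by metis
  define V where "V m = (case prod_decode m of (i, n) \<Rightarrow> U i n)" for m
  have "(\<Union>i. A i) \<subseteq> (\<Union>m. V m)"
  proof
    fix x assume "x \<in> (\<Union>i. A i)"
    then obtain i n where "x \<in> U i n" using U(1) by blast
    then have "x \<in> V (prod_encode (i, n))" by (simp add: V_def)
    then show "x \<in> (\<Union>m. V m)" by blast
  qed
  then have "linear_premeasure \<delta> (\<Union>i. A i) \<le> (\<Sum>m. ennreal (diameter (V m)))"
    by (rule linear_premeasure_le) (auto simp: V_def U split: prod.split)
  also have "\<dots> = (\<Sum>i. \<Sum>n. ennreal (diameter (U i n)))"
  proof -
    have "(\<Sum>m. (\<lambda>(i, n). ennreal (diameter (U i n))) (prod_decode m)) = (\<Sum>i. \<Sum>n. ennreal (diameter (U i n)))"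
      by (rule suminf_ennreal_2dimen) simp
    then show ?thesis by (simp add: V_def case_prod_unfold)
  qed
  also have "\<dots> \<le> (\<Sum>i. linear_premeasure \<delta> (A i) + ennreal (e * (1/2) ^ Suc i))"
    by (intro suminf_le U(4)) auto
  also have "\<dots> = (\<Sum>i. linear_premeasure \<delta> (A i)) + (\<Sum>i. ennreal (e * (1/2) ^ Suc i))"
    by (rule suminf_add[symmetric]) auto
  also have "(\<Sum>i. ennreal (e * (1/2) ^ Suc i)) = ennreal e"
    using e sums_mult[OF power_half_series, of e] by (intro suminf_ennreal_eq) auto
  finally show "linear_premeasure \<delta> (\<Union>i. A i) \<le> (\<Sum>i. linear_premeasure \<delta> (A i)) + ennreal e" .
qed

lemma linear_measure_UN:
  "linear_measure (\<Union>i::nat. A i) \<le> (\<Sum>i. linear_measure (A i))"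
  unfolding linear_measure_def[of "\<Union>i. A i"]
proof (rule SUP_least)
  fix \<delta> :: real assume "\<delta> \<in> {0<..}"
  then have "(\<Sum>i. linear_premeasure \<delta> (A i)) \<le> (\<Sum>i. linear_measure (A i))"
    by (intro suminf_le linear_premeasure_le_measure) auto
  then show "linear_premeasure \<delta> (\<Union>i. A i) \<le> (\<Sum>i. linear_measure (A i))"
    using linear_premeasure_UN order_trans by blast
qed

section \<open>Caratheodory measurability of Borel sets\<close>

lemma linear_measure_Un: "linear_measure (A \<union> B) \<le> linear_measure A + linear_measure B"
proof -
  define S where "S n = (if n = 0 then A else if n = 1 then B else {})" for n :: nat
  have "A \<union> B = (\<Union>n. S n)" by (auto simp: S_def split: if_splits)
  then have "linear_measure (A \<union> B) \<le> (\<Sum>n. linear_measure (S n))" using linear_measure_UN[of S] by simp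
  also have "\<dots> = (\<Sum>n<2. linear_measure (S n))"
    by (rule suminf_finite) (auto simp: S_def linear_measure_empty)
  finally show ?thesis by (simp add: S_def numeral_2_eq_2)
qed

text \<open>A set of diameter below \<open>d\<close> cannot meet both \<open>A\<close> and
  \<open>B\<close>, so a fine cover of the union splits into a cover of \<open>A\<close> and a cover
  of \<open>B\<close>.\<close>

lemma linear_measure_metric_additive:
  assumes d: "d > 0" "\<And>x y. x \<in> A \<Longrightarrow> y \<in> B \<Longrightarrow> d \<le> dist x y"
  shows "linear_measure A + linear_measure B \<le> linear_measure (A \<union> B)"
proof -
  have small: "linear_premeasure \<delta> A + linear_premeasure \<delta> B \<le> linear_premeasure \<delta> (A \<union> B)" if "\<delta> < d" for \<delta>
    unfolding linear_premeasure_def[of \<delta> "A \<union> B"]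
  proof (rule INF_greatest)
    fix U :: "nat \<Rightarrow> 'a set"
    assume "U \<in> {U. A \<union> B \<subseteq> (\<Union>n. U n) \<and> (\<forall>n. bounded (U n) \<and> diameter (U n) \<le> \<delta>)}"
    then have U: "A \<union> B \<subseteq> (\<Union>n. U n)" "\<And>n. bounded (U n)" "\<And>n. diameter (U n) \<le> \<delta>" by auto
    have \<delta>0: "0 \<le> \<delta>" using U(3)[of 0] diameter_ge_0[OF U(2)[of 0]] by linarith
    define V where "V S n = (if U n \<inter> S \<noteq> {} then U n else {})" for S n
    have V: "linear_premeasure \<delta> S \<le> (\<Sum>n. ennreal (diameter (V S n)))" if "S \<subseteq> A \<union> B" for S
    proof (rule linear_premeasure_le)
      show "S \<subseteq> (\<Union>n. V S n)"
      proof
        fix x assume "x \<in> S"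
        then have "x \<in> (\<Union>n. U n)" using U(1) \<open>S \<subseteq> A \<union> B\<close> by blast
        then obtain n where "x \<in> U n" by blast
        then show "x \<in> (\<Union>n. V S n)" using \<open>x \<in> S\<close> by (auto simp: V_def)
      qed
    qed (use U(2,3) \<delta>0 in \<open>auto simp: V_def\<close>)
    have "ennreal (diameter (V A n)) + ennreal (diameter (V B n)) \<le> ennreal (diameter (U n))" for n
    proof -
      have "U n \<inter> A = {} \<or> U n \<inter> B = {}"
      proof (rule ccontr)
        assume "\<not> ?thesis"
        then obtain x y where xy: "x \<in> U n" "x \<in> A" "y \<in> U n" "y \<in> B" by blast
        then have "dist x y \<le> diameter (U n)" using diameter_bounded_bound U(2) by blast
        then show False using d(2)[of x y] xy U(3)[of n] that by linarith
      qed
      then show ?thesis by (auto simp: V_def)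
    qed
    then have "(\<Sum>n. ennreal (diameter (V A n)) + ennreal (diameter (V B n))) \<le> (\<Sum>n. ennreal (diameter (U n)))"
      by (intro suminf_le) auto
    moreover have "(\<Sum>n. ennreal (diameter (V A n)) + ennreal (diameter (V B n))) =
        (\<Sum>n. ennreal (diameter (V A n))) + (\<Sum>n. ennreal (diameter (V B n)))"
      by (rule suminf_add[symmetric]) auto
    ultimately show "linear_premeasure \<delta> A + linear_premeasure \<delta> B \<le> (\<Sum>n. ennreal (diameter (U n)))"
      using order_trans[OF add_mono[OF V[of A] V[of B]]] by simp
  qed
  have "linear_premeasure a A + linear_premeasure b B \<le> linear_measure (A \<union> B)" if "a > 0" "b > 0" for a b
  proof -
    define \<delta> where "\<delta> = min (min a b) (d/2)"
    have \<delta>: "\<delta> > 0" "\<delta> < d" "\<delta> \<le> a" "\<delta> \<le> b" using that d(1) by (auto simp: \<delta>_def)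
    have "linear_premeasure a A + linear_premeasure b B \<le> linear_premeasure \<delta> A + linear_premeasure \<delta> B"
      using \<delta> by (intro add_mono linear_premeasure_antimono)
    also have "\<dots> \<le> linear_measure (A \<union> B)"
      using small[OF \<delta>(2)] linear_premeasure_le_measure[OF \<delta>(1)] order_trans by blast
    finally show ?thesis .
  qed
  then have "(SUP a\<in>{0<..}. linear_premeasure a A) + linear_premeasure b B \<le> linear_measure (A \<union> B)" if "b > 0" for b
    using that by (subst ennreal_SUP_add_left[symmetric]) (auto intro!: SUP_least)
  then have "linear_premeasure b B + linear_measure A \<le> linear_measure (A \<union> B)" if "b > 0" for b
    using that by (simp add: linear_measure_def add.commute)
  then have "(SUP b\<in>{0<..}. linear_premeasure b B) + linear_measure A \<le> linear_measure (A \<union> B)"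
    by (subst ennreal_SUP_add_left[symmetric]) (auto intro!: SUP_least)
  then show ?thesis by (simp add: linear_measure_def add.commute)
qed

text \<open>Caratheodory's criterion: the layers \<open>S k\<close> with \<open>k\<close> of the same parity have mutually
  positive distances, so the sum of their measures converges.\<close>

lemma linear_measure_closed_split:
  fixes F T :: "'a::metric_space set"
  assumes F: "closed F"
  shows "linear_measure (T \<inter> F) + linear_measure (T - F) \<le> linear_measure T"
proof (cases "linear_measure T = \<infinity> \<or> F = {}")
  case True
  then show ?thesis by (auto simp: linear_measure_empty)
next
  case False
  then have fin: "linear_measure T \<noteq> \<infinity>" and ne: "F \<noteq> {}" by auto
  define c where "c n = inverse (real (Suc n))" for n
  have c0: "c n > 0" for n by (simp add: c_def)
  have cdec: "c n < c m" if "m < n" for m n using that by (simp add: c_def)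
  define E where "E n = {x \<in> T. infdist x F \<ge> c n}" for n
  define S where "S n = {x \<in> T. c (Suc n) \<le> infdist x F \<and> infdist x F < c n}" for n
  have TF: "T - F = E n \<union> (\<Union>k. S (n + k))" for n
  proof
    show "T - F \<subseteq> E n \<union> (\<Union>k. S (n + k))"
    proof
      fix x assume x: "x \<in> T - F"
      then have pos: "infdist x F > 0"
        using F ne in_closed_iff_infdist_zero infdist_nonneg by (metis DiffD2 order_le_less)
      then obtain m where m: "c m < infdist x F"
        unfolding c_def using reals_Archimedean by blast
      show "x \<in> E n \<union> (\<Union>k. S (n + k))"
      proof (cases "c n \<le> infdist x F")
        case True then show ?thesis using x by (auto simp: E_def)
      next
        case False
        define k where "k = (LEAST k. c k \<le> infdist x F)"
        have k: "c k \<le> infdist x F" 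
          using LeastI[of "\<lambda>k. c k \<le> infdist x F" m] m unfolding k_def by simp
        have "n < k" using False k cdec by (metis not_less_iff_gr_or_eq order_le_less_trans less_imp_le)
        then obtain j where j: "k = Suc j" "n \<le> j" by (cases k) auto
        have "\<not> c j \<le> infdist x F" using not_less_Least[of j "\<lambda>k. c k \<le> infdist x F"] j by (auto simp: k_def)
        then have "x \<in> S j" using k j x by (auto simp: S_def)
        then show ?thesis using j(2) by (metis UN_I UnI2 UNIV_I le_iff_add)
      qed
    qed
    have "x \<notin> F" if "infdist x F \<ge> c m" for x m using that c0[of m] by (metis infdist_zero not_less)
    then show "E n \<union> (\<Union>k. S (n + k)) \<subseteq> T - F" by (auto simp: E_def S_def)
  qed
  have sep: "\<bar>infdist x F - infdist y F\<bar> \<le> dist x y" for x y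
    using infdist_triangle[of x F y] infdist_triangle[of y F x] by (auto simp: dist_commute abs_le_iff)
  have one: "linear_measure (T \<inter> F) + linear_measure (E n) \<le> linear_measure T" for n
  proof -
    have "linear_measure (T \<inter> F) + linear_measure (E n) \<le> linear_measure ((T \<inter> F) \<union> E n)"
    proof (rule linear_measure_metric_additive[OF c0[of n]])
      fix x y assume "x \<in> T \<inter> F" "y \<in> E n"
      then show "c n \<le> dist x y" using sep[of x y] by (auto simp: E_def)
    qed
    also have "\<dots> \<le> linear_measure T" by (intro linear_measure_mono) (auto simp: E_def)
    finally show ?thesis .
  qed
  have parity: "(\<Sum>k<n. linear_measure (S (2 * k + j))) \<le> linear_measure T" for n j
  proof -
    have "(\<Sum>k<n. linear_measure (S (2 * k + j))) \<le> linear_measure (\<Union>k<n. S (2 * k + j))"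
    proof (induction n)
      case (Suc n)
      have "linear_measure (S (2 * n + j)) + linear_measure (\<Union>k<n. S (2 * k + j)) \<le>
          linear_measure (S (2 * n + j) \<union> (\<Union>k<n. S (2 * k + j)))"
      proof (cases "n = 0")
        case False
        \<comment> \<open>The gap between layers of equal parity is at least the thickness of the
          layer \<open>2 * n + j - 1\<close>, which lies between them. The subtraction of 1 is
          genuine because \<open>n\<close> is positive here.\<close>
        define d where "d = c (2 * n + j - 1) - c (2 * n + j)"
        have d: "d > 0" using cdec[of "2 * n + j - 1" "2 * n + j"] False by (simp add: d_def)
        show ?thesis
        proof (rule linear_measure_metric_additive[OF d])
          fix x y assume x: "x \<in> S (2 * n + j)" and "y \<in> (\<Union>k<n. S (2 * k + j))"
          then obtain k where k: "k < n" "y \<in> S (2 * k + j)" by blast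
          have "Suc (2 * k + j) \<le> 2 * n + j - 1" using k by simp
          then have "c (2 * n + j - 1) \<le> c (Suc (2 * k + j))" using cdec by (metis le_less order_refl)
          then have "d \<le> infdist y F - infdist x F" using x k by (auto simp: S_def d_def)
          then show "d \<le> dist x y" using sep[of x y] by linarith
        qed
      qed (simp add: linear_measure_empty)
      moreover have "S (2 * n + j) \<union> (\<Union>k<n. S (2 * k + j)) = (\<Union>k<Suc n. S (2 * k + j))"
        by (auto simp: less_Suc_eq)
      ultimately show ?case using Suc.IH by (simp add: add.commute) (meson add_left_mono order_trans)
    qed simp
    also have "\<dots> \<le> linear_measure T" by (intro linear_measure_mono) (auto simp: S_def)
    finally show ?thesis .
  qed
  have "(\<Sum>k<n. linear_measure (S k)) \<le> 2 * linear_measure T" for n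
  proof -
    have "(\<Sum>k<n. linear_measure (S k)) \<le> (\<Sum>k<2*n. linear_measure (S k))"
      by (intro sum_mono2) auto
    also have "\<dots> = (\<Sum>k<n. linear_measure (S (2 * k))) + (\<Sum>k<n. linear_measure (S (2 * k + 1)))"
      by (induction n) (simp_all add: algebra_simps)
    also have "\<dots> \<le> linear_measure T + linear_measure T"
      using parity[of 0 n] parity[of 1 n] by (intro add_mono) auto
    finally show ?thesis by (simp add: mult_2)
  qed
  then have "(\<Sum>k. linear_measure (S k)) \<le> 2 * linear_measure T"
    unfolding suminf_eq_SUP by (intro SUP_least)
  moreover have "2 * linear_measure T < \<infinity>" using fin by (simp add: ennreal_mult_less_top less_top)
  ultimately have sfin: "(\<Sum>k. linear_measure (S k)) < \<infinity>" by (rule le_less_trans)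
  show ?thesis
  proof (rule ennreal_le_epsilon)
    fix e :: real assume e: "0 < e"
    let ?s = "\<Sum>k. linear_measure (S k)"
    \<comment> \<open>The layers have finite total measure, so their tails become small: for a
      suitable \<open>n\<close> the set \<open>T - F\<close> exceeds \<open>E n\<close> by a set of
      measure at most \<open>e\<close>.\<close>
    have "(\<lambda>n. (\<Sum>k<n. linear_measure (S k)) + ennreal e) \<longlonglongrightarrow> ?s + ennreal e"
      by (intro tendsto_add summable_LIMSEQ) auto
    moreover have "?s < ?s + ennreal e"
      using sfin e by (cases ?s) (auto simp: ennreal_plus[symmetric] ennreal_less_iff simp del: ennreal_plus)
    ultimately obtain n where "?s < (\<Sum>k<n. linear_measure (S k)) + ennreal e"
      using order_tendstoD(1) eventually_happens'[OF sequentially_bot] by blast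
    moreover have "?s = (\<Sum>k. linear_measure (S (k + n))) + (\<Sum>k<n. linear_measure (S k))"
      by (rule suminf_offset) auto
    ultimately have "(\<Sum>k<n. linear_measure (S k)) + (\<Sum>k. linear_measure (S (k + n))) <
        (\<Sum>k<n. linear_measure (S k)) + ennreal e" by (simp add: add.commute)
    then have n: "(\<Sum>k. linear_measure (S (n + k))) < ennreal e"
      by (simp add: ennreal_add_left_cancel_less add.commute)
    have "linear_measure (T - F) \<le> linear_measure (E n) + linear_measure (\<Union>k. S (n + k))"
      unfolding TF[of n] by (rule linear_measure_Un)
    also have "\<dots> \<le> linear_measure (E n) + ennreal e"
      using linear_measure_UN[of "\<lambda>k. S (n + k)"] n by (intro add_left_mono) auto
    finally have "linear_measure (T \<inter> F) + linear_measure (T - F) \<le>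
        linear_measure (T \<inter> F) + (linear_measure (E n) + ennreal e)" by (rule add_left_mono)
    also have "\<dots> \<le> linear_measure T + ennreal e" using one[of n] by (simp add: add.assoc[symmetric] add_right_mono)
    finally show "linear_measure (T \<inter> F) + linear_measure (T - F) \<le> linear_measure T + ennreal e" .
  qed
qed

text \<open>The sets that split every test set additively form a sigma-algebra by Caratheodory's
  theorem. It contains the closed sets, hence all Borel sets. The test set \<open>T\<close> is
  arbitrary, which matters because the pieces of a \<sigma>-finite decomposition are arbitrary
  sets.\<close>

lemma linear_measure_borel_split:
  fixes A T :: "'a::metric_space set"
  assumes A: "A \<in> sets borel"
  shows "linear_measure T = linear_measure (T \<inter> A) + linear_measure (T - A)"
proof -
  interpret P: sigma_algebra UNIV "Pow UNIV :: 'a set set" by (rule sigma_algebra_Pow)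
  have oms: "outer_measure_space (Pow UNIV) (linear_measure :: 'a set \<Rightarrow> ennreal)"
    unfolding outer_measure_space_def positive_def increasing_def countably_subadditive_def
    by (auto simp: linear_measure_empty intro: linear_measure_mono linear_measure_UN)
  let ?L = "lambda_system UNIV (Pow UNIV) (linear_measure :: 'a set \<Rightarrow> ennreal)"
  have "measure_space UNIV ?L linear_measure" by (rule P.caratheodory_lemma[OF oms])
  then have sa: "sigma_algebra UNIV ?L" by (simp add: measure_space_def)
  have "{F. closed F} \<subseteq> ?L"
  proof
    fix F :: "'a set" assume "F \<in> {F. closed F}"
    then have F: "closed F" by simp
    have "linear_measure (T \<inter> F) + linear_measure (T - F) = linear_measure T" for T
      using linear_measure_closed_split[OF F, of T] linear_measure_Un[of "T \<inter> F" "T - F"]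
      by (metis Un_Diff_Int Un_commute antisym)
    then show "F \<in> ?L" unfolding P.lambda_system_eq by auto
  qed
  then have "sigma_sets UNIV {F. closed F} \<subseteq> ?L"
    using sigma_algebra.sigma_sets_subset[OF sa] by blast
  moreover have "A \<in> sigma_sets UNIV {F. closed F}"
    using A unfolding borel_eq_closed by simp
  ultimately have "A \<in> ?L" by blast
  then show ?thesis unfolding P.lambda_system_eq by auto
qed

text \<open>Disjoint Borel sets cut \<open>B\<close> additively, so for each \<open>n\<close> only
  finitely many of them can meet \<open>B\<close> in measure above \<open>inverse (Suc n)\<close>.
  Applied to the shadows of circles, this leaves only countably many exceptional radii.\<close>

lemma countable_disjoint_positive_linear_measure:
  fixes B :: "'a::metric_space set" and A :: "'i \<Rightarrow> 'a set"
  assumes B: "linear_measure B < \<infinity>" and A: "\<And>i. i \<in> I \<Longrightarrow> A i \<in> sets borel"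
    and disj: "disjoint_family_on A I"
  shows "countable {i \<in> I. linear_measure (B \<inter> A i) \<noteq> 0}"
proof -
  have sum: "(\<Sum>i\<in>F. linear_measure (B \<inter> A i)) \<le> linear_measure (B \<inter> (\<Union>i\<in>F. A i))"
    if "finite F" "F \<subseteq> I" for F
    using that
  proof (induction F rule: finite_induct)
    case (insert j F)
    let ?T = "B \<inter> (\<Union>i\<in>insert j F. A i)"
    have "A j \<inter> A i = {}" if "i \<in> F" for i
      using disj insert that unfolding disjoint_family_on_def by (metis insert_subset subsetD)
    then have "?T \<inter> A j = B \<inter> A j" "?T - A j = B \<inter> (\<Union>i\<in>F. A i)" by auto
    then have "linear_measure ?T = linear_measure (B \<inter> A j) + linear_measure (B \<inter> (\<Union>i\<in>F. A i))"
      using linear_measure_borel_split[OF A, of j ?T] insert by simp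
    then show ?case using insert by (simp add: add_left_mono)
  qed simp
  obtain b where b: "b \<ge> 0" "linear_measure B = ennreal b"
    using B by (metis ennreal_cases infinity_ennreal_def less_irrefl)
  define J where "J n = {i \<in> I. linear_measure (B \<inter> A i) > ennreal (inverse (Suc n))}" for n :: nat
  have "finite (J n)" for n
  proof (rule ccontr)
    assume inf: "infinite (J n)"
    obtain m :: nat where m: "b * Suc n < m" using reals_Archimedean2 by blast
    obtain F where F: "F \<subseteq> J n" "finite F" "card F = m" using infinite_arbitrarily_large[OF inf] by blast
    have "of_nat m * ennreal (inverse (Suc n)) = (\<Sum>i\<in>F. ennreal (inverse (Suc n)))" using F by simp
    also have "\<dots> \<le> (\<Sum>i\<in>F. linear_measure (B \<inter> A i))" using F(1) by (intro sum_mono) (auto simp: J_def)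
    also have "\<dots> \<le> linear_measure B"
      using sum[of F] F(1,2) linear_measure_mono[of "B \<inter> (\<Union>i\<in>F. A i)" B] by (force simp: J_def)
    finally have "ennreal (m * inverse (Suc n)) \<le> ennreal b" using b by (simp add: ennreal_mult ennreal_of_nat_eq_real_of_nat)
    then have "m * inverse (Suc n) \<le> b" using b by (simp add: ennreal_le_iff)
    then show False using m by (simp add: field_simps)
  qed
  moreover have "{i \<in> I. linear_measure (B \<inter> A i) \<noteq> 0} \<subseteq> (\<Union>n. J n)"
  proof
    fix i assume "i \<in> {i \<in> I. linear_measure (B \<inter> A i) \<noteq> 0}"
    then have i: "i \<in> I" "linear_measure (B \<inter> A i) > 0" by (auto simp: zero_less_iff_neq_zero)
    obtain n where "ennreal (inverse (Suc n)) < linear_measure (B \<inter> A i)"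
    proof (cases "linear_measure (B \<inter> A i)")
      case (real r)
      then have "r > 0" using i by simp
      then obtain n where "inverse (Suc n) < r" using reals_Archimedean by blast
      then show ?thesis using that real by (simp add: ennreal_less_iff)
    qed (use that[of 0] in auto)
    then have "i \<in> J n" using i by (simp add: J_def)
    then show "i \<in> (\<Union>n. J n)" by blast
  qed
  ultimately show ?thesis by (meson countable_UN countable_finite countable_subset uncountable_def countableI_type)
qed

section \<open>Lipschitz images and projections to lines\<close>

lemma diameter_image_Lipschitz:
  assumes h: "\<And>x y. x \<in> A \<Longrightarrow> y \<in> A \<Longrightarrow> dist (h x) (h y) \<le> M * dist x y"
    and U: "bounded U" "U \<subseteq> A" and M: "M \<ge> 0"
  shows "bounded (h ` U)" "diameter (h ` U) \<le> M * diameter U"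
proof -
  have *: "dist (h x) (h y) \<le> M * diameter U" if "x \<in> U" "y \<in> U" for x y
  proof -
    have "dist (h x) (h y) \<le> M * dist x y" using h that U(2) by blast
    also have "\<dots> \<le> M * diameter U" using diameter_bounded_bound[OF U(1)] that M by (intro mult_left_mono) auto
    finally show ?thesis .
  qed
  show "bounded (h ` U)" unfolding bounded_two_points using * by auto
  show "diameter (h ` U) \<le> M * diameter U"
    using * M diameter_ge_0[OF U(1)] by (auto simp: diameter_def[of "h ` U"] intro!: cSUP_least)
qed

lemma linear_measure_Lipschitz_image:
  assumes h: "\<And>x y. x \<in> A \<Longrightarrow> y \<in> A \<Longrightarrow> dist (h x) (h y) \<le> M * dist x y" and M: "M > 0"
    and A: "linear_measure A < \<infinity>"
  shows "linear_measure (h ` A) < \<infinity>"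
proof -
  have "linear_premeasure \<delta> (h ` A) \<le> ennreal M * linear_measure A" if \<delta>: "\<delta> > 0" for \<delta>
  proof (rule ennreal_le_epsilon)
    fix e :: real assume e: "e > 0"
    have "linear_premeasure (\<delta> / M) A < linear_measure A + ennreal (e / M)"
      using linear_premeasure_le_measure[of "\<delta> / M" A] A e \<delta> M
      by (metis divide_pos_pos ennreal_less_zero_iff ennreal_add_left_cancel_less add.right_neutral order_le_less_trans infinity_ennreal_def less_top)
    then obtain U where U: "A \<subseteq> (\<Union>n. U n)" "\<And>n::nat. bounded (U n)" "\<And>n. diameter (U n) \<le> \<delta> / M"
      "(\<Sum>n. ennreal (diameter (U n))) < linear_measure A + ennreal (e / M)"
      using linear_premeasure_cover by metis
    have dU: "diameter (h ` (U n \<inter> A)) \<le> M * diameter (U n)" and bU: "bounded (h ` (U n \<inter> A))" for n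
    proof -
      have b: "bounded (U n \<inter> A)" using U(2) by blast
      have "diameter (h ` (U n \<inter> A)) \<le> M * diameter (U n \<inter> A)"
        using diameter_image_Lipschitz(2)[OF h b] M by simp
      also have "\<dots> \<le> M * diameter (U n)" using diameter_subset[OF _ U(2)] M by (intro mult_left_mono) auto
      finally show "diameter (h ` (U n \<inter> A)) \<le> M * diameter (U n)" .
      show "bounded (h ` (U n \<inter> A))" using diameter_image_Lipschitz(1)[OF h b] M by simp
    qed
    have "linear_premeasure \<delta> (h ` A) \<le> (\<Sum>n. ennreal (diameter (h ` (U n \<inter> A))))"
    proof (rule linear_premeasure_le[OF _ bU])
      show "h ` A \<subseteq> (\<Union>n. h ` (U n \<inter> A))" using U(1) by blast
      show "diameter (h ` (U n \<inter> A)) \<le> \<delta>" for n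
        using dU[of n] U(3)[of n] M by (simp add: field_simps)
    qed
    also have "\<dots> \<le> (\<Sum>n. ennreal M * ennreal (diameter (U n)))"
      using dU M diameter_ge_0[OF U(2)] by (intro suminf_le) (auto simp: ennreal_mult[symmetric] intro!: ennreal_leI)
    also have "\<dots> = ennreal M * (\<Sum>n. ennreal (diameter (U n)))" by simp
    also have "\<dots> \<le> ennreal M * (linear_measure A + ennreal (e / M))"
      using U(4) by (intro mult_left_mono) auto
    also have "\<dots> = ennreal M * linear_measure A + ennreal e"
      using M e by (simp add: distrib_left ennreal_mult[symmetric])
    finally show "linear_premeasure \<delta> (h ` A) \<le> ennreal M * linear_measure A + ennreal e" .
  qed
  then have "linear_measure (h ` A) \<le> ennreal M * linear_measure A"
    unfolding linear_measure_def[of "h ` A"] by (intro SUP_least) auto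
  also have "\<dots> < \<infinity>" using A by (simp add: ennreal_mult_less_top)
  finally show ?thesis .
qed

lemma outer_measure_projection_le:
  fixes A :: "'a::real_inner set"
  assumes A: "bounded A" and e: "norm e = 1"
  shows "outer_measure_of lborel ((\<lambda>z. z \<bullet> e) ` A) \<le> 2 * ennreal (diameter A)"
proof (cases "A = {}")
  case True
  then show ?thesis by (simp add: outer_measure_of_eq)
next
  case False
  then obtain a where a: "a \<in> A" by blast
  have "(\<lambda>z. z \<bullet> e) ` A \<subseteq> cball (a \<bullet> e) (diameter A)"
  proof clarsimp
    fix z assume z: "z \<in> A"
    have "\<bar>(a - z) \<bullet> e\<bar> \<le> norm (a - z) * norm e" by (rule Cauchy_Schwarz_ineq2)
    also have "\<dots> \<le> diameter A" using diameter_bounded_bound[OF A a z] e by (simp add: dist_norm)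
    finally show "dist (a \<bullet> e) (z \<bullet> e) \<le> diameter A" by (simp add: dist_real_def inner_diff_left)
  qed
  then have "outer_measure_of lborel ((\<lambda>z. z \<bullet> e) ` A) \<le> outer_measure_of lborel (cball (a \<bullet> e) (diameter A))"
    by (rule outer_measure_of_mono)
  also have "\<dots> = emeasure lborel (cball (a \<bullet> e) (diameter A))" by (intro outer_measure_of_eq) auto
  also have "\<dots> = ennreal (2 * diameter A)"
    unfolding cball_eq_atLeastAtMost using diameter_ge_0[OF A] by (subst emeasure_lborel_Icc) auto
  also have "\<dots> = 2 * ennreal (diameter A)" using diameter_ge_0[OF A] by (simp add: ennreal_mult)
  finally show ?thesis .
qed

text \<open>Covers project to covers, each piece landing in an interval of at most twice its
  diameter. This is how a set of linear measure zero, possibly uncountable, drops out of the extent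
  of a connected set.\<close>

lemma outer_measure_projection_null:
  fixes A :: "'a::real_inner set"
  assumes A: "linear_measure A = 0" and e: "norm e = 1"
  shows "outer_measure_of lborel ((\<lambda>z. z \<bullet> e) ` A) = 0"
proof -
  have "outer_measure_of lborel ((\<lambda>z. z \<bullet> e) ` A) \<le> 0 + ennreal \<epsilon>" if \<epsilon>: "\<epsilon> > 0" for \<epsilon>
  proof -
    have "linear_premeasure 1 A < ennreal (\<epsilon> / 2)"
      using linear_premeasure_le_measure[of 1 A] A \<epsilon> by simp
    then obtain U where U: "A \<subseteq> (\<Union>n. U n)" "\<And>n::nat. bounded (U n)"
      "(\<Sum>n. ennreal (diameter (U n))) < ennreal (\<epsilon> / 2)"
      using linear_premeasure_cover by metis
    have one: "outer_measure_of lborel ((\<lambda>z. z \<bullet> e) ` U n) \<le> 2 * ennreal (diameter (U n))" for n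
      using outer_measure_projection_le U(2) e by blast
    have "outer_measure_of lborel ((\<lambda>z. z \<bullet> e) ` A) \<le> outer_measure_of lborel (\<Union>n. (\<lambda>z. z \<bullet> e) ` U n)"
      using U(1) by (intro outer_measure_of_mono) blast
    also have "\<dots> \<le> (\<Sum>n. outer_measure_of lborel ((\<lambda>z. z \<bullet> e) ` U n))" by (rule outer_measure_of_UN_nat_le) simp
    also have "\<dots> \<le> (\<Sum>n. 2 * ennreal (diameter (U n)))" using one by (intro suminf_le) auto
    also have "\<dots> = 2 * (\<Sum>n. ennreal (diameter (U n)))" by simp
    also have "\<dots> \<le> 2 * ennreal (\<epsilon> / 2)" using U(3) by (intro mult_left_mono) auto
    also have "\<dots> = 0 + ennreal \<epsilon>" using \<epsilon> by (simp add: ennreal_mult'[symmetric] ennreal_numeral[symmetric] del: ennreal_numeral)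
    finally show ?thesis .
  qed
  then have "outer_measure_of lborel ((\<lambda>z. z \<bullet> e) ` A) \<le> 0" by (rule ennreal_le_epsilon)
  then show ?thesis by simp
qed

section \<open>Continuous extension in the plane\<close>

text \<open>If the frontier were one point \<open>c\<close>, the connected set \<open>- {c}\<close>
  would be the disjoint union of the open sets \<open>interior C\<close> and \<open>- C\<close>, so
  one of them would be empty. Compactness rules out the complement, and an empty interior leaves
  only \<open>c\<close>.\<close>

lemma frontier_nondegenerate:
  fixes C :: "'a::euclidean_space set"
  assumes C: "compact C" and D: "2 \<le> DIM('a)" and xy: "x \<in> C" "y \<in> C" "x \<noteq> y"
  shows "\<exists>a\<in>frontier C. \<exists>b\<in>frontier C. a \<noteq> b"
proof (rule ccontr)
  assume "\<not> ?thesis"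
  moreover have "frontier C \<noteq> {}"
    using C xy frontier_eq_empty[of C] not_compact_UNIV by auto
  ultimately obtain c where c: "frontier C = {c}" by blast
  have cl: "closed C" using C compact_imp_closed by blast
  have con: "connected (- {c})" using connected_punctured_universe[OF D] .
  have "interior C = {} \<or> - C = {}"
  proof (rule ccontr)
    assume "\<not> ?thesis"
    moreover have "- {c} \<subseteq> interior C \<union> - C" using c cl by (auto simp: frontier_def)
    moreover have "c \<notin> interior C" using c by (auto simp: frontier_def)
    moreover have "c \<in> C" using c frontier_subset_closed[OF cl] by auto
    ultimately show False
      using connectedD[OF con, of "interior C" "- C"] interior_subset[of C] cl by fastforce
  qed
  moreover have "- C \<noteq> {}" using C not_compact_UNIV by (metis Compl_empty_eq double_compl)
  ultimately have "C = {c}" using c cl by (auto simp: frontier_def)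
  then show False using xy by auto
qed

lemma frontier_nondegenerate_component:
  fixes K :: "complex set"
  assumes K: "compact K" "connected (- K)" and C: "C \<in> nondegenerate_components K"
  shows "frontier C \<in> nondegenerate_components (frontier K)"
proof -
  obtain x y where C: "C \<in> components K" "x \<in> C" "y \<in> C" "x \<noteq> y"
    using C by (auto simp: nondegenerate_components_def)
  show ?thesis
    using frontier_nondegenerate[OF compact_components[OF K(1) C(1)] _ C(2-4)]
      frontier_component_compact(2)[OF K C(1)] by (simp add: nondegenerate_components_def)
qed

lemma inj_on_frontier_components:
  fixes K :: "complex set"
  assumes K: "compact K" "connected (- K)"
  shows "inj_on frontier (components K)"
proof (rule inj_onI)
  fix C D assume c: "C \<in> components K" "D \<in> components K" and CD: "frontier C = frontier D"
  obtain x where "x \<in> frontier C" using frontier_component_compact(3)[OF K c(1)] by blast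
  then have "x \<in> C" "x \<in> D"
    using CD frontier_component_compact(1)[OF K c(1)] frontier_component_compact(1)[OF K c(2)] by auto
  then show "C = D" using components_eq[OF c] by blast
qed

lemma inj_on_frontier_nondegenerate_components:
  fixes K :: "complex set"
  assumes "compact K" "connected (- K)"
  shows "inj_on frontier (nondegenerate_components K)"
  by (rule inj_on_subset[OF inj_on_frontier_components[OF assms]]) (auto simp: nondegenerate_components_def)

lemma countable_components_nondegenerate:
  fixes K :: "complex set"
  assumes K: "compact K" "connected (- K)" and cnt: "countable (nondegenerate_components (frontier K))"
  shows "countable (nondegenerate_components K)"
proof -
  have "frontier ` nondegenerate_components K \<subseteq> nondegenerate_components (frontier K)"
    using frontier_nondegenerate_component[OF K] by blast
  then have "countable (frontier ` nondegenerate_components K)" using cnt countable_subset by blast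
  then show ?thesis using inj_on_frontier_nondegenerate_components[OF K] countable_image_inj_on by blast
qed

text \<open>The line through a point of \<open>P\<close> perpendicular to \<open>e\<close> is
  unbounded, so it leaves \<open>P\<close> and crosses the frontier at a point with the same
  projection. Hence a filled component casts no larger shadow than its frontier, whose diameter is
  what the summability hypothesis controls.\<close>

lemma projection_frontier:
  fixes P :: "complex set"
  assumes P: "compact P" and e: "norm e = 1"
  shows "(\<lambda>z. z \<bullet> e) ` P \<subseteq> (\<lambda>z. z \<bullet> e) ` frontier P"
proof
  fix y assume "y \<in> (\<lambda>z. z \<bullet> e) ` P"
  then obtain z where z: "z \<in> P" "y = z \<bullet> e" by blast
  define T where "T = {w. e \<bullet> w = e \<bullet> z}"
  have "connected T" unfolding T_def by (intro convex_connected convex_hyperplane)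
  moreover have "T \<inter> P \<noteq> {}" using z by (auto simp: T_def)
  moreover have "T - P \<noteq> {}"
  proof
    assume "T - P = {}"
    then have "bounded T" using P compact_imp_bounded bounded_subset by blast
    then obtain b where b: "\<And>w. w \<in> T \<Longrightarrow> norm w \<le> b" using bounded_iff by blast
    \<comment> \<open>A point of the line beyond the supposed bound \<open>b\<close>:
      \<open>\<i> * e\<close> is a unit vector orthogonal to \<open>e\<close>.\<close>
    define w where "w = z + of_real (norm z + b + 1) * (\<i> * e)"
    have "e \<bullet> w = e \<bullet> z" by (simp add: w_def inner_complex_def algebra_simps)
    then have "norm w \<le> b" using b by (simp add: T_def)
    moreover have "norm z \<le> b" using b[of z] by (simp add: T_def)
    then have "0 \<le> norm z + b + 1" using norm_ge_zero[of z] by linarith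
    then have "norm (of_real (norm z + b + 1) * (\<i> * e)) = norm z + b + 1"
      using e by (simp only: norm_mult norm_of_real norm_ii abs_of_nonneg) simp
    moreover have "norm (of_real (norm z + b + 1) * (\<i> * e)) \<le> norm w + norm z"
      using norm_triangle_ineq4[of w z] by (simp add: w_def)
    ultimately show False by linarith
  qed
  ultimately obtain w where "w \<in> T" "w \<in> frontier P" using connected_Int_frontier[of T P] by blast
  then show "y \<in> (\<lambda>z. z \<bullet> e) ` frontier P" using z(2)
    by (intro image_eqI[of _ _ w]) (simp_all add: T_def inner_commute)
qed

section \<open>Connected sets, Peano continua and limits\<close>

lemma connected_dist_le_outer_measure:
  fixes I :: "real set"
  assumes "connected I" "a \<in> I" "b \<in> I"
  shows "ennreal \<bar>a - b\<bar> \<le> outer_measure_of lborel I"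
proof -
  have *: "ennreal \<bar>a - b\<bar> \<le> outer_measure_of lborel I" if "a \<le> b" "a \<in> I" "b \<in> I" for a b
  proof -
    have "{a..b} \<subseteq> I" using assms(1) that connectedD_interval by (metis atLeastAtMost_iff subsetI)
    then have "outer_measure_of lborel {a..b} \<le> outer_measure_of lborel I" by (rule outer_measure_of_mono)
    moreover have "outer_measure_of lborel {a..b} = ennreal \<bar>a - b\<bar>"
      using that by (simp add: outer_measure_of_eq)
    ultimately show ?thesis by simp
  qed
  show ?thesis using *[of a b] *[of b a] assms by (cases "a \<le> b") (auto simp: abs_minus_commute)
qed

text \<open>\<open>P\<close> is a finite union of continua \<open>T i\<close> of diameter at most
  \<epsilon> / 2, the images of short parameter intervals. With \<eta> below the gaps between
  disjoint pairs, every piece that comes within \<eta> of \<open>p\<close> meets the piece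
  \<open>T j\<close> containing \<open>p\<close>, so the union \<open>M\<close> of these pieces is
  connected and small.\<close>

lemma peano_continuum_uniformly_locally_connected:
  fixes P :: "'a::heine_borel set"
  assumes P: "peano_continuum P" and e: "\<epsilon> > 0"
  obtains \<eta> where "\<eta> > 0"
    "\<And>p. p \<in> P \<Longrightarrow> \<exists>M. compact M \<and> connected M \<and> M \<subseteq> P \<and> P \<inter> cball p \<eta> \<subseteq> M \<and> M \<subseteq> cball p \<epsilon>"
proof -
  obtain g :: "real \<Rightarrow> 'a" where g: "continuous_on {0..1} g" "P = g ` {0..1}"
    using P unfolding peano_continuum_def by blast
  have "uniformly_continuous_on {0..1} g" using g(1) compact_uniformly_continuous by blast
  then obtain d where d: "d > 0" "\<And>s t. s \<in> {0..1} \<Longrightarrow> t \<in> {0..1} \<Longrightarrow> dist t s < d \<Longrightarrow> dist (g t) (g s) < \<epsilon> / 2"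
    unfolding uniformly_continuous_on_def using e by (metis half_gt_zero)
  obtain N :: nat where N: "N > 0" "inverse N < d" using d(1) reals_Archimedean by (metis zero_less_Suc)
  define I where "I i = {real i / N..(real i + 1) / N}" for i :: nat
  define T where "T i = g ` I i" for i
  have Isub: "I i \<subseteq> {0..1}" if "i < N" for i
  proof -
    have "real i + 1 \<le> N" using that by linarith
    then have "(real i + 1) / N \<le> 1" using N(1) by (simp add: field_simps)
    then show ?thesis by (auto simp: I_def intro: order_trans[of 0 "real i / N"])
  qed
  have cT: "compact (T i)" "connected (T i)" if "i < N" for i
    unfolding T_def using continuous_on_subset[OF g(1) Isub[OF that]]
    by (auto simp: I_def intro!: compact_continuous_image connected_continuous_image)
  have dT: "dist x y \<le> \<epsilon> / 2" if i: "i < N" and xy: "x \<in> T i" "y \<in> T i" for i x y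
  proof -
    obtain s t where st: "s \<in> I i" "t \<in> I i" "x = g s" "y = g t" using xy by (auto simp: T_def)
    have "\<bar>s - t\<bar> \<le> (real i + 1) / N - real i / N" using st(1,2) by (auto simp: I_def)
    also have "\<dots> = inverse N" by (simp add: field_simps diff_divide_distrib[symmetric])
    finally have "dist s t < d" using N(2) by (simp add: dist_real_def)
    then show ?thesis using d(2)[of t s] Isub[OF i] st less_imp_le by blast
  qed
  have TP: "P = (\<Union>i<N. T i)"
  proof
    show "P \<subseteq> (\<Union>i<N. T i)"
    proof
      fix p assume "p \<in> P"
      then obtain t where t: "0 \<le> t" "t \<le> 1" "p = g t" using g(2) by auto
      show "p \<in> (\<Union>i<N. T i)"
      proof (cases "t = 1")
        case True
        have "t \<in> I (N - 1)" using N(1) True by (auto simp: I_def of_nat_diff)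
        then show ?thesis using N(1) t(3) by (auto simp: T_def intro!: bexI[of _ "N - 1"])
      next
        case False
        define i where "i = nat \<lfloor>t * N\<rfloor>"
        have tN: "0 \<le> t * N" "t * N < N" using t False N(1) by auto
        have i: "real i \<le> t * N" "t * N < real i + 1" using tN(1) by (auto simp: i_def)
        then have "i < N" using tN(2) by linarith
        moreover have "t \<in> I i" using i N(1) by (auto simp: I_def field_simps)
        ultimately show ?thesis using t(3) by (auto simp: T_def)
      qed
    qed
    show "(\<Union>i<N. T i) \<subseteq> P" using Isub g(2) by (auto simp: T_def)
  qed
  define D where "D = {(i, j). i < N \<and> j < N \<and> T i \<inter> T j = {}}"
  have fD: "finite D" by (rule finite_subset[of _ "{..<N} \<times> {..<N}"]) (auto simp: D_def)
  have "\<forall>ij\<in>D. \<exists>c>0. \<forall>x\<in>T (fst ij). \<forall>y\<in>T (snd ij). c \<le> dist x y"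
  proof
    fix ij assume "ij \<in> D"
    then have ij: "fst ij < N" "snd ij < N" "T (fst ij) \<inter> T (snd ij) = {}" by (auto simp: D_def)
    show "\<exists>c>0. \<forall>x\<in>T (fst ij). \<forall>y\<in>T (snd ij). c \<le> dist x y"
      using separate_compact_closed[OF cT(1)[OF ij(1)] compact_imp_closed[OF cT(1)[OF ij(2)]] ij(3)] .
  qed
  then obtain c where c: "\<And>ij. ij \<in> D \<Longrightarrow> c ij > 0"
    "\<And>ij x y. ij \<in> D \<Longrightarrow> x \<in> T (fst ij) \<Longrightarrow> y \<in> T (snd ij) \<Longrightarrow> c ij \<le> dist x y"
    by metis
  \<comment> \<open>Halving the minimum makes \<eta> strictly smaller than every gap, as the
    contradiction in \<open>meet\<close> requires.\<close>
  define \<eta> where "\<eta> = Min (insert (\<epsilon> / 2) (c ` D)) / 2"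
  have "\<eta> > 0" using fD c(1) e by (auto simp: \<eta>_def)
  have M1: "Min (insert (\<epsilon> / 2) (c ` D)) \<le> \<epsilon> / 2" using fD by (intro Min_le) auto
  have \<eta>1: "\<eta> \<le> \<epsilon> / 2" using M1 e by (auto simp: \<eta>_def)
  have \<eta>2: "\<eta> < c ij" if "ij \<in> D" for ij
  proof -
    have "Min (insert (\<epsilon> / 2) (c ` D)) \<le> c ij" using fD that by (intro Min_le) auto
    then show ?thesis using c(1)[OF that] by (auto simp: \<eta>_def)
  qed
  have "\<exists>M. compact M \<and> connected M \<and> M \<subseteq> P \<and> P \<inter> cball p \<eta> \<subseteq> M \<and> M \<subseteq> cball p \<epsilon>" if p: "p \<in> P" for p
  proof -
    obtain j where j: "j < N" "p \<in> T j" using p TP by auto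
    define H where "H = {i. i < N \<and> T i \<inter> cball p \<eta> \<noteq> {}}"
    have jH: "j \<in> H" using j \<open>\<eta> > 0\<close> by (auto simp: H_def)
    define M where "M = (\<Union>i\<in>H. T i \<union> T j)"
    have meet: "T i \<inter> T j \<noteq> {}" if iH: "i \<in> H" for i
    proof
      assume "T i \<inter> T j = {}"
      then have "(i, j) \<in> D" using that j by (auto simp: D_def H_def)
      moreover obtain y where "y \<in> T i" "dist p y \<le> \<eta>" using iH by (auto simp: H_def)
      ultimately show False using c(2)[of "(i, j)" y p] \<eta>2[of "(i, j)"] j by (auto simp: dist_commute)
    qed
    have "finite H" by (auto simp: H_def)
    then have "compact M" unfolding M_def using cT j by (intro compact_UN compact_Un) (auto simp: H_def)
    moreover have "connected M" unfolding M_def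
    proof (rule connected_Union)
      show "\<And>S. S \<in> (\<lambda>i. T i \<union> T j) ` H \<Longrightarrow> connected S"
        using cT j meet by (auto simp: H_def intro!: connected_Un)
      show "\<Inter> ((\<lambda>i. T i \<union> T j) ` H) \<noteq> {}" using j by auto
    qed
    moreover have "M \<subseteq> P" using TP j by (auto simp: M_def H_def)
    moreover have "P \<inter> cball p \<eta> \<subseteq> M" using TP by (auto simp: M_def H_def)
    moreover have "M \<subseteq> cball p \<epsilon>"
    proof
      fix z assume "z \<in> M"
      then consider "z \<in> T j" | i where "i \<in> H" "z \<in> T i"
        unfolding M_def by blast
      then show "z \<in> cball p \<epsilon>"
      proof cases
        case 1
        then show ?thesis using dT[OF j(1) j(2)] e by fastforce
      next
        case 2
        then obtain y where y: "y \<in> T i" "dist p y \<le> \<eta>" by (auto simp: H_def)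
        then have "dist y z \<le> \<epsilon> / 2" using dT[of i y z] 2 by (auto simp: H_def)
        then show ?thesis using y(2) \<eta>1 dist_triangle[of p z y] by auto
      qed
    qed
    ultimately show ?thesis by blast
  qed
  then show ?thesis using that \<open>\<eta> > 0\<close> by blast
qed

text \<open>The centre \<open>p\<close> may depend on \<epsilon>. The limit is therefore found by
  the Cauchy criterion along one sequence, and the same oscillation bound extends it to all points
  near \<open>x\<close>.\<close>

lemma limit_if_small_oscillation:
  fixes f :: "'a::metric_space \<Rightarrow> 'b::complete_space"
  assumes x: "x islimpt U"
    and osc: "\<And>\<epsilon>. \<epsilon> > 0 \<Longrightarrow> \<exists>d>0. \<exists>p. \<forall>z\<in>U \<inter> ball x d. dist (f z) p \<le> \<epsilon>"
  shows "\<exists>l. (f \<longlongrightarrow> l) (at x within U)"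
proof -
  obtain s where s: "\<And>n. s n \<in> U - {x}" "s \<longlonglongrightarrow> x" using x islimpt_sequential by metis
  have close: "\<exists>d>0. \<forall>z\<in>U \<inter> ball x d. \<forall>w\<in>U \<inter> ball x d. dist (f z) (f w) < \<epsilon>" if "\<epsilon> > 0" for \<epsilon>
  proof -
    obtain d p where d: "d > 0" "\<forall>z\<in>U \<inter> ball x d. dist (f z) p \<le> \<epsilon> / 3" using osc[of "\<epsilon> / 3"] \<open>\<epsilon> > 0\<close> by auto
    have "dist (f z) (f w) < \<epsilon>" if "z \<in> U \<inter> ball x d" "w \<in> U \<inter> ball x d" for z w
    proof -
      have "dist (f z) p \<le> \<epsilon> / 3" "dist (f w) p \<le> \<epsilon> / 3" using d(2) that by blast+
      then show ?thesis using dist_triangle2[of "f z" "f w" p] \<open>\<epsilon> > 0\<close> by linarith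
    qed
    then show ?thesis using d(1) by blast
  qed
  have ev: "\<exists>N. \<forall>n\<ge>N. s n \<in> U \<inter> ball x d" if "d > 0" for d
    using s(1) s(2)[unfolded lim_sequentially, rule_format, OF that] by (auto simp: dist_commute)
  have "Cauchy (\<lambda>n. f (s n))" unfolding Cauchy_def
  proof (intro allI impI)
    fix \<epsilon> :: real assume "\<epsilon> > 0"
    then obtain d where d: "d > 0" "\<forall>z\<in>U \<inter> ball x d. \<forall>w\<in>U \<inter> ball x d. dist (f z) (f w) < \<epsilon>" using close by blast
    then show "\<exists>M. \<forall>m\<ge>M. \<forall>n\<ge>M. dist (f (s m)) (f (s n)) < \<epsilon>" using ev[OF d(1)] by blast
  qed
  then obtain l where l: "(\<lambda>n. f (s n)) \<longlonglongrightarrow> l" using Cauchy_convergent_iff convergent_def by blast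
  have "(f \<longlongrightarrow> l) (at x within U)"
    unfolding tendsto_iff eventually_at
  proof (intro allI impI)
    fix \<epsilon> :: real assume e: "\<epsilon> > 0"
    then obtain d where d: "d > 0" "\<forall>z\<in>U \<inter> ball x d. \<forall>w\<in>U \<inter> ball x d. dist (f z) (f w) < \<epsilon> / 2"
      using close[of "\<epsilon> / 2"] by auto
    obtain N1 where N1: "\<And>n. n \<ge> N1 \<Longrightarrow> s n \<in> U \<inter> ball x d" using ev[OF d(1)] by blast
    obtain N2 where N2: "\<And>n. n \<ge> N2 \<Longrightarrow> dist (f (s n)) l < \<epsilon> / 2"
      using l[unfolded lim_sequentially, rule_format, of "\<epsilon> / 2"] e by auto
    define n where "n = max N1 N2"
    have n: "s n \<in> U \<inter> ball x d" "dist (f (s n)) l < \<epsilon> / 2" using N1[of n] N2[of n] by (auto simp: n_def)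
    have "dist (f z) l < \<epsilon>" if "z \<in> U" "dist z x < d" for z
    proof -
      have "dist (f z) (f (s n)) < \<epsilon> / 2" using d(2) n(1) that by (auto simp: dist_commute)
      then show ?thesis using n(2) dist_triangle[of "f z" l "f (s n)"] by linarith
    qed
    then show "\<exists>d>0. \<forall>z\<in>U. z \<noteq> x \<and> dist z x < d \<longrightarrow> dist (f z) l < \<epsilon>" using d(1) by blast
  qed
  then show ?thesis by blast
qed

section \<open>Diameters of images of arcs\<close>

locale conformal_pair = end_pair +
  assumes hol: "f holomorphic_on - K"
begin

text \<open>Besides the non-degenerate components of \<open>L\<close>, the partners of
  non-degenerate components of \<open>K\<close> are removed even when they are points, since many
  circles about one centre may meet the same component of \<open>K\<close>. What is left of
  \<open>L\<close> consists of points whose partners in \<open>K\<close> are single points, each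
  lying on one circle.\<close>

definition bad_components :: "complex set set" where
  "bad_components = nondegenerate_components L \<union>
     (\<lambda>C. end_graph K L f `` C) ` nondegenerate_components K"

definition point_shadow :: "complex \<Rightarrow> real \<Rightarrow> complex set" where
  "point_shadow x r = (end_graph K L f `` sphere x r \<inter> L) - \<Union>bad_components"

lemma bad_components_subset: "bad_components \<subseteq> components L"
  unfolding bad_components_def nondegenerate_components_def using image_component(1) by auto

lemma end_graph_same_component:
  assumes "(k, p) \<in> end_graph K L f" "(j, p) \<in> end_graph K L f" "p \<in> L"
  shows "j \<in> cc K k"
proof -
  have "end_rel K L f k p" "end_rel K L f j p" using assms end_graph_in_iff end_graph_in by blast+
  then show ?thesis using end_rel_left by blast
qed

text \<open>A point in the shadows of two radii would have a partner component containing points of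
  both circles. That component is non-degenerate, so its own partner was removed as bad.\<close>

lemma disjoint_point_shadow: "disjoint_family_on (point_shadow x) I"
  unfolding disjoint_family_on_def
proof (intro ballI impI)
  fix r r' :: real assume ne: "r \<noteq> r'"
  have False if p: "p \<in> point_shadow x r" "p \<in> point_shadow x r'" for p
  proof -
    obtain k j where kj: "k \<in> sphere x r" "j \<in> sphere x r'" "(k, p) \<in> end_graph K L f" "(j, p) \<in> end_graph K L f"
      and pL: "p \<in> L" and pB: "p \<notin> \<Union>bad_components"
      using p unfolding point_shadow_def by blast
    have kK: "k \<in> K" using kj(3) pL end_graph_in_iff by blast
    have "j \<in> cc K k" using end_graph_same_component[OF kj(3,4) pL] .
    moreover have "k \<in> cc K k" using kK by simp
    moreover have "k \<noteq> j" using kj(1,2) ne by auto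
    moreover have "cc K k \<in> components K" using kK by (simp add: componentsI)
    ultimately have "cc K k \<in> nondegenerate_components K" unfolding nondegenerate_components_def by blast
    then have "end_graph K L f `` cc K k \<in> bad_components" by (auto simp: bad_components_def)
    moreover have "p \<in> end_graph K L f `` cc K k" using kj(3) \<open>k \<in> cc K k\<close> by blast
    ultimately show False using pB by blast
  qed
  then show "point_shadow x r \<inter> point_shadow x r' = {}" by blast
qed

lemma point_shadow_subset: "point_shadow x r \<subseteq> \<Union>(point_components (frontier L))"
proof
  fix p assume p: "p \<in> point_shadow x r"
  then have pL: "p \<in> L" by (simp add: point_shadow_def)
  have C: "cc L p \<in> components L" using pL by (simp add: componentsI)
  have pc: "p \<in> cc L p" using pL by simp
  then have "cc L p \<notin> nondegenerate_components L" using p by (auto simp: point_shadow_def bad_components_def)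
  then have "cc L p = {p}" using C pc by (auto simp: nondegenerate_components_def)
  then have "{p} \<in> components (frontier L)"
    using frontier_component_compact(2)[OF L C] by (simp add: frontier_def)
  then show "p \<in> \<Union>(point_components (frontier L))" by (auto simp: point_components_def)
qed

lemma borel_point_shadow:
  assumes "countable bad_components"
  shows "point_shadow x r \<in> sets borel"
proof -
  have "compact (end_graph K L f `` sphere x r \<inter> L)"
    using compact_end_graph_image(1)[of "sphere x r"] L(1) by (intro compact_Int) auto
  moreover have "\<Union>bad_components \<in> sets borel"
    using assms bad_components_subset compact_components[OF L(1)]
    by (intro sets.countable_Union) (auto intro: borel_compact)
  ultimately show ?thesis unfolding point_shadow_def by (auto intro: borel_compact)
qed

text \<open>Two image points lie in the image of one path, which is compact as
  \<open>compact_end_graph_image\<close> requires; an open arc of a circle is not.\<close>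

lemma connected_end_graph_image:
  assumes A: "path_connected A"
  shows "connected (end_graph K L f `` A)"
  unfolding connected_iff_connected_component
proof (intro ballI)
  fix p q assume "p \<in> end_graph K L f `` A" "q \<in> end_graph K L f `` A"
  then obtain a b where ab: "a \<in> A" "b \<in> A" "(a, p) \<in> end_graph K L f" "(b, q) \<in> end_graph K L f" by blast
  then obtain \<gamma> where \<gamma>: "path \<gamma>" "path_image \<gamma> \<subseteq> A" "pathstart \<gamma> = a" "pathfinish \<gamma> = b"
    using A unfolding path_connected_def by blast
  have "connected (end_graph K L f `` path_image \<gamma>)"
    using compact_end_graph_image(2) \<gamma>(1) compact_path_image connected_path_image by blast
  moreover have "p \<in> end_graph K L f `` path_image \<gamma>" "q \<in> end_graph K L f `` path_image \<gamma>"
    using ab \<gamma> pathstart_in_path_image pathfinish_in_path_image by blast+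
  ultimately show "connected_component (end_graph K L f `` A) p q"
    unfolding connected_component_def using \<gamma>(2) by blast
qed

text \<open>The image of \<open>A\<close> is connected, so its extent in a direction
  \<open>e\<close> is at most the outer measure of its projection. Of the three covering parts the
  curve contributes at most 2 \<epsilon>, the point shadow nothing, and the bad components other
  than the partner of \<open>C\<close> at most 2 \<epsilon>. The two coordinate directions together
  give 8 \<epsilon>.\<close>

lemma crosscut_image_diameter:
  assumes cnt: "countable bad_components"
    and r: "r > 0" and C: "C \<in> components K" and A: "A \<subseteq> sphere x r - C" "path_connected A"
    and len: "circle_length f (- K) x r \<le> ennreal \<epsilon>" and e0: "\<epsilon> > 0"
    and null: "\<And>e. norm e = 1 \<Longrightarrow> outer_measure_of lborel ((\<lambda>z. z \<bullet> e) ` point_shadow x r) = 0"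
    and small: "\<And>F. finite F \<Longrightarrow> F \<subseteq> nondegenerate_components L - {end_graph K L f `` C} \<Longrightarrow>
       (\<forall>P\<in>F. P \<inter> end_graph K L f `` sphere x r \<noteq> {}) \<Longrightarrow> (\<Sum>P\<in>F. diameter (frontier P)) \<le> \<epsilon>"
    and p: "p \<in> end_graph K L f `` A" "q \<in> end_graph K L f `` A"
  shows "dist p q \<le> 8 * \<epsilon>"
proof -
  define X where "X = end_graph K L f `` A"
  define B where "B = {P \<in> bad_components. P \<noteq> end_graph K L f `` C \<and> P \<inter> end_graph K L f `` sphere x r \<noteq> {}}"
  have cB: "countable B" unfolding B_def using cnt by (rule countable_subset[rotated]) auto
  have BL: "B \<subseteq> components L" using bad_components_subset by (auto simp: B_def)
  have cX: "connected X" unfolding X_def using connected_end_graph_image A by blast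
  have cover: "X \<subseteq> f ` (- K \<inter> sphere x r) \<union> point_shadow x r \<union> \<Union>B"
  proof
    fix y assume "y \<in> X"
    then obtain a where a: "a \<in> A" "(a, y) \<in> end_graph K L f" by (auto simp: X_def)
    then have as: "a \<in> sphere x r" "a \<notin> C" using A by auto
    show "y \<in> f ` (- K \<inter> sphere x r) \<union> point_shadow x r \<union> \<Union>B"
    proof (cases "a \<in> K")
      case False
      then have "y = f a" using a end_graph_notin by blast
      then show ?thesis using False as by blast
    next
      case True
      then have yL: "y \<in> L" using a end_graph_in_iff by blast
      have yS: "y \<in> end_graph K L f `` sphere x r" using as a by blast
      show ?thesis
      proof (cases "y \<in> \<Union>bad_components")
        case False
        then show ?thesis using yL yS by (simp add: point_shadow_def)
      next
        case True
        then obtain P where P: "P \<in> bad_components" "y \<in> P" by blast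
        moreover have "y \<notin> end_graph K L f `` C" using image_component(2)[OF C a(2)] as by simp
        ultimately have "P \<in> B" using yS unfolding B_def by blast
        then show ?thesis using P by blast
      qed
    qed
  qed
  have proj: "\<bar>p \<bullet> e - q \<bullet> e\<bar> \<le> 4 * \<epsilon>" if e: "norm e = 1" for e
  proof -
    let ?\<pi> = "\<lambda>z. z \<bullet> e"
    have "connected (?\<pi> ` X)" using cX by (intro connected_continuous_image continuous_intros)
    then have "ennreal \<bar>p \<bullet> e - q \<bullet> e\<bar> \<le> outer_measure_of lborel (?\<pi> ` X)"
      using p by (intro connected_dist_le_outer_measure) (auto simp: X_def)
    also have "\<dots> \<le> ennreal (4 * \<epsilon>)"
    proof -
      define S where "S n = (if n = 0 then (\<lambda>z. f z \<bullet> e) ` (- K \<inter> sphere x r)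
        else if n = 1 then ?\<pi> ` point_shadow x r else if n = 2 then (\<Union>P\<in>B. ?\<pi> ` P) else {})" for n :: nat
      have "?\<pi> ` X \<subseteq> ?\<pi> ` (f ` (- K \<inter> sphere x r) \<union> point_shadow x r \<union> \<Union>B)"
        using cover by (rule image_mono)
      also have "\<dots> = S 0 \<union> S 1 \<union> S 2" unfolding S_def by (simp add: image_Un image_image image_Union)
      finally have "?\<pi> ` X \<subseteq> S 0 \<union> S 1 \<union> S 2" .
      then have "?\<pi> ` X \<subseteq> (\<Union>n. S n)" by blast
      then have "outer_measure_of lborel (?\<pi> ` X) \<le> outer_measure_of lborel (\<Union>n. S n)"
        by (rule outer_measure_of_mono)
      also have "\<dots> \<le> (\<Sum>n. outer_measure_of lborel (S n))" by (rule outer_measure_of_UN_nat_le) simp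
      also have "\<dots> = (\<Sum>n<3. outer_measure_of lborel (S n))"
        by (rule suminf_finite) (auto simp: S_def outer_measure_of_eq)
      also have "\<dots> = outer_measure_of lborel (S 0) + outer_measure_of lborel (S 1) + outer_measure_of lborel (S 2)"
        by (simp add: numeral_3_eq_3 numeral_2_eq_2)
      also have "\<dots> \<le> ennreal (2 * \<epsilon>) + 0 + ennreal (2 * \<epsilon>)"
      proof (intro add_mono)
        have "outer_measure_of lborel (S 0) \<le> 2 * circle_length f (- K) x r"
          using outer_measure_circle_image[OF hol _ e r] K(1) compact_imp_closed by (auto simp: S_def)
        also have "\<dots> \<le> 2 * ennreal \<epsilon>" using len by (rule mult_left_mono) simp
        finally show "outer_measure_of lborel (S 0) \<le> ennreal (2 * \<epsilon>)" using e0 by (simp add: ennreal_mult)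
        show "outer_measure_of lborel (S 1) \<le> 0" using null[OF e] by (simp add: S_def)
        have "outer_measure_of lborel (\<Union>P\<in>B. ?\<pi> ` P) \<le> ennreal (2 * \<epsilon>)"
        proof (rule outer_measure_of_UN_le[OF cB])
          fix P assume P: "P \<in> B"
          have cP: "compact P" using P BL compact_components[OF L(1)] by blast
          have "outer_measure_of lborel (?\<pi> ` P) \<le> outer_measure_of lborel (?\<pi> ` frontier P)"
            using projection_frontier[OF cP e] by (rule outer_measure_of_mono)
          also have "\<dots> \<le> 2 * ennreal (diameter (frontier P))"
            using compact_frontier[OF cP] compact_imp_bounded e by (intro outer_measure_projection_le) auto
          finally show "outer_measure_of lborel (?\<pi> ` P) \<le> 2 * ennreal (diameter (frontier P))" .
        next
          fix F assume F: "finite F" "F \<subseteq> B"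
          have nonneg: "0 \<le> diameter (frontier P)" if "P \<in> F" for P
            using that F BL compact_components[OF L(1)] compact_frontier compact_imp_bounded
            by (intro diameter_ge_0) blast
          \<comment> \<open>A bad component that is a single point has diameter zero, so only the
            non-degenerate ones count, and to these \<open>small\<close> applies.\<close>
          have "(\<Sum>P\<in>F. diameter (frontier P)) = (\<Sum>P\<in>F \<inter> nondegenerate_components L. diameter (frontier P))"
          proof (rule sum.mono_neutral_right[OF F(1)])
            show "\<forall>P\<in>F - F \<inter> nondegenerate_components L. diameter (frontier P) = 0"
            proof
              fix P assume P: "P \<in> F - F \<inter> nondegenerate_components L"
              then have PL: "P \<in> components L" "P \<notin> nondegenerate_components L" using F BL by auto
              then obtain a where "P = {a}"
                using in_components_nonempty[OF PL(1)] unfolding nondegenerate_components_def by blast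
              then show "diameter (frontier P) = 0" by (simp add: frontier_def)
            qed
          qed auto
          also have "\<dots> \<le> \<epsilon>" using F by (intro small) (auto simp: B_def)
          finally have "(\<Sum>P\<in>F. diameter (frontier P)) \<le> \<epsilon>" .
          moreover have "(\<Sum>P\<in>F. 2 * ennreal (diameter (frontier P))) = ennreal (2 * (\<Sum>P\<in>F. diameter (frontier P)))"
            using nonneg by (simp add: sum_distrib_left[symmetric] sum_ennreal ennreal_mult sum_nonneg)
          ultimately show "(\<Sum>P\<in>F. 2 * ennreal (diameter (frontier P))) \<le> ennreal (2 * \<epsilon>)"
            by (simp add: ennreal_leI)
        qed simp
        then show "outer_measure_of lborel (S 2) \<le> ennreal (2 * \<epsilon>)" by (simp add: S_def)
      qed
      also have "\<dots> = ennreal (4 * \<epsilon>)" using e0 by (simp add: ennreal_plus[symmetric] del: ennreal_plus)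
      finally show ?thesis .
    qed
    finally show ?thesis using e0 by (simp add: ennreal_le_iff)
  qed
  have "dist p q \<le> \<bar>Re (p - q)\<bar> + \<bar>Im (p - q)\<bar>" unfolding dist_norm by (rule cmod_le)
  moreover have "\<bar>Re (p - q)\<bar> \<le> 4 * \<epsilon>" using proj[of 1] by simp
  moreover have "\<bar>Im (p - q)\<bar> \<le> 4 * \<epsilon>" using proj[of \<i>] by (simp add: inner_complex_def)
  ultimately show ?thesis by linarith
qed

end

text \<open>The planar form of the hypotheses together with the Peano property. The sets
  \<open>E\<close> carry the \<sigma>-finiteness: countably many sets of finite linear measure that
  cover the point components.\<close>

locale extension_setup = conformal_pair +
  fixes E :: "nat \<Rightarrow> complex set"
  assumes jordan: "\<And>C. C \<in> components (frontier K) \<Longrightarrow> (\<exists>x. C = {x}) \<or> jordan_curve C"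
    and countable_K: "countable (nondegenerate_components (frontier K))"
    and countable_L: "countable (nondegenerate_components (frontier L))"
    and summable_L: "diameter summable_on (nondegenerate_components (frontier L))"
    and points_L: "\<Union>(point_components (frontier L)) \<subseteq> (\<Union>n. E n)"
    and finite_E: "\<And>n. linear_measure (E n) < \<infinity>"
    and peano_L: "\<And>P. P \<in> components (frontier L) \<Longrightarrow> peano_continuum P"
begin

lemma countable_bad: "countable bad_components"
  unfolding bad_components_def
  using countable_components_nondegenerate[OF K countable_K] countable_components_nondegenerate[OF L countable_L]
  by simp

text \<open>Circles are short for uncountably many radii. For each \<open>n\<close> the shadows of
  different radii are disjoint Borel sets, so only countably many of them meet \<open>E n\<close> in
  positive measure; a short radius outside all these exceptional sets remains.\<close>

lemma good_radius:
  assumes \<rho>: "\<rho> > 0" and \<epsilon>: "\<epsilon> > 0"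
  obtains r where "0 < r" "r < \<rho>" "circle_length f (- K) x r \<le> ennreal \<epsilon>"
    "\<And>e. norm e = 1 \<Longrightarrow> outer_measure_of lborel ((\<lambda>z. z \<bullet> e) ` point_shadow x r) = 0"
proof -
  have inj: "inj_on f (- K)" by (rule inj_on_inverseI[of _ g]) simp
  have bd: "bounded (f ` (- K \<inter> ball x \<rho>))"
    using bounded_f[of "ball x \<rho>"] by (simp add: Diff_eq Int_commute)
  have oK: "open (- K)" using K(1) compact_imp_closed by auto
  let ?G = "{r \<in> {0<..<\<rho>}. circle_length f (- K) x r \<le> ennreal \<epsilon>}"
  let ?N = "\<Union>n. {r \<in> {0<..<\<rho>}. linear_measure (E n \<inter> point_shadow x r) \<noteq> 0}"
  have "uncountable ?G" using uncountable_short_circles[OF hol oK inj bd \<rho> \<epsilon>] .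
  moreover have "countable ?N"
    using countable_disjoint_positive_linear_measure[OF finite_E borel_point_shadow[OF countable_bad] disjoint_point_shadow, where I="{0<..<\<rho>}"]
    by (intro countable_UN) blast+
  ultimately obtain r where r: "r \<in> ?G" "r \<notin> ?N" by (meson countable_subset subsetI)
  have "outer_measure_of lborel ((\<lambda>z. z \<bullet> e) ` point_shadow x r) = 0" if e: "norm e = 1" for e
  proof -
    have "linear_measure (E n \<inter> point_shadow x r) = 0" for n using r by auto
    then have "linear_measure (\<Union>n. E n \<inter> point_shadow x r) \<le> 0"
      using linear_measure_UN[of "\<lambda>n. E n \<inter> point_shadow x r"] by simp
    moreover have "point_shadow x r \<subseteq> (\<Union>n. E n \<inter> point_shadow x r)"
      using point_shadow_subset points_L by blast
    ultimately have "linear_measure (point_shadow x r) = 0"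
      using linear_measure_mono by (metis le_zero_eq order_trans)
    then show ?thesis using outer_measure_projection_null e by blast
  qed
  then show ?thesis using that r by auto
qed

text \<open>By summability, all but finitely many frontiers of components have total diameter at
  most \<epsilon>. The partner in \<open>K\<close> of each of the finitely many others is compact
  and, unless it is \<open>C\<close>, does not contain \<open>x\<close>, so all sufficiently small
  circles about \<open>x\<close> miss it.\<close>

lemma small_tail:
  assumes C: "C \<in> components K" and x: "x \<in> C" and e: "\<epsilon> > 0"
  obtains \<rho> where "\<rho> > 0" "\<And>r F. r < \<rho> \<Longrightarrow> finite F \<Longrightarrow> F \<subseteq> nondegenerate_components L - {end_graph K L f `` C} \<Longrightarrow>
       (\<forall>P\<in>F. P \<inter> end_graph K L f `` sphere x r \<noteq> {}) \<Longrightarrow> (\<Sum>P\<in>F. diameter (frontier P)) \<le> \<epsilon>"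
proof -
  let ?N = "nondegenerate_components L"
  have fN: "frontier P \<in> nondegenerate_components (frontier L)" if "P \<in> ?N" for P
    using frontier_nondegenerate_component[OF L that] .
  have inj: "inj_on frontier ?N" using inj_on_frontier_nondegenerate_components[OF L] .
  have bd: "bounded S" if "S \<in> nondegenerate_components (frontier L)" for S
  proof -
    have "S \<subseteq> frontier L" using that in_components_subset unfolding nondegenerate_components_def by blast
    moreover have "bounded (frontier L)" using compact_frontier[OF L(1)] compact_imp_bounded by blast
    ultimately show ?thesis using bounded_subset by blast
  qed
  let ?s = "infsum diameter (nondegenerate_components (frontier L))"
  obtain F0 where F0: "finite F0" "F0 \<subseteq> nondegenerate_components (frontier L)" "dist (sum diameter F0) ?s \<le> \<epsilon>"
    using infsum_finite_approximation[OF summable_L e] by blast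
  have tail: "(\<Sum>P\<in>F. diameter (frontier P)) \<le> \<epsilon>" if F: "finite F" "F \<subseteq> ?N" "\<forall>P\<in>F. frontier P \<notin> F0" for F
  proof -
    have "sum diameter (F0 \<union> frontier ` F) \<le> ?s"
      using F F0 fN bd by (intro finite_sum_le_infsum summable_L) (auto intro: diameter_ge_0)
    moreover have "sum diameter (F0 \<union> frontier ` F) = sum diameter F0 + sum diameter (frontier ` F)"
      using F F0 by (intro sum.union_disjoint) auto
    moreover have "sum diameter (frontier ` F) = (\<Sum>P\<in>F. diameter (frontier P))"
      using inj_on_subset[OF inj F(2)] by (simp add: sum.reindex)
    ultimately show ?thesis using F0(3) by (simp add: dist_real_def)
  qed
  define H where "H = {P \<in> ?N. frontier P \<in> F0 \<and> P \<noteq> end_graph K L f `` C}"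
  have "frontier ` H \<subseteq> F0" by (auto simp: H_def)
  then have "finite (frontier ` H)" using F0(1) finite_subset by blast
  moreover have "inj_on frontier H" using inj by (rule inj_on_subset) (auto simp: H_def)
  ultimately have fH: "finite H" by (rule finite_imageD)
  have "\<exists>d>0. \<forall>r<d. P \<inter> end_graph K L f `` sphere x r = {}" if P: "P \<in> H" for P
  proof -
    have PC: "P \<in> components L" "P \<noteq> end_graph K L f `` C" using P by (auto simp: H_def nondegenerate_components_def)
    interpret s: end_pair L K g f by (rule swap)
    define D where "D = end_graph L K g `` P"
    have cD: "compact D" unfolding D_def using s.compact_end_graph_image(1) compact_components[OF L(1) PC(1)] .
    have "x \<notin> D"
    proof
      assume "x \<in> D"
      then obtain p where p: "p \<in> P" "(p, x) \<in> end_graph L K g" by (auto simp: D_def)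
      then have "(x, p) \<in> end_graph K L f" using end_graph_swap by blast
      then have "p \<in> end_graph K L f `` C" using x by blast
      then show False using components_eq[OF PC(1) image_component(1)[OF C]] p(1) PC(2) by blast
    qed
    then obtain d where d: "d > 0" "ball x d \<subseteq> - D"
      using cD compact_imp_closed open_contains_ball[of "- D"] by (metis ComplI open_Compl)
    have "P \<inter> end_graph K L f `` sphere x r = {}" if "r < d" for r
    proof (rule ccontr)
      assume "\<not> ?thesis"
      then obtain p k where "p \<in> P" "k \<in> sphere x r" "(k, p) \<in> end_graph K L f" by blast
      then have "k \<in> D" "k \<in> ball x d" using end_graph_swap that unfolding D_def by auto
      then show False using d(2) by blast
    qed
    then show ?thesis using d(1) by blast
  qed
  then obtain d where d: "\<And>P. P \<in> H \<Longrightarrow> d P > 0"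
    "\<And>P r. P \<in> H \<Longrightarrow> r < d P \<Longrightarrow> P \<inter> end_graph K L f `` sphere x r = {}" by metis
  define \<rho> where "\<rho> = Min (insert 1 (d ` H))"
  have \<rho>: "\<rho> > 0" "\<And>P. P \<in> H \<Longrightarrow> \<rho> \<le> d P" using fH d(1) by (auto simp: \<rho>_def)
  show ?thesis
  proof (rule that[OF \<rho>(1)])
    fix r F assume r: "r < \<rho>" and F: "finite F" "F \<subseteq> ?N - {end_graph K L f `` C}"
      "\<forall>P\<in>F. P \<inter> end_graph K L f `` sphere x r \<noteq> {}"
    have "frontier P \<notin> F0" if P: "P \<in> F" for P
    proof
      assume "frontier P \<in> F0"
      then have "P \<in> H" using P F(2) by (auto simp: H_def)
      then show False using d(2)[of P r] \<rho>(2)[of P] r F(3) P by auto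
    qed
    then show "(\<Sum>P\<in>F. diameter (frontier P)) \<le> \<epsilon>" using F by (intro tail) auto
  qed
qed

lemma small_oscillation:
  assumes x: "x \<in> frontier K" and e: "\<epsilon> > 0"
  shows "\<exists>d>0. \<exists>p. \<forall>z\<in>- K \<inter> ball x d. dist (f z) p \<le> \<epsilon>"
proof -
  have xK: "x \<in> K" using x K(1) compact_imp_closed frontier_subset_closed by blast
  define C where "C = cc K x"
  have C: "C \<in> components K" and xC: "x \<in> C" using xK by (auto simp: C_def componentsI)
  have cC: "compact C" using compact_components[OF K(1) C] .
  have conC: "connected C" using C in_components_connected by blast
  have conC': "connected (- C)" using component_complement_connected[of "- K" C] K(2) C by simp
  have CK: "C \<subseteq> K" using C in_components_subset by blast
  have xf: "x \<in> frontier C" using frontier_component_compact(1)[OF K C] xC x by blast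
  define P where "P = end_graph K L f `` C"
  have P: "P \<in> components L" unfolding P_def using image_component(1)[OF C] .
  have cP: "compact P" using compact_components[OF L(1) P] .
  obtain \<eta> where \<eta>: "\<eta> > 0" "\<And>p. p \<in> frontier P \<Longrightarrow>
      \<exists>M. compact M \<and> connected M \<and> M \<subseteq> frontier P \<and> frontier P \<inter> cball p \<eta> \<subseteq> M \<and> M \<subseteq> cball p \<epsilon>"
    using peano_continuum_uniformly_locally_connected[OF peano_L[OF frontier_component_compact(2)[OF L P]] e] by blast
  \<comment> \<open>\<open>crosscut_image_diameter\<close> yields \<open>8 * \<kappa>\<close>, which
    must fit below both the scale \<eta> of local connectedness and the target \<epsilon>.\<close>
  define \<kappa> where "\<kappa> = min \<eta> \<epsilon> / 8"
  have \<kappa>: "\<kappa> > 0" "8 * \<kappa> \<le> \<eta>" "8 * \<kappa> \<le> \<epsilon>" using \<eta>(1) e by (auto simp: \<kappa>_def)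
  obtain \<rho> where \<rho>: "\<rho> > 0" "\<And>r F. r < \<rho> \<Longrightarrow> finite F \<Longrightarrow> F \<subseteq> nondegenerate_components L - {P} \<Longrightarrow>
       (\<forall>P\<in>F. P \<inter> end_graph K L f `` sphere x r \<noteq> {}) \<Longrightarrow> (\<Sum>P\<in>F. diameter (frontier P)) \<le> \<kappa>"
    using small_tail[OF C xC \<kappa>(1)] unfolding P_def by blast
  obtain r where r: "0 < r" "r < \<rho>" "circle_length f (- K) x r \<le> ennreal \<kappa>"
    "\<And>e. norm e = 1 \<Longrightarrow> outer_measure_of lborel ((\<lambda>z. z \<bullet> e) ` point_shadow x r) = 0"
    using good_radius[OF \<rho>(1) \<kappa>(1)] by blast
  \<comment> \<open>If the frontier of \<open>C\<close> is a point, \<open>B\<close> is empty;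
    otherwise \<open>B\<close> is the Jordan curve without an arc around \<open>x\<close> that lies
    in the disc.\<close>
  obtain B where B: "closed B" "connected B" "B \<subseteq> frontier C" "x \<notin> B" "frontier C - B \<subseteq> ball x r"
  proof (cases "\<exists>y. frontier C = {y}")
    case True
    then show ?thesis using that[of "{}"] xf r(1) by auto
  next
    case False
    then have "jordan_curve (frontier C)" using jordan[OF frontier_component_compact(2)[OF K C]] by blast
    then show ?thesis using jordan_curve_punctured_arc[OF _ xf r(1)] that by blast
  qed
  obtain d where d: "0 < d" "d \<le> r"
    "\<And>a b. a \<in> ball x d - C \<Longrightarrow> b \<in> ball x d - C \<Longrightarrow> connected_component (ball x r - C) a b"
    using locally_connected_complement_at[OF cC conC' r(1) B] by blast
  show ?thesis
  proof (cases "- K \<inter> ball x d = {}")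
    case True
    then show ?thesis using d(1) by blast
  next
    case False
    then obtain z where z: "z \<notin> K" "z \<in> ball x d" by blast
    obtain b0 where b0: "\<And>p. p \<in> end_graph K L f `` cball x r \<Longrightarrow> norm p \<le> b0"
      using bounded_end_graph_image[OF bounded_cball, of x r] unfolding bounded_iff by metis
    obtain b1 where b1: "\<And>p. p \<in> L \<Longrightarrow> norm p \<le> b1"
      using compact_imp_bounded[OF L(1)] unfolding bounded_iff by metis
    \<comment> \<open>The modulus of \<open>v\<close> exceeds the bounds \<open>b0\<close> and
      \<open>b1\<close> by more than \<epsilon>. So \<open>v\<close> is off \<open>L\<close>, its
      preimage \<open>w\<close> is outside the closed disc about \<open>x\<close>, and
      \<open>v\<close> is outside any \<epsilon>-disc whose centre respects the bound
      \<open>b0\<close>.\<close>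
    define v :: complex where "v = of_real (\<bar>b0\<bar> + \<bar>b1\<bar> + \<epsilon> + 1)"
    have nv: "norm v = \<bar>b0\<bar> + \<bar>b1\<bar> + \<epsilon> + 1" using e unfolding v_def norm_of_real by simp
    have vL: "v \<notin> L" using b1[of v] nv e by auto
    define w where "w = g v"
    have w: "w \<notin> K" "f w = v" using vL by (auto simp: w_def)
    have wball: "w \<notin> cball x r"
    proof
      assume "w \<in> cball x r"
      then have "v \<in> end_graph K L f `` cball x r" using end_graph_notin[OF w(1)] w(2) by blast
      then show False using b0[of v] nv e by auto
    qed
    have zC: "z \<in> ball x r - C" using z d(2) CK by auto
    obtain A where A: "A \<in> components (sphere x r - C)" "compact (C \<union> A)"
      "\<not> connected_component (- (C \<union> A)) z w"
      using separating_circle_component[OF cC conC conC' zC wball] w(1) CK by blast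
    have AS: "A \<subseteq> sphere x r - C" using A(1) in_components_subset by blast
    have pcA: "path_connected A"
    proof -
      have "open (- C)" using cC compact_imp_closed by auto
      then have "openin (top_of_set (sphere x r)) (sphere x r - C)" by (metis Diff_eq openin_open_Int)
      then have lp: "locally path_connected (sphere x r - C)"
        using locally_path_connected_sphere locally_open_subset by blast
      obtain a where "a \<in> sphere x r - C" "A = cc (sphere x r - C) a" using A(1) by (auto simp: components_def)
      then have "A = path_component_set (sphere x r - C) a"
        using path_component_eq_connected_component_set[OF lp] by simp
      then show ?thesis by simp
    qed
    define X where "X = end_graph K L f `` A"
    have dX: "dist p q \<le> 8 * \<kappa>" if "p \<in> X" "q \<in> X" for p q
      using that unfolding X_def
      by (intro crosscut_image_diameter[OF countable_bad r(1) C AS pcA r(3) \<kappa>(1) r(4) \<rho>(2)[OF r(2), unfolded P_def]]) auto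
    have "A \<noteq> {}" using A(1) in_components_nonempty by blast
    then obtain p1 where p1: "p1 \<in> X" using end_graph_total unfolding X_def by blast
    have XC: "X \<inter> P = {}"
      using image_component(2)[OF C] AS unfolding X_def P_def by blast
    have dclX: "closure X \<subseteq> cball p (8 * \<kappa>)" if p: "p \<in> closure X" for p
    proof -
      have "X \<subseteq> cball q (8 * \<kappa>)" if "q \<in> X" for q using dX that by auto
      then have "closure X \<subseteq> cball q (8 * \<kappa>)" if "q \<in> X" for q using that by (intro closure_minimal) auto
      then have "X \<subseteq> cball p (8 * \<kappa>)" using p by (metis dist_commute mem_cball subset_iff)
      then show ?thesis by (intro closure_minimal) auto
    qed
    \<comment> \<open>\<open>X\<close> misses \<open>P\<close>, so a point of \<open>P\<close> in
      the closure of \<open>X\<close> is not interior to \<open>P\<close>, and the local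
      connectedness known for \<open>frontier P\<close> is available at it.\<close>
    have PX: "q \<in> frontier P" if "q \<in> P" "q \<in> closure X" for q
    proof -
      have "q \<notin> interior P"
        using that XC interior_subset[of P] open_interior[of P] by (metis IntI closure_iff_nhds_not_empty disjoint_iff subset_eq)
      then show ?thesis using that cP by (auto simp: frontier_def compact_imp_closed)
    qed
    \<comment> \<open>If the closure of the image of the arc misses \<open>P\<close>, the empty set
      serves as \<open>M\<close>. Otherwise \<open>P \<inter> closure X\<close> lies within \<eta>
      of one of its points, and a small subcontinuum of \<open>frontier P\<close> captures all of
      it.\<close>
    obtain p M where pM: "p \<in> closure X" "closed M" "connected M" "M \<subseteq> P" "P \<inter> closure X \<subseteq> M" "M \<subseteq> cball p \<epsilon>"
    proof (cases "P \<inter> closure X = {}")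
      case True
      then show ?thesis using that[of p1 "{}"] p1 closure_subset by auto
    next
      case False
      then obtain p where p: "p \<in> P" "p \<in> closure X" by blast
      then obtain M where M: "compact M" "connected M" "M \<subseteq> frontier P" "frontier P \<inter> cball p \<eta> \<subseteq> M" "M \<subseteq> cball p \<epsilon>"
        using \<eta>(2)[OF PX[OF p]] by blast
      have "M \<subseteq> P" using M(3) cP compact_imp_closed frontier_subset_closed by blast
      moreover have "P \<inter> closure X \<subseteq> M"
        using dclX[OF p(2)] PX M(4) \<kappa>(2) by fastforce
      ultimately show ?thesis using that[OF p(2)] M compact_imp_closed by blast
    qed
    have inball: "closure X \<union> M \<subseteq> cball p \<epsilon>"
      using dclX[OF pM(1)] pM(6) \<kappa>(3) by (meson Un_least order_trans subset_cball)
    have np: "norm p \<le> b0"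
    proof -
      have "A \<subseteq> cball x r" using AS by auto
      then have "X \<subseteq> cball 0 b0" using b0 unfolding X_def by (meson Image_mono mem_cball_0 order_refl subset_iff)
      then have "closure X \<subseteq> cball 0 b0" by (intro closure_minimal) auto
      then show ?thesis using pM(1) by auto
    qed
    have vball: "f w \<notin> cball p \<epsilon>"
    proof
      assume "f w \<in> cball p \<epsilon>"
      then have "norm v \<le> norm p + \<epsilon>" using norm_triangle_sub[of v p] w(2) by (simp add: dist_norm norm_minus_commute)
      then show False using np nv by linarith
    qed
    \<comment> \<open>\<open>A\<close> was chosen for the one point \<open>z\<close>. Since
      \<open>y\<close> is joined to \<open>z\<close> inside the open disc off \<open>C\<close>,
      which \<open>A\<close> does not enter, the same arc separates \<open>y\<close> from
      \<open>w\<close>.\<close>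
    have "dist (f y) p \<le> \<epsilon>" if y: "y \<in> - K \<inter> ball x d" for y
    proof -
      have "connected_component (ball x r - C) z y" using d(3)[of z y] z y CK by blast
      moreover have "ball x r - C \<subseteq> - (C \<union> A)" using AS by auto
      ultimately have zy: "connected_component (- (C \<union> A)) z y" using connected_component_of_subset by blast
      have "\<not> connected_component (- (C \<union> A)) y w"
        using A(3) connected_component_trans[OF zy] by blast
      then have "f y \<in> cball p \<epsilon>"
        using crosscut_image_bound[OF C _ A(2) _ w(1), of y M p \<epsilon>] AS y pM inball vball
        unfolding X_def P_def by blast
      then show ?thesis by (simp add: dist_commute)
    qed
    then show ?thesis using d(1) by blast
  qed
qed

lemma limit_at_frontier:
  assumes x: "x \<in> frontier K"
  shows "\<exists>l. (f \<longlongrightarrow> l) (at x within - K)"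
proof (rule limit_if_small_oscillation)
  have "x \<in> closure (- K)" "x \<in> K"
    using x K(1) compact_imp_closed frontier_subset_closed by (auto simp: frontier_closures)
  then show "x islimpt - K" by (simp add: closure_def)
qed (use small_oscillation[OF x] in auto)

end

section \<open>From an extension to Peano components\<close>

context end_pair begin

text \<open>The graph of \<open>\<Phi>\<close> over the frontier of \<open>K\<close> lies in the
  closed relation, so \<open>\<Phi>\<close> sends the frontier of a component \<open>C\<close> into
  the frontier of its partner \<open>Q\<close>. It is onto, since a point of the latter is a limit
  of values of \<open>f\<close>. Thus \<open>P\<close> is a continuous image of a point or of a
  Jordan curve.\<close>

lemma peano_components_if_extension:
  assumes \<Phi>: "continuous_on (closure (- K)) \<Phi>" "\<And>z. z \<notin> K \<Longrightarrow> \<Phi> z = f z"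
    and jordan: "\<And>C. C \<in> components (frontier K) \<Longrightarrow> (\<exists>x. C = {x}) \<or> jordan_curve C"
    and P: "P \<in> components (frontier L)"
  shows "peano_continuum P"
proof -
  interpret s: end_pair L K g f by (rule swap)
  have lim: "(\<lambda>n. f (y n)) \<longlonglongrightarrow> \<Phi> z" if "y \<longlonglongrightarrow> z" "\<And>n. y n \<notin> K" "z \<in> closure (- K)" for y z
  proof -
    have "(\<lambda>n. \<Phi> (y n)) \<longlonglongrightarrow> \<Phi> z"
    proof (rule continuous_on_tendsto_compose[OF \<Phi>(1) that(1,3)])
      show "\<forall>\<^sub>F n in sequentially. y n \<in> closure (- K)"
        using that(2) closure_subset[of "- K"] by (intro always_eventually allI subsetD[OF closure_subset]) simp
    qed
    then show ?thesis using \<Phi>(2) that(2) by simp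
  qed
  have fr: "z \<in> closure (- K) \<and> z \<in> K" if "z \<in> frontier K" for z
    using that K(1) compact_imp_closed frontier_subset_closed by (auto simp: frontier_closures)
  have fr': "z \<in> frontier K" if "z \<in> closure (- K)" "z \<in> K" for z
    using that closure_subset[of K] by (auto simp: frontier_closures)
  have graph: "(z, \<Phi> z) \<in> end_graph K L f" "\<Phi> z \<in> frontier L" if z: "z \<in> frontier K" for z
  proof -
    obtain y where y: "\<And>n. y n \<notin> K" "y \<longlonglongrightarrow> z" using fr[OF z] unfolding closure_sequential by auto
    have l: "(\<lambda>n. f (y n)) \<longlonglongrightarrow> \<Phi> z" using lim y fr[OF z] by blast
    show "(z, \<Phi> z) \<in> end_graph K L f" by (rule end_graph_limit[OF _ y(2) l]) (use y end_graph_notin in blast)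
    then have "\<Phi> z \<in> L" using fr[OF z] end_graph_in_iff by blast
    moreover have "\<Phi> z \<in> closure (- L)" unfolding closure_sequential using l y f_in by (intro exI[of _ "\<lambda>n. f (y n)"]) auto
    ultimately show "\<Phi> z \<in> frontier L" using closure_subset[of L] by (auto simp: frontier_closures)
  qed
  obtain Q where Q: "Q \<in> components L" "P = frontier Q" using component_frontier_compact[OF L P] .
  define C where "C = end_graph L K g `` Q"
  have C: "C \<in> components K" unfolding C_def using s.image_component(1)[OF Q(1)] .
  have mem: "z \<in> C \<longleftrightarrow> p \<in> Q" if "(z, p) \<in> end_graph K L f" for z p
    using s.image_component(2)[OF Q(1), of p z] end_graph_swap that unfolding C_def by blast
  have "\<Phi> ` frontier C = P"
  proof
    show "\<Phi> ` frontier C \<subseteq> P"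
      using graph mem frontier_component_compact(1)[OF K C] frontier_component_compact(1)[OF L Q(1)] Q(2) by auto
    show "P \<subseteq> \<Phi> ` frontier C"
    proof
      fix p assume p: "p \<in> P"
      then have pQ: "p \<in> Q" "p \<in> frontier L" using Q(2) frontier_component_compact(1)[OF L Q(1)] by auto
      then have pL: "p \<in> L" "p \<in> closure (- L)"
        using Q(1) in_components_subset by (auto simp: frontier_closures)
      obtain v where v: "\<And>n. v n \<notin> L" "v \<longlonglongrightarrow> p" using pL(2) unfolding closure_sequential by auto
      \<comment> \<open>\<open>bounded_g\<close> keeps the preimages of the approximating values
        from escaping to infinity, so a subsequence of them converges.\<close>
      have "bounded (g ` (range v - L))" using bounded_g convergent_imp_bounded v(2) by blast
      moreover have "range (g \<circ> v) \<subseteq> g ` (range v - L)" using v(1) by auto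
      ultimately have "bounded (range (g \<circ> v))" using bounded_subset by blast
      then obtain z r where r: "strict_mono r" "(g \<circ> v \<circ> r) \<longlonglongrightarrow> z"
        using bounded_imp_convergent_subsequence by metis
      define y where "y = (\<lambda>n. g (v (r n)))"
      have y: "\<And>n. y n \<notin> K" "y \<longlonglongrightarrow> z" using v(1) r(2) by (auto simp: y_def o_def)
      have vr: "(\<lambda>n. v (r n)) \<longlonglongrightarrow> p" using LIMSEQ_subseq_LIMSEQ[OF v(2) r(1)] by (simp add: o_def)
      have fy: "f (y n) = v (r n)" for n using v(1) by (simp add: y_def)
      have zp: "(z, p) \<in> end_graph K L f"
        by (rule end_graph_limit[OF _ y(2) vr]) (use y(1) fy end_graph_notin in metis)
      then have zK: "z \<in> K" using pL(1) end_graph_in_iff by blast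
      have zc: "z \<in> closure (- K)" unfolding closure_sequential using y by (intro exI[of _ y]) auto
      have "(\<lambda>n. f (y n)) \<longlonglongrightarrow> \<Phi> z" using lim[OF y(2,1) zc] .
      then have "\<Phi> z = p" using vr fy LIMSEQ_unique by simp
      moreover have "z \<in> frontier C"
        using mem[OF zp] pQ(1) frontier_component_compact(1)[OF K C] fr'[OF zc zK] by blast
      ultimately show "p \<in> \<Phi> ` frontier C" by blast
    qed
  qed
  moreover have fC: "frontier C \<in> components (frontier K)" using frontier_component_compact(2)[OF K C] .
  moreover have "frontier C \<subseteq> closure (- K)" using fr frontier_component_compact(1)[OF K C] by blast
  then have cC: "continuous_on (frontier C) \<Phi>" using \<Phi>(1) continuous_on_subset by blast
  ultimately show ?thesis
  proof (cases "\<exists>x. frontier C = {x}")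
    case True
    then obtain x where "frontier C = {x}" by blast
    then have "P = (\<lambda>t::real. \<Phi> x) ` {0..1}" 
      using \<open>\<Phi> ` frontier C = P\<close> by (simp add: image_constant_conv)
    then show ?thesis unfolding peano_continuum_def using continuous_on_const by blast
  next
    case False
    then obtain h where h: "simple_path h" "path_image h = frontier C"
      using jordan[OF fC] unfolding jordan_curve_def by blast
    have "continuous_on {0..1} h" using h(1) by (simp add: simple_path_def path_def)
    then have "continuous_on {0..1} (\<lambda>t. \<Phi> (h t))"
      by (rule continuous_on_compose2[OF cC]) (use h(2) in \<open>auto simp: path_image_def\<close>)
    moreover have "P = (\<lambda>t. \<Phi> (h t)) ` {0..1}"
      using \<open>\<Phi> ` frontier C = P\<close> h(2) by (metis image_image path_image_def)
    ultimately show ?thesis unfolding peano_continuum_def by blast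
  qed
qed

end

section \<open>Charts of the sphere\<close>

text \<open>A parametrisation of the sphere without \<open>Fin c\<close>, with \<open>Infty\<close>
  at the origin. For \<open>c\<close> in a domain, the missing point corresponds to infinity of the
  plane, and the complement of the domain becomes a compact plane set.\<close>

definition chart :: "complex \<Rightarrow> complex \<Rightarrow> ecomplex" where
  "chart c z = (if z = 0 then Infty else Fin (1 / z + c))"

definition chart_inv :: "complex \<Rightarrow> ecomplex \<Rightarrow> complex" where
  "chart_inv c x = (case x of Infty \<Rightarrow> 0 | Fin u \<Rightarrow> 1 / (u - c))"

text \<open>The squared norm of the homogeneous coordinates \<open>(1 + c * z, z)\<close> of
  \<open>chart c z\<close>; it governs how the chart scales distances.\<close>

definition chart_weight :: "complex \<Rightarrow> complex \<Rightarrow> real" where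
  "chart_weight c z = (cmod (1 + c * z))\<^sup>2 + (cmod z)\<^sup>2"

lemma chart_inv_chart [simp]: "chart_inv c (chart c z) = z"
  by (simp add: chart_def chart_inv_def)

lemma chart_chart_inv [simp]: "x \<noteq> Fin c \<Longrightarrow> chart c (chart_inv c x) = x"
  by (cases x) (auto simp: chart_def chart_inv_def)

lemma chart_neq [simp]: "chart c z \<noteq> Fin c"
  by (auto simp: chart_def)

lemma chart_eq_iff [simp]: "chart c z = chart c w \<longleftrightarrow> z = w"
  by (metis chart_inv_chart)

lemma chart_weight_pos: "chart_weight c z > 0"
proof (cases "z = 0")
  case False
  then show ?thesis by (simp add: chart_weight_def add_nonneg_pos)
qed (simp add: chart_weight_def)

lemma continuous_chart_weight: "continuous_on S (chart_weight c)"
  unfolding chart_weight_def by (intro continuous_intros)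

text \<open>Homogeneous coordinates: the point \<open>a / b\<close> of the sphere.\<close>

definition hom_sphere :: "complex \<Rightarrow> complex \<Rightarrow> complex \<times> real" where
  "hom_sphere a b = ((2 / ((cmod a)\<^sup>2 + (cmod b)\<^sup>2)) *\<^sub>R (a * cnj b),
     ((cmod a)\<^sup>2 - (cmod b)\<^sup>2) / ((cmod a)\<^sup>2 + (cmod b)\<^sup>2))"

lemma to_sphere_chart: "to_sphere (chart c z) = hom_sphere (1 + c * z) z"
proof (cases "z = 0")
  case False
  define a where "a = 1 + c * z"
  have u: "1 / z + c = a / z" using False by (simp add: a_def field_simps)
  have z2: "(cmod z)\<^sup>2 > 0" using False by simp
  have w: "(cmod a)\<^sup>2 + (cmod z)\<^sup>2 > 0" using z2 by (simp add: add_nonneg_pos)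
  have "1 + (cmod (a / z))\<^sup>2 = ((cmod a)\<^sup>2 + (cmod z)\<^sup>2) / (cmod z)\<^sup>2"
    using z2 by (simp add: norm_divide power_divide field_simps)
  then have e: "2 / (1 + (cmod (a / z))\<^sup>2) = 2 / ((cmod a)\<^sup>2 + (cmod z)\<^sup>2) * (cmod z)\<^sup>2" by simp
  have "((cmod z)\<^sup>2) *\<^sub>R (a / z) = a * cnj z"
    using False complex_norm_square[of z] by (simp add: scaleR_conv_of_real field_simps)
  then have f1: "(2 / (1 + (cmod (a / z))\<^sup>2)) *\<^sub>R (a / z) = (2 / ((cmod a)\<^sup>2 + (cmod z)\<^sup>2)) *\<^sub>R (a * cnj z)"
    unfolding e by (metis scaleR_scaleR)
  have f2: "((cmod (a / z))\<^sup>2 - 1) / (1 + (cmod (a / z))\<^sup>2) = ((cmod a)\<^sup>2 - (cmod z)\<^sup>2) / ((cmod a)\<^sup>2 + (cmod z)\<^sup>2)"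
    using z2 w by (simp add: norm_divide power_divide divide_simps)
  have "chart c z = Fin (a / z)" using False u by (simp add: chart_def)
  then show ?thesis unfolding hom_sphere_def a_def[symmetric] using f1 f2 by simp
qed (simp add: chart_def hom_sphere_def zero_prod_def)

section \<open>Spherical distance in a chart\<close>

lemma to_sphere_Fin: "to_sphere (Fin c) = hom_sphere c 1"
  by (simp add: hom_sphere_def add.commute)

text \<open>An identity of Lagrange type for homogeneous coordinates. The inner product is the
  cosine of the spherical distance \<open>d\<close>, so in view of
  \<open>cos d = 1 - 2 * (sin (d / 2))^2\<close> the quotient multiplied by 2 is the square of
  \<open>sin (d / 2)\<close>.\<close>

lemma inner_hom_sphere:
  assumes N: "(cmod a)\<^sup>2 + (cmod b)\<^sup>2 > 0" and N': "(cmod a')\<^sup>2 + (cmod b')\<^sup>2 > 0"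
  shows "hom_sphere a b \<bullet> hom_sphere a' b' =
    1 - 2 * (cmod (a * b' - a' * b))\<^sup>2 / (((cmod a)\<^sup>2 + (cmod b)\<^sup>2) * ((cmod a')\<^sup>2 + (cmod b')\<^sup>2))"
proof -
  define n where "n = (cmod a)\<^sup>2 + (cmod b)\<^sup>2"
  define n' where "n' = (cmod a')\<^sup>2 + (cmod b')\<^sup>2"
  have n: "n > 0" "n' > 0" using N N' by (auto simp: n_def n'_def)
  have key: "4 * ((a * cnj b) \<bullet> (a' * cnj b')) + ((cmod a)\<^sup>2 - (cmod b)\<^sup>2) * ((cmod a')\<^sup>2 - (cmod b')\<^sup>2) =
      n * n' - 2 * (cmod (a * b' - a' * b))\<^sup>2"
    unfolding n_def n'_def cmod_power2 inner_complex_def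
    by (simp add: power2_eq_square algebra_simps)
  have "hom_sphere a b \<bullet> hom_sphere a' b' =
      (4 * ((a * cnj b) \<bullet> (a' * cnj b')) + ((cmod a)\<^sup>2 - (cmod b)\<^sup>2) * ((cmod a')\<^sup>2 - (cmod b')\<^sup>2)) / (n * n')"
    unfolding hom_sphere_def n_def[symmetric] n'_def[symmetric]
    by (simp add: inner_prod_def add_divide_distrib)
  then show ?thesis unfolding key n_def[symmetric] n'_def[symmetric]
    using n by (simp add: diff_divide_distrib)
qed

text \<open>Up to pi / 3 the derivative \<open>cos t - 1 / 2\<close> of the difference is
  nonnegative. Beyond, \<open>sin t\<close> is at least \<open>sqrt 3 / 2\<close>, and
  \<open>8 / 10\<close> lies between this and the largest value pi / 4 of
  \<open>t / 2\<close>.\<close>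

lemma sin_ge_half: "t / 2 \<le> sin t" if "0 \<le> t" "t \<le> pi / 2"
proof (cases "t \<le> pi / 3")
  case True
  have "sin 0 - 0 / 2 \<le> sin t - t / 2"
  proof (rule DERIV_nonneg_imp_nondecreasing[OF that(1)])
    fix s assume s: "0 \<le> s" "s \<le> t"
    have "cos (pi / 3) \<le> cos s" using s True by (intro cos_monotone_0_pi_le) auto
    then have "0 \<le> cos s - 1 / 2" by (simp add: cos_60)
    then show "\<exists>y. ((\<lambda>t. sin t - t / 2) has_real_derivative y) (at s) \<and> 0 \<le> y"
      by (intro exI[of _ "cos s - 1 / 2"]) (auto intro!: derivative_eq_intros)
  qed
  then show ?thesis by simp
next
  case False
  have "sin (pi / 3) \<le> sin t" using False that by (intro sin_monotone_2pi_le) auto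
  moreover have "t / 2 \<le> 8 / 10"
  proof -
    have "pi \<le> 16 / 5" using pi_approx(2) by (rule order_trans) simp
    then show ?thesis using that(2) by linarith
  qed
  moreover have "8 / 10 \<le> sqrt 3 / 2"
  proof -
    have "8 / 5 \<le> sqrt 3" by (rule real_le_rsqrt) (simp add: power2_eq_square)
    then show ?thesis by simp
  qed
  ultimately show ?thesis by (simp add: sin_60)
qed

text \<open>Here \<open>k = sin (d / 2)\<close> for the spherical distance \<open>d\<close>, and
  this sine lies between \<open>d / 4\<close> and \<open>d / 2\<close>.\<close>

lemma dist_ecomplex_bounds:
  assumes k: "to_sphere x \<bullet> to_sphere y = 1 - 2 * k\<^sup>2" and k0: "k \<ge> 0"
  shows "2 * k \<le> dist x y" "dist x y \<le> 4 * k"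
proof -
  define d where "d = dist x y"
  have d: "0 \<le> d" "d \<le> pi" "cos d = 1 - 2 * k\<^sup>2"
    using inner_to_sphere_bounds[of x y] k arccos_lbound[of "to_sphere x \<bullet> to_sphere y"]
      arccos_ubound[of "to_sphere x \<bullet> to_sphere y"] cos_arccos[of "to_sphere x \<bullet> to_sphere y"]
    unfolding d_def dist_ecomplex_def by auto
  have "cos d = 1 - 2 * (sin (d / 2))\<^sup>2" using cos_double_sin[of "d / 2"] by simp
  then have "(sin (d / 2))\<^sup>2 = k\<^sup>2" using d(3) by simp
  moreover have "0 \<le> sin (d / 2)" using d by (intro sin_ge_zero) auto
  ultimately have k': "k = sin (d / 2)" using k0 power2_eq_iff_nonneg by metis
  have "sin (d / 2) \<le> d / 2" using d(1) sin_x_le_x[of "d / 2"] by simp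
  then show "2 * k \<le> dist x y" using k' by (simp add: d_def)
  have "d / 2 / 2 \<le> sin (d / 2)" using d by (intro sin_ge_half) auto
  then show "dist x y \<le> 4 * k" using k' by (simp add: d_def)
qed

lemma dist_chart:
  "2 * (cmod (z - w) / sqrt (chart_weight c z * chart_weight c w)) \<le> dist (chart c z) (chart c w)"
  "dist (chart c z) (chart c w) \<le> 4 * (cmod (z - w) / sqrt (chart_weight c z * chart_weight c w))"
proof -
  let ?k = "cmod (z - w) / sqrt (chart_weight c z * chart_weight c w)"
  have W: "chart_weight c z * chart_weight c w > 0" by (simp add: chart_weight_pos)
  have "to_sphere (chart c z) \<bullet> to_sphere (chart c w) = 1 - 2 * (cmod (z - w))\<^sup>2 / (chart_weight c z * chart_weight c w)"
    unfolding to_sphere_chart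
    using inner_hom_sphere[of "1 + c * z" z "1 + c * w" w] chart_weight_pos[of c z] chart_weight_pos[of c w]
    by (simp add: chart_weight_def algebra_simps norm_minus_commute)
  then have i: "to_sphere (chart c z) \<bullet> to_sphere (chart c w) = 1 - 2 * ?k\<^sup>2"
    using W by (simp add: power_divide)
  have k0: "?k \<ge> 0" using W by simp
  show "2 * ?k \<le> dist (chart c z) (chart c w)" "dist (chart c z) (chart c w) \<le> 4 * ?k"
    using dist_ecomplex_bounds[OF i k0] by auto
qed

lemma dist_chart_centre:
  "2 / sqrt (chart_weight c z * (1 + (cmod c)\<^sup>2)) \<le> dist (chart c z) (Fin c)"
  "dist (chart c z) (Fin c) \<le> 4 / sqrt (chart_weight c z * (1 + (cmod c)\<^sup>2))"
proof -
  let ?k = "1 / sqrt (chart_weight c z * (1 + (cmod c)\<^sup>2))"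
  have c: "1 + (cmod c)\<^sup>2 > 0" by (simp add: add_pos_nonneg)
  have W: "chart_weight c z * (1 + (cmod c)\<^sup>2) > 0" using c by (simp add: chart_weight_pos)
  have "to_sphere (chart c z) \<bullet> to_sphere (Fin c) = 1 - 2 / (chart_weight c z * (1 + (cmod c)\<^sup>2))"
    unfolding to_sphere_chart to_sphere_Fin
    using inner_hom_sphere[of "1 + c * z" z c 1] chart_weight_pos[of c z] c
    by (simp add: chart_weight_def add.commute)
  then have i: "to_sphere (chart c z) \<bullet> to_sphere (Fin c) = 1 - 2 * ?k\<^sup>2"
    using W by (simp add: power_divide)
  have k0: "?k \<ge> 0" using W by simp
  show "2 / sqrt (chart_weight c z * (1 + (cmod c)\<^sup>2)) \<le> dist (chart c z) (Fin c)"
    "dist (chart c z) (Fin c) \<le> 4 / sqrt (chart_weight c z * (1 + (cmod c)\<^sup>2))"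
    using dist_ecomplex_bounds[OF i k0] by auto
qed

lemma chart_weight_bounds:
  assumes "bounded B"
  obtains m M where "m > 0" "M > 0" "\<And>z. z \<in> B \<Longrightarrow> m \<le> chart_weight c z" "\<And>z. z \<in> B \<Longrightarrow> chart_weight c z \<le> M"
proof -
  have cl: "compact (closure (insert 0 B))" using assms by (simp add: compact_closure)
  then obtain a where a: "\<And>z. z \<in> closure (insert 0 B) \<Longrightarrow> chart_weight c a \<le> chart_weight c z"
    using continuous_attains_inf[OF cl _ continuous_chart_weight, of c] closure_subset by blast
  obtain b where b: "\<And>z. z \<in> closure (insert 0 B) \<Longrightarrow> chart_weight c z \<le> chart_weight c b"
    using continuous_attains_sup[OF cl _ continuous_chart_weight, of c] closure_subset by blast
  have "B \<subseteq> closure (insert 0 B)" using closure_subset by blast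
  then show ?thesis using that[of "chart_weight c a" "chart_weight c b"] a b chart_weight_pos by blast
qed

text \<open>On a bounded set the weight is bounded above and away from zero. Hence diameters and
  linear measure change only by constant factors between sphere and plane.\<close>

lemma chart_bilipschitz:
  assumes "bounded B"
  obtains m M where "m > 0" "M > 0"
    "\<And>z w. z \<in> B \<Longrightarrow> w \<in> B \<Longrightarrow> m * dist z w \<le> dist (chart c z) (chart c w)"
    "\<And>z w. z \<in> B \<Longrightarrow> w \<in> B \<Longrightarrow> dist (chart c z) (chart c w) \<le> M * dist z w"
proof -
  obtain \<mu> \<nu> where \<mu>: "\<mu> > 0" "\<nu> > 0" "\<And>z. z \<in> B \<Longrightarrow> \<mu> \<le> chart_weight c z" "\<And>z. z \<in> B \<Longrightarrow> chart_weight c z \<le> \<nu>"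
    using chart_weight_bounds[OF assms] by blast
  have sq: "\<mu> \<le> sqrt (chart_weight c z * chart_weight c w)" "sqrt (chart_weight c z * chart_weight c w) \<le> \<nu>"
    if "z \<in> B" "w \<in> B" for z w
  proof -
    have "\<mu> * \<mu> \<le> chart_weight c z * chart_weight c w" "chart_weight c z * chart_weight c w \<le> \<nu> * \<nu>"
      using \<mu> that less_imp_le[OF chart_weight_pos] by (auto intro!: mult_mono)
    then show "\<mu> \<le> sqrt (chart_weight c z * chart_weight c w)" "sqrt (chart_weight c z * chart_weight c w) \<le> \<nu>"
      using \<mu>(1,2) by (auto intro: real_le_rsqrt real_le_lsqrt simp: power2_eq_square)
  qed
  show ?thesis
  proof (rule that[of "2 / \<nu>" "4 / \<mu>"])
    fix z w assume zw: "z \<in> B" "w \<in> B"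
    have s0: "sqrt (chart_weight c z * chart_weight c w) > 0" by (simp add: chart_weight_pos)
    have "2 / \<nu> * dist z w \<le> 2 * (cmod (z - w) / sqrt (chart_weight c z * chart_weight c w))"
      using divide_left_mono[OF sq(2)[OF zw], of "cmod (z - w)"] \<mu>(2) s0 by (simp add: dist_norm)
    then show "2 / \<nu> * dist z w \<le> dist (chart c z) (chart c w)" using dist_chart(1) order_trans by blast
    have "4 * (cmod (z - w) / sqrt (chart_weight c z * chart_weight c w)) \<le> 4 / \<mu> * dist z w"
      using divide_left_mono[OF sq(1)[OF zw], of "cmod (z - w)"] \<mu>(1) s0 by (simp add: dist_norm)
    then show "dist (chart c z) (chart c w) \<le> 4 / \<mu> * dist z w" using dist_chart(2) order_trans by blast
  qed (use \<mu> in auto)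
qed

lemma continuous_on_chart: "continuous_on S (chart c)"
proof (rule continuous_on_subset)
  show "continuous_on UNIV (chart c)"
    unfolding continuous_on_iff
  proof (intro ballI allI impI)
    fix z :: complex and e :: real assume e: "e > 0"
    obtain m M where M: "M > 0" "\<And>v w. v \<in> ball z 1 \<Longrightarrow> w \<in> ball z 1 \<Longrightarrow> dist (chart c v) (chart c w) \<le> M * dist v w"
      using chart_bilipschitz[OF bounded_ball[of z 1], of c] by metis
    show "\<exists>d>0. \<forall>w\<in>UNIV. dist w z < d \<longrightarrow> dist (chart c w) (chart c z) < e"
    proof (intro exI[of _ "min 1 (e / M)"] conjI ballI impI)
      fix w assume w: "dist w z < min 1 (e / M)"
      then have "dist (chart c w) (chart c z) \<le> M * dist w z" using M(2) by (auto simp: dist_commute)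
      also have "\<dots> < e" using w M(1) by (simp add: field_simps)
      finally show "dist (chart c w) (chart c z) < e" .
    qed (use e M in auto)
  qed
qed auto

text \<open>The lower bound on the spherical distance involves the weight of the unknown point
  \<open>w\<close>, whose square root is at most \<open>(1 + cmod c) * (1 + cmod w)\<close>.
  Bounding \<open>cmod w\<close> by \<open>cmod z + cmod (z - w)\<close> produces a multiple of
  \<open>cmod (z - w)\<close> that is absorbed on the left.\<close>

lemma continuous_on_chart_inv: "continuous_on (- {Fin c}) (chart_inv c)"
  unfolding continuous_on_iff
proof (intro ballI allI impI)
  fix x :: ecomplex and e :: real assume x: "x \<in> - {Fin c}" and e: "e > 0"
  define z where "z = chart_inv c x"
  have xz: "x = chart c z" using x by (simp add: z_def)
  define A where "A = sqrt (chart_weight c z) * (1 + cmod c)"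
  have c0: "0 < 1 + cmod c" by (simp add: add_pos_nonneg)
  have A: "A > 0" unfolding A_def using chart_weight_pos c0 by (intro mult_pos_pos) auto
  define k where "k = A * (1 + cmod z)"
  have k: "k > 0" unfolding k_def using A by (intro mult_pos_pos) (auto simp: add_pos_nonneg)
  \<comment> \<open>The first bound limits the absorbed term to half of \<open>cmod (z - w)\<close>;
    the second leaves at most \<open>e / 2\<close> in the end.\<close>
  define d where "d = min (1 / (2 * A)) (e / (4 * k))"
  have d: "d > 0" using A k e by (simp add: d_def)
  have "dist (chart_inv c y) z < e" if y: "y \<in> - {Fin c}" and yd: "dist y x < d" for y
  proof -
    define w where "w = chart_inv c y"
    have yw: "y = chart c w" using y by (simp add: w_def)
    have n: "cmod (1 + c * w) \<le> 1 + cmod c * cmod w"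
      using norm_triangle_ineq[of 1 "c * w"] by (simp add: norm_mult)
    have "chart_weight c w \<le> (cmod (1 + c * w) + cmod w)\<^sup>2"
      by (simp add: chart_weight_def power2_sum)
    also have "\<dots> \<le> ((1 + cmod c) * (1 + cmod w))\<^sup>2"
    proof (rule power_mono)
      have "cmod (1 + c * w) + cmod w \<le> (1 + cmod c) * (1 + cmod w) - cmod c" using n by (simp add: algebra_simps)
      then show "cmod (1 + c * w) + cmod w \<le> (1 + cmod c) * (1 + cmod w)" by (smt (verit) norm_ge_zero)
    qed simp
    finally have "sqrt (chart_weight c w) \<le> (1 + cmod c) * (1 + cmod w)"
      using c0 by (intro real_le_lsqrt) auto
    then have sq: "sqrt (chart_weight c z * chart_weight c w) \<le> A * (1 + cmod w)"
      unfolding A_def real_sqrt_mult mult.assoc by (intro mult_left_mono) (auto simp: less_imp_le[OF chart_weight_pos])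
    have s0: "sqrt (chart_weight c z * chart_weight c w) > 0" by (simp add: chart_weight_pos)
    have "2 * (cmod (z - w) / sqrt (chart_weight c z * chart_weight c w)) < d"
      using dist_chart(1)[of z w c] yd yw xz by (simp add: dist_commute)
    then have "cmod (z - w) \<le> d * sqrt (chart_weight c z * chart_weight c w)"
      using s0 by (simp add: field_simps) (smt (verit) norm_ge_zero)
    also have "\<dots> \<le> d * (A * (1 + cmod w))" using sq d by (intro mult_left_mono) auto
    also have "\<dots> \<le> d * (A * (1 + cmod z + cmod (z - w)))"
      using d A norm_triangle_sub[of w z] by (intro mult_left_mono) (auto simp: norm_minus_commute)
    also have "\<dots> = d * k + d * A * cmod (z - w)" by (simp add: k_def algebra_simps)
    also have "\<dots> \<le> d * k + 1 / 2 * cmod (z - w)"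
    proof -
      have "d * A \<le> 1 / (2 * A) * A" using A by (intro mult_right_mono) (auto simp: d_def)
      then show ?thesis using A by (intro add_left_mono mult_right_mono) auto
    qed
    finally have "cmod (z - w) \<le> 2 * (d * k)" by simp
    also have "\<dots> \<le> 2 * (e / (4 * k) * k)" using k by (intro mult_left_mono mult_right_mono) (auto simp: d_def)
    also have "\<dots> < e" using k e by simp
    finally show ?thesis by (simp add: w_def dist_norm norm_minus_commute)
  qed
  then show "\<exists>d>0. \<forall>y\<in>- {Fin c}. dist y x < d \<longrightarrow> dist (chart_inv c y) (chart_inv c x) < e"
    using d z_def by auto
qed

lemma centre_notin_chart_image [simp]: "Fin c \<notin> chart c ` S"
  using chart_neq by (metis imageE)

lemma continuous_on_chart_inv_image: "continuous_on (chart c ` S) (chart_inv c)"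
  by (rule continuous_on_subset[OF continuous_on_chart_inv]) auto

lemma open_chart_image:
  assumes "open W" shows "open (chart c ` W)"
proof -
  have "open (- {Fin c} \<inter> chart_inv c -` W)"
    using continuous_open_preimage[OF continuous_on_chart_inv _ assms] by auto
  moreover have "chart c ` W = - {Fin c} \<inter> chart_inv c -` W"
    by (auto simp: image_iff) (metis chart_chart_inv)
  ultimately show ?thesis by simp
qed

lemma chart_away:
  assumes "bounded B"
  obtains d where "d > 0" "\<And>z. z \<in> B \<Longrightarrow> d \<le> dist (chart c z) (Fin c)"
proof -
  obtain m M where M: "M > 0" "\<And>z. z \<in> B \<Longrightarrow> chart_weight c z \<le> M"
    using chart_weight_bounds[OF assms, of c] by metis
  have c: "1 + (cmod c)\<^sup>2 > 0" by (simp add: add_pos_nonneg)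
  show ?thesis
  proof (rule that[of "2 / sqrt (M * (1 + (cmod c)\<^sup>2))"])
    show "2 / sqrt (M * (1 + (cmod c)\<^sup>2)) > 0" using M c by simp
    fix z assume z: "z \<in> B"
    have "2 / sqrt (M * (1 + (cmod c)\<^sup>2)) \<le> 2 / sqrt (chart_weight c z * (1 + (cmod c)\<^sup>2))"
      using M(2)[OF z] c chart_weight_pos[of c z] M(1)
      by (intro divide_left_mono real_sqrt_le_mono mult_right_mono mult_pos_pos) auto
    then show "2 / sqrt (M * (1 + (cmod c)\<^sup>2)) \<le> dist (chart c z) (Fin c)"
      using dist_chart_centre(1) order_trans by blast
  qed
qed

lemma chart_near:
  assumes "e > 0"
  obtains R where "R > 0" "\<And>z. R < cmod z \<Longrightarrow> dist (chart c z) (Fin c) < e"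
proof (rule that[of "4 / e"])
  fix z assume z: "4 / e < cmod z"
  then have z0: "cmod z > 0" using assms by (meson divide_pos_pos order_less_trans zero_less_numeral)
  have "(cmod z)\<^sup>2 * 1 \<le> chart_weight c z * (1 + (cmod c)\<^sup>2)"
    by (intro mult_mono) (auto simp: chart_weight_def)
  then have "cmod z \<le> sqrt (chart_weight c z * (1 + (cmod c)\<^sup>2))" by (intro real_le_rsqrt) simp
  then have "4 / sqrt (chart_weight c z * (1 + (cmod c)\<^sup>2)) \<le> 4 / cmod z"
    using z0 chart_weight_pos by (intro divide_left_mono mult_pos_pos real_sqrt_gt_zero) (auto simp: add_pos_nonneg)
  also have "\<dots> < e" using z assms z0 by (simp add: field_simps)
  finally show "dist (chart c z) (Fin c) < e" using dist_chart_centre(2)[of c z] by linarith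
qed (use assms in simp)

section \<open>Domains and their complements in a chart\<close>

definition chart_hull :: "complex \<Rightarrow> ecomplex set \<Rightarrow> complex set" where
  "chart_hull c \<Omega> = {z. chart c z \<notin> \<Omega>}"

locale chart_domain =
  fixes c :: complex and \<Omega> :: "ecomplex set"
  assumes dom: "domain \<Omega>" and centre: "Fin c \<in> \<Omega>"
begin

lemma open_domain: "open \<Omega>" and connected_domain: "connected \<Omega>"
  using dom by (auto simp: domain_def)

lemma open_complement: "open (- chart_hull c \<Omega>)"
proof -
  have "- chart_hull c \<Omega> = chart c -` \<Omega>" by (auto simp: chart_hull_def)
  then show ?thesis using open_vimage[OF open_domain continuous_on_chart] by simp
qed

lemma hull_far:
  obtains R where "R > 0" "\<And>z. R < cmod z \<Longrightarrow> z \<notin> chart_hull c \<Omega>"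
proof -
  obtain e where e: "e > 0" "ball (Fin c) e \<subseteq> \<Omega>" using open_domain centre open_contains_ball by blast
  obtain R where "R > 0" "\<And>z. R < cmod z \<Longrightarrow> dist (chart c z) (Fin c) < e" using chart_near[OF e(1)] by blast
  then show ?thesis using that e(2) by (auto simp: chart_hull_def dist_commute subset_iff)
qed

lemma compact_hull: "compact (chart_hull c \<Omega>)"
proof -
  obtain R where "R > 0" "\<And>z. R < cmod z \<Longrightarrow> z \<notin> chart_hull c \<Omega>" using hull_far by blast
  then have "bounded (chart_hull c \<Omega>)" unfolding bounded_iff using not_less by blast
  then show ?thesis using open_complement by (simp add: compact_eq_bounded_closed closed_def)
qed

lemma chart_complement: "\<Omega> = insert (Fin c) (chart c ` (- chart_hull c \<Omega>))"
proof
  show "\<Omega> \<subseteq> insert (Fin c) (chart c ` (- chart_hull c \<Omega>))"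
  proof
    fix x assume x: "x \<in> \<Omega>"
    show "x \<in> insert (Fin c) (chart c ` (- chart_hull c \<Omega>))"
    proof (cases "x = Fin c")
      case False
      then have "x = chart c (chart_inv c x)" "chart_inv c x \<in> - chart_hull c \<Omega>"
        using x by (simp_all add: chart_hull_def)
      then show ?thesis by blast
    qed simp
  qed
qed (use centre in \<open>auto simp: chart_hull_def\<close>)

text \<open>Removing \<open>Fin c\<close> does not disconnect the domain. In a splitting of the
  plane set, the exterior of a large disc is connected and lies in one part; with
  \<open>Fin c\<close> adjoined, this part is still open on the sphere, so the domain itself would
  split.\<close>

lemma connected_complement: "connected (- chart_hull c \<Omega>)"
proof (rule ccontr)
  let ?U = "- chart_hull c \<Omega>"
  assume "\<not> connected ?U"
  then obtain A B where AB: "open A" "open B" "?U \<subseteq> A \<union> B" "A \<inter> B \<inter> ?U = {}" "A \<inter> ?U \<noteq> {}" "B \<inter> ?U \<noteq> {}"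
    unfolding connected_def by blast
  obtain R where R: "R > 0" "\<And>z. R < cmod z \<Longrightarrow> z \<in> ?U"
    using hull_far by (metis ComplI)
  have far: False if A: "open A" and B: "open B" and cov: "?U \<subseteq> A \<union> B" and dis: "A \<inter> B \<inter> ?U = {}"
    and ne: "B \<inter> ?U \<noteq> {}" and sub: "- cball 0 R \<subseteq> A" for A B
  proof -
    have oU: "open ?U" by (rule open_complement)
    obtain d where d: "d > 0" "\<And>z. z \<in> cball 0 R \<Longrightarrow> d \<le> dist (chart c z) (Fin c)"
      using chart_away[OF bounded_cball] by blast
    let ?A = "insert (Fin c) (chart c ` (A \<inter> ?U))" and ?B = "chart c ` (B \<inter> ?U)"
    have oA: "open (chart c ` (A \<inter> ?U))" and oB: "open ?B"
      using open_chart_image A B oU open_Int by blast+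
    have "?A = ball (Fin c) d \<union> chart c ` (A \<inter> ?U)"
    proof -
      have "y \<in> ?A" if y: "y \<in> ball (Fin c) d" for y
      proof (cases "y = Fin c")
        case False
        define z where "z = chart_inv c y"
        have yz: "y = chart c z" using False by (simp add: z_def)
        then have "z \<notin> cball 0 R" using d(2)[of z] y by (auto simp: dist_commute)
        then have "z \<in> A" "z \<in> ?U" using sub R(2)[of z] by auto
        then show ?thesis using yz by blast
      qed simp
      moreover have "Fin c \<in> ball (Fin c) d" using d(1) by simp
      ultimately show ?thesis by blast
    qed
    then have oA': "open ?A" using oA by auto
    have "\<Omega> \<subseteq> ?A \<union> ?B"
    proof
      fix x assume "x \<in> \<Omega>"
      then consider "x = Fin c" | z where "z \<in> ?U" "x = chart c z" using chart_complement by blast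
      then show "x \<in> ?A \<union> ?B" using cov by cases auto
    qed
    moreover have "?A \<inter> ?B \<inter> \<Omega> = {}"
    proof -
      have False if "y \<in> ?A" "y \<in> ?B" for y
      proof -
        obtain z where z: "z \<in> B \<inter> ?U" "y = chart c z" using \<open>y \<in> ?B\<close> by blast
        then have "chart c z \<in> chart c ` (A \<inter> ?U)" using \<open>y \<in> ?A\<close> chart_neq by (metis insertE)
        then obtain w where "w \<in> A \<inter> ?U" "chart c z = chart c w" by blast
        then have "z \<in> A \<inter> B \<inter> ?U" using z by simp
        then show False using dis by blast
      qed
      then show ?thesis by blast
    qed
    moreover have "?A \<inter> \<Omega> \<noteq> {}" using centre by blast
    moreover have "?B \<inter> \<Omega> \<noteq> {}" using ne by (auto simp: chart_hull_def)
    ultimately show False using connectedD[OF connected_domain oA' oB] by metis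
  qed
  have con: "connected (- cball (0::complex) R)" by (intro connected_complement_bounded_convex) auto
  have sub: "- cball 0 R \<subseteq> ?U"
  proof (rule subsetI)
    fix z :: complex assume "z \<in> - cball 0 R"
    then show "z \<in> ?U" by (intro R(2)) simp
  qed
  then have "A \<inter> (- cball 0 R) = {} \<or> B \<inter> (- cball 0 R) = {}"
    using connectedD[OF con AB(1,2)] AB(3,4) by blast
  then show False
    using far[of A B] far[of B A] AB sub by blast
qed

lemma closure_chart:
  assumes "x \<noteq> Fin c"
  shows "x \<in> closure \<Omega> \<longleftrightarrow> chart_inv c x \<in> closure (- chart_hull c \<Omega>)"
proof
  define z where "z = chart_inv c x"
  have xz: "x = chart c z" using assms by (simp add: z_def)
  assume x: "x \<in> closure \<Omega>"
  have "(- chart_hull c \<Omega>) \<inter> W \<noteq> {}" if W: "open W" "z \<in> W" for W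
  proof -
    have "open (chart c ` W)" "x \<in> chart c ` W" using open_chart_image W xz by auto
    then have "\<Omega> \<inter> chart c ` W \<noteq> {}" using x closure_iff_nhds_not_empty by (metis inf_commute subset_refl)
    then show ?thesis by (auto simp: chart_hull_def)
  qed
  then show "chart_inv c x \<in> closure (- chart_hull c \<Omega>)"
    unfolding z_def[symmetric] closure_iff_nhds_not_empty by blast
next
  define z where "z = chart_inv c x"
  have xz: "x = chart c z" using assms by (simp add: z_def)
  assume "chart_inv c x \<in> closure (- chart_hull c \<Omega>)"
  then have z: "z \<in> closure (- chart_hull c \<Omega>)" by (simp add: z_def)
  have "chart c ` closure (- chart_hull c \<Omega>) \<subseteq> closure (chart c ` (- chart_hull c \<Omega>))"
    by (rule continuous_image_closure_subset[OF continuous_on_chart[of UNIV]]) simp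
  then show "x \<in> closure \<Omega>" using z xz chart_complement closure_mono[of "chart c ` (- chart_hull c \<Omega>)" \<Omega>] by blast
qed

lemma frontier_hull: "frontier (chart_hull c \<Omega>) = chart_hull c \<Omega> \<inter> closure (- chart_hull c \<Omega>)"
  using compact_imp_closed[OF compact_hull] by (simp add: frontier_closures)

lemma frontier_chart: "frontier \<Omega> = chart c ` frontier (chart_hull c \<Omega>)"
proof -
  have "x \<in> frontier \<Omega> \<longleftrightarrow> x \<in> chart c ` frontier (chart_hull c \<Omega>)" for x
  proof (cases "x = Fin c")
    case True
    then show ?thesis using centre open_domain chart_neq by (auto simp: frontier_def interior_open)
  next
    case False
    then have x: "x = chart c (chart_inv c x)" by simp
    have "x \<in> frontier \<Omega> \<longleftrightarrow> chart_inv c x \<in> frontier (chart_hull c \<Omega>)"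
      unfolding frontier_hull using closure_chart[OF False] open_domain x
      by (auto simp: frontier_def interior_open chart_hull_def)
    then show ?thesis using x by (metis chart_eq_iff imageE image_eqI)
  qed
  then show ?thesis by blast
qed

end

section \<open>Components, curves and continua in a chart\<close>

lemma chart_inv_image_chart [simp]: "chart_inv c ` chart c ` S = S"
  by (simp add: image_image)

lemma components_chart_image: "components (chart c ` S) = (`) (chart c) ` components S"
proof -
  have "homeomorphism S (chart c ` S) (chart c) (chart_inv c)"
    unfolding homeomorphism_def
    using continuous_on_chart continuous_on_chart_inv_image by (auto simp: image_image)
  then have "cc (chart c ` S) (chart c x) = chart c ` cc S x" if "x \<in> S" for x
    using connected_component_set_homeomorphism that by blast
  then show ?thesis by (auto simp: components_def image_iff)
qed

lemma inj_image_chart: "inj_on ((`) (chart c)) S"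
  by (rule inj_on_inverseI[of _ "(`) (chart_inv c)"]) (simp add: image_image)

lemma nondegenerate_components_chart:
  "nondegenerate_components (chart c ` S) = (`) (chart c) ` nondegenerate_components S"
proof -
  have "{D \<in> h ` A. Q D} = h ` {C \<in> A. Q (h C)}" for h :: "complex set \<Rightarrow> ecomplex set" and A Q by auto
  moreover have "(\<exists>x\<in>chart c ` C. \<exists>y\<in>chart c ` C. x \<noteq> y) \<longleftrightarrow> (\<exists>x\<in>C. \<exists>y\<in>C. x \<noteq> y)" for C by simp
  ultimately show ?thesis unfolding nondegenerate_components_def components_chart_image by simp
qed

lemma Union_point_components: "\<Union>(point_components S) = {x. {x} \<in> components S}"
  by (auto simp: point_components_def)

lemma Union_point_components_chart:
  "\<Union>(point_components (chart c ` S)) = chart c ` \<Union>(point_components S)"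
proof -
  have "{y} \<in> (`) (chart c) ` components S \<longleftrightarrow> y \<in> chart c ` {x. {x} \<in> components S}" for y
  proof
    assume "{y} \<in> (`) (chart c) ` components S"
    then obtain C where C: "C \<in> components S" "chart c ` C = {y}" by auto
    then have "C = {chart_inv c y}" by (metis chart_inv_image_chart image_empty image_insert)
    moreover from this have "y = chart c (chart_inv c y)" using C(2) by auto
    ultimately show "y \<in> chart c ` {x. {x} \<in> components S}" using C(1) by blast
  next
    assume "y \<in> chart c ` {x. {x} \<in> components S}"
    then obtain x where "y = chart c x" "{x} \<in> components S" by blast
    then show "{y} \<in> (`) (chart c) ` components S" by (intro image_eqI[of _ _ "{x}"]) auto
  qed
  then show ?thesis unfolding Union_point_components components_chart_image by blast
qed

lemma peano_continuum_image:
  assumes "peano_continuum P" "continuous_on P h"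
  shows "peano_continuum (h ` P)"
proof -
  obtain g :: "real \<Rightarrow> 'a" where g: "continuous_on {0..1} g" "P = g ` {0..1}"
    using assms(1) unfolding peano_continuum_def by blast
  have "continuous_on {0..1} (\<lambda>t. h (g t))"
    using continuous_on_compose2[OF assms(2) g(1)] g(2) by blast
  then show ?thesis unfolding peano_continuum_def using g(2) by (metis image_image)
qed

lemma peano_continuum_chart: "peano_continuum (chart c ` P) \<longleftrightarrow> peano_continuum P"
  using peano_continuum_image[of "chart c ` P" "chart_inv c"] peano_continuum_image[of P "chart c"]
    continuous_on_chart_inv_image continuous_on_chart by fastforce

lemma jordan_curve_chart: "jordan_curve (chart c ` C) \<Longrightarrow> jordan_curve C"
  unfolding jordan_curve_def
proof (elim exE conjE)
  fix g assume g: "simple_path g" "pathfinish g = pathstart g" "path_image g = chart c ` C"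
  have "inj_on (chart_inv c) (chart c ` C)" by (rule inj_on_inverseI[of _ "chart c"]) auto
  then have "simple_path (chart_inv c \<circ> g)"
    using simple_path_continuous_image[OF g(1)] g(3) continuous_on_chart_inv_image by metis
  moreover have "pathfinish (chart_inv c \<circ> g) = pathstart (chart_inv c \<circ> g)"
    using g(2) by (simp add: pathfinish_compose pathstart_compose)
  moreover have "path_image (chart_inv c \<circ> g) = C" using g(3) by (simp add: path_image_compose)
  ultimately show "\<exists>g. simple_path g \<and> pathfinish g = pathstart g \<and> path_image g = C" by blast
qed

section \<open>Passing between the sphere and the plane\<close>

lemma continuous_extension_closure:
  fixes h :: "'a::metric_space \<Rightarrow> 'b::metric_space"
  assumes h: "continuous_on U h" and lim: "\<And>x. x \<in> closure U - U \<Longrightarrow> \<exists>l. (h \<longlongrightarrow> l) (at x within U)"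
  obtains H where "continuous_on (closure U) H" "\<And>x. x \<in> U \<Longrightarrow> H x = h x" "H ` closure U \<subseteq> closure (h ` U)"
proof -
  have "\<exists>l. (x \<in> U \<longrightarrow> l = h x) \<and> (\<forall>e>0. \<exists>d>0. \<forall>y\<in>U. dist y x < d \<longrightarrow> dist (h y) l < e)"
    if x: "x \<in> closure U" for x
  proof (cases "x \<in> U")
    case True
    then show ?thesis using h unfolding continuous_on_iff by blast
  next
    case False
    then obtain l where "(h \<longlongrightarrow> l) (at x within U)" using lim x by blast
    then have "\<forall>e>0. \<exists>d>0. \<forall>y\<in>U. dist y x < d \<longrightarrow> dist (h y) l < e"
      unfolding tendsto_iff eventually_at using False by metis
    then show ?thesis using False by blast
  qed
  then obtain H where H: "\<And>x. x \<in> U \<Longrightarrow> H x = h x"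
    "\<And>x e. x \<in> closure U \<Longrightarrow> e > 0 \<Longrightarrow> \<exists>d>0. \<forall>y\<in>U. dist y x < d \<longrightarrow> dist (h y) (H x) < e"
    using closure_subset[of U] by (metis subsetD)
  have near: "\<exists>y\<in>U. dist y x < d \<and> dist (h y) (H x) < e" if x: "x \<in> closure U" and de: "d > 0" "e > 0" for x d e
  proof -
    obtain d' where d': "d' > 0" "\<forall>y\<in>U. dist y x < d' \<longrightarrow> dist (h y) (H x) < e" using H(2)[OF x de(2)] by blast
    obtain y where "y \<in> U" "dist y x < min d d'"
      using x de(1) d'(1) closure_approachable[of x U] by (metis min_less_iff_conj)
    then show ?thesis using d'(2) by auto
  qed
  have "continuous_on (closure U) H"
    unfolding continuous_on_iff
  proof (intro ballI allI impI)
    fix x e assume x: "x \<in> closure U" and e: "(0::real) < e"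
    obtain d where d: "d > 0" "\<forall>y\<in>U. dist y x < d \<longrightarrow> dist (h y) (H x) < e / 2"
      using H(2)[OF x, of "e / 2"] e by auto
    have "dist (H w) (H x) < e" if w: "w \<in> closure U" "dist w x < d / 2" for w
    proof -
      obtain y where y: "y \<in> U" "dist y w < d / 2" "dist (h y) (H w) < e / 2"
        using near[OF w(1), of "d / 2" "e / 2"] d(1) e by auto
      have "dist y x < d" using dist_triangle[of y x w] y(2) w(2) by linarith
      then have "dist (h y) (H x) < e / 2" using d(2) y(1) by blast
      then show ?thesis using dist_triangle3[of "H w" "H x" "h y"] y(3) by linarith
    qed
    then show "\<exists>d>0. \<forall>w\<in>closure U. dist w x < d \<longrightarrow> dist (H w) (H x) < e"
      using d(1) by (intro exI[of _ "d / 2"]) auto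
  qed
  moreover have "H ` closure U \<subseteq> closure (h ` U)"
  proof clarify
    fix x assume x: "x \<in> closure U"
    show "H x \<in> closure (h ` U)" unfolding closure_approachable
    proof (intro allI impI)
      fix e :: real assume "e > 0"
      then show "\<exists>y\<in>h ` U. dist y (H x) < e" using near[OF x zero_less_one, of e] by blast
    qed
  qed
  ultimately show ?thesis using that H(1) by blast
qed

text \<open>\<open>\<phi>\<close> takes one centre to the other, so that in the two charts it
  becomes a map fixing infinity, as \<open>end_pair\<close> demands.\<close>

locale sphere_homeomorphism = D1: chart_domain c1 \<Omega>1 + D2: chart_domain c2 \<Omega>2
  for c1 \<Omega>1 c2 \<Omega>2 +
  fixes \<phi> \<psi> :: "ecomplex \<Rightarrow> ecomplex"
  assumes homeo: "homeomorphism \<Omega>1 \<Omega>2 \<phi> \<psi>" and centres: "\<phi> (Fin c1) = Fin c2"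
begin

abbreviation K where "K \<equiv> chart_hull c1 \<Omega>1"
abbreviation L where "L \<equiv> chart_hull c2 \<Omega>2"

definition planar where "planar z = chart_inv c2 (\<phi> (chart c1 z))"

lemma inverse_phi: "x \<in> \<Omega>1 \<Longrightarrow> \<psi> (\<phi> x) = x" and phi_in: "x \<in> \<Omega>1 \<Longrightarrow> \<phi> x \<in> \<Omega>2"
  and cont_phi: "continuous_on \<Omega>1 \<phi>" and cont_psi: "continuous_on \<Omega>2 \<psi>"
  using homeo unfolding homeomorphism_def by auto

lemma chart_in: "z \<notin> K \<Longrightarrow> chart c1 z \<in> \<Omega>1"
  by (simp add: chart_hull_def)

lemma phi_chart_neq: "z \<notin> K \<Longrightarrow> \<phi> (chart c1 z) \<noteq> Fin c2"
  using inverse_phi[OF D1.centre] inverse_phi[OF chart_in] centres chart_neq by metis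

lemma chart_planar: "z \<notin> K \<Longrightarrow> chart c2 (planar z) = \<phi> (chart c1 z)"
  unfolding planar_def using phi_chart_neq by simp

lemma planar_in: "z \<notin> K \<Longrightarrow> planar z \<notin> L"
  using chart_planar[of z] phi_in[OF chart_in, of z] by (simp add: chart_hull_def)

lemma continuous_planar: "continuous_on (- K) planar"
proof -
  have "continuous_on (- K) (\<lambda>z. \<phi> (chart c1 z))"
    by (rule continuous_on_compose2[OF cont_phi continuous_on_chart]) (use chart_in in auto)
  then show ?thesis unfolding planar_def
  proof (rule continuous_on_compose2[OF continuous_on_chart_inv _ image_subsetI])
    show "\<phi> (chart c1 z) \<in> - {Fin c2}" if "z \<in> - K" for z using phi_chart_neq[of z] that by simp
  qed
qed

text \<open>On the sphere, points of \<open>B\<close> keep a positive distance from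
  \<open>Fin c1\<close>. A very large value of \<open>planar\<close> would mean an image near
  \<open>Fin c2\<close>, and continuity of \<open>\<psi>\<close> would bring the point itself near
  \<open>Fin c1\<close>.\<close>

lemma bounded_planar:
  assumes B: "bounded B" shows "bounded (planar ` (B - K))"
proof -
  obtain d where d: "d > 0" "\<And>z. z \<in> B \<Longrightarrow> d \<le> dist (chart c1 z) (Fin c1)" using chart_away[OF B] by blast
  obtain e where e: "e > 0" "\<And>y. y \<in> \<Omega>2 \<Longrightarrow> dist y (Fin c2) < e \<Longrightarrow> dist (\<psi> y) (\<psi> (Fin c2)) < d"
    using cont_psi[unfolded continuous_on_iff] D2.centre d(1) by metis
  obtain R where R: "\<And>z. R < cmod z \<Longrightarrow> dist (chart c2 z) (Fin c2) < e" using chart_near[OF e(1)] by metis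
  have "cmod (planar z) \<le> R" if z: "z \<in> B - K" for z
  proof (rule ccontr)
    assume "\<not> ?thesis"
    then have "dist (\<phi> (chart c1 z)) (Fin c2) < e" using R[of "planar z"] chart_planar z by auto
    then have "dist (\<psi> (\<phi> (chart c1 z))) (\<psi> (Fin c2)) < d" using e(2) phi_in chart_in z by blast
    moreover have "\<psi> (\<phi> (chart c1 z)) = chart c1 z" using inverse_phi chart_in z by blast
    moreover have "\<psi> (Fin c2) = Fin c1" using inverse_phi[OF D1.centre] centres by simp
    ultimately show False using d(2)[of z] z by simp
  qed
  then show ?thesis unfolding bounded_iff by blast
qed

end

lemma (in sphere_homeomorphism) swap: "sphere_homeomorphism c2 \<Omega>2 c1 \<Omega>1 \<psi> \<phi>"
proof -
  have "homeomorphism \<Omega>2 \<Omega>1 \<psi> \<phi>" using homeo homeomorphism_sym by blast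
  moreover have "\<psi> (Fin c2) = Fin c1" using inverse_phi[OF D1.centre] centres by simp
  ultimately show ?thesis by unfold_locales
qed

context sphere_homeomorphism begin

definition planar_inv where "planar_inv w = chart_inv c1 (\<psi> (chart c2 w))"

lemma end_pair_planar: "end_pair K L planar planar_inv"
proof -
  interpret s: sphere_homeomorphism c2 \<Omega>2 c1 \<Omega>1 \<psi> \<phi> by (rule swap)
  have pi: "planar_inv = s.planar" by (simp add: fun_eq_iff planar_inv_def s.planar_def)
  have inv1: "planar_inv (planar z) = z" if "z \<notin> K" for z
    using that chart_planar inverse_phi[OF chart_in] by (simp add: planar_inv_def)
  have inv2: "planar (planar_inv w) = w" if "w \<notin> L" for w
    using that s.chart_planar s.inverse_phi[OF s.chart_in] unfolding pi by (simp add: planar_def)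
  have "homeomorphism (- K) (- L) planar planar_inv"
    unfolding homeomorphism_def pi
  proof (intro conjI ballI)
    show "planar ` (- K) = - L"
      using planar_in s.planar_in inv2 unfolding pi by (auto simp: image_iff) (metis ComplI)
    show "s.planar ` (- L) = - K"
      using planar_in s.planar_in inv1 unfolding pi by (auto simp: image_iff) (metis ComplI)
  qed (use inv1 inv2 pi continuous_planar s.continuous_planar in auto)
  then show ?thesis
    using D1.compact_hull D2.compact_hull D1.connected_complement D2.connected_complement
      bounded_planar s.bounded_planar pi by unfold_locales auto
qed

text \<open>Off the finite set \<open>T\<close>, which holds the origin and at most one point sent
  to \<open>Infty\<close>, \<open>planar\<close> is the coordinate expression \<open>F\<close> of
  \<open>\<phi>\<close> composed with Moebius maps. As \<open>planar\<close> is continuous, the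
  points of \<open>T\<close> are removable.\<close>

lemma holomorphic_planar:
  assumes "sphere_holomorphic_on \<phi> \<Omega>1"
  shows "planar holomorphic_on - K"
proof -
  define F where "F = (\<lambda>u. the_complex (\<phi> (Fin u)))"
  define S where "S = {u. Fin u \<in> \<Omega>1 \<and> \<phi> (Fin u) \<noteq> Infty}"
  have F: "F holomorphic_on S"
    using assms unfolding sphere_holomorphic_on_def F_def S_def by (auto dest!: bspec[where x=id])
  define T where "T = {0} \<union> {z. z \<notin> K \<and> \<phi> (chart c1 z) = Infty}"
  have "finite {z. z \<notin> K \<and> \<phi> (chart c1 z) = Infty}"
  proof (rule finite_subset)
    show "{z. z \<notin> K \<and> \<phi> (chart c1 z) = Infty} \<subseteq> {chart_inv c1 (\<psi> Infty)}"
      using inverse_phi[OF chart_in] by auto (metis chart_inv_chart)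
  qed simp
  then have T: "finite T" by (simp add: T_def)
  have z: "1 / z + c1 \<in> S" "planar z = 1 / (F (1 / z + c1) - c2)" "F (1 / z + c1) \<noteq> c2" if z: "z \<in> - K - T" for z
  proof -
    have z0: "z \<noteq> 0" and zK: "z \<notin> K" and zi: "\<phi> (chart c1 z) \<noteq> Infty" using z by (auto simp: T_def)
    have e: "chart c1 z = Fin (1 / z + c1)" using z0 by (simp add: chart_def)
    show "1 / z + c1 \<in> S" using chart_in[OF zK] zi by (simp add: S_def e)
    have p: "\<phi> (chart c1 z) = Fin (F (1 / z + c1))" using zi unfolding F_def e by (cases "\<phi> (Fin (1 / z + c1))") auto
    show "planar z = 1 / (F (1 / z + c1) - c2)" unfolding planar_def p by (simp add: chart_inv_def)
    show "F (1 / z + c1) \<noteq> c2" using phi_chart_neq[OF zK] p by auto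
  qed
  have "(\<lambda>z. F (1 / z + c1)) holomorphic_on - K - T"
  proof -
    have "(\<lambda>z. 1 / z + c1) holomorphic_on - K - T" by (intro holomorphic_intros) (auto simp: T_def)
    then show ?thesis using holomorphic_on_compose_gen[of "\<lambda>z. 1 / z + c1" "- K - T" F S] F z(1) by (auto simp: o_def)
  qed
  then have "(\<lambda>z. 1 / (F (1 / z + c1) - c2)) holomorphic_on - K - T"
    using z(3) by (intro holomorphic_intros) auto
  then have "planar holomorphic_on - K - T" by (rule holomorphic_transform) (use z(2) in auto)
  then show ?thesis using no_isolated_singularity[OF continuous_planar _ D1.open_complement T] by blast
qed

lemma extends_if_planar_limits:
  assumes lim: "\<And>z. z \<in> frontier K \<Longrightarrow> \<exists>l. (planar \<longlongrightarrow> l) (at z within - K)"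
  shows "extends_continuously \<Omega>1 \<Omega>2 \<phi>"
proof -
  have "\<exists>l. (\<phi> \<longlongrightarrow> l) (at x within \<Omega>1)" if x: "x \<in> closure \<Omega>1 - \<Omega>1" for x
  proof -
    have "x \<in> frontier \<Omega>1" using x D1.open_domain by (simp add: frontier_def interior_open)
    then obtain z where z: "z \<in> frontier K" "x = chart c1 z" using D1.frontier_chart by blast
    obtain l where l: "(planar \<longlongrightarrow> l) (at z within - K)" using lim[OF z(1)] by blast
    have zK: "z \<in> K" using z(1) D1.frontier_hull by blast
    have op: "open (- {Fin c1})" by (intro open_Compl closed_singleton)
    have xc: "x \<in> - {Fin c1}" using z by simp
    have evt: "\<forall>\<^sub>F y in at x within \<Omega>1. y \<in> - {Fin c1}"
      using eventually_at_in_open'[OF op xc] eventually_at_topological op xc by metis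
    have ev: "\<forall>\<^sub>F y in at x within \<Omega>1. y \<in> \<Omega>1 \<and> y \<noteq> Fin c1"
      using evt eventually_at_filter[of "\<lambda>y. y \<in> \<Omega>1" x \<Omega>1]
      by (auto simp: eventually_at_filter elim: eventually_mono)
    have "isCont (chart_inv c1) x" using continuous_on_chart_inv op xc continuous_on_eq_continuous_at by blast
    then have "(chart_inv c1 \<longlongrightarrow> chart_inv c1 x) (at x within \<Omega>1)"
      using isContD tendsto_within_subset by (metis UNIV_I subset_UNIV)
    then have t: "(chart_inv c1 \<longlongrightarrow> z) (at x within \<Omega>1)" using z(2) by simp
    have "\<forall>\<^sub>F y in at x within \<Omega>1. chart_inv c1 y \<in> - K \<and> chart_inv c1 y \<noteq> z"
      using ev
    proof eventually_elim
      case (elim y)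
      then have "chart_inv c1 y \<notin> K" by (simp add: chart_hull_def)
      then show ?case using zK by auto
    qed
    then have "filterlim (chart_inv c1) (at z within - K) (at x within \<Omega>1)"
      using t by (simp add: filterlim_at)
    then have "((\<lambda>y. planar (chart_inv c1 y)) \<longlongrightarrow> l) (at x within \<Omega>1)"
      using l filterlim_compose by blast
    moreover have "isCont (chart c2) l" using continuous_on_chart[of UNIV] by (simp add: continuous_on_eq_continuous_at)
    ultimately have "((\<lambda>y. chart c2 (planar (chart_inv c1 y))) \<longlongrightarrow> chart c2 l) (at x within \<Omega>1)"
      using isCont_tendsto_compose by blast
    moreover have "\<forall>\<^sub>F y in at x within \<Omega>1. chart c2 (planar (chart_inv c1 y)) = \<phi> y"
      using ev
    proof eventually_elim
      case (elim y)
      then have "chart_inv c1 y \<notin> K" by (simp add: chart_hull_def)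
      then show ?case using chart_planar[of "chart_inv c1 y"] elim by simp
    qed
    ultimately show ?thesis using Lim_transform_eventually by blast
  qed
  then obtain \<Phi> where \<Phi>: "continuous_on (closure \<Omega>1) \<Phi>" "\<And>x. x \<in> \<Omega>1 \<Longrightarrow> \<Phi> x = \<phi> x"
    "\<Phi> ` closure \<Omega>1 \<subseteq> closure (\<phi> ` \<Omega>1)"
    using continuous_extension_closure[OF cont_phi] by blast
  moreover have "\<phi> ` \<Omega>1 = \<Omega>2" using homeo by (simp add: homeomorphism_def)
  ultimately show ?thesis unfolding extends_continuously_def by auto
qed

lemma planar_extension_if_extends:
  assumes "extends_continuously \<Omega>1 \<Omega>2 \<phi>"
  obtains \<Phi> where "continuous_on (closure (- K)) \<Phi>" "\<And>z. z \<notin> K \<Longrightarrow> \<Phi> z = planar z"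
proof -
  obtain H where H: "continuous_on (closure \<Omega>1) H" "\<And>x. x \<in> \<Omega>1 \<Longrightarrow> H x = \<phi> x"
    using assms unfolding extends_continuously_def by blast
  have cl: "chart c1 z \<in> closure \<Omega>1" if "z \<in> closure (- K)" for z
    using D1.closure_chart[of "chart c1 z"] that by simp
  \<comment> \<open>If a boundary point went to \<open>Fin c2\<close>, an interior point of
    \<open>\<Omega>2\<close>, continuity of \<open>\<psi>\<close> would force points of
    \<open>\<Omega>1\<close> tending to it to tend to \<open>Fin c1\<close> as well. So the
    extension can be read in the chart.\<close>
  have ne: "H (chart c1 z) \<noteq> Fin c2" if z: "z \<in> closure (- K)" for z
  proof (cases "z \<in> K")
    case False
    then show ?thesis using H(2)[OF chart_in] phi_chart_neq by simp
  next
    case True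
    show ?thesis
    proof
      assume eq: "H (chart c1 z) = Fin c2"
      obtain y where y: "\<And>n. y n \<in> \<Omega>1" "y \<longlonglongrightarrow> chart c1 z" using cl[OF z] unfolding closure_sequential by blast
      have "(\<lambda>n. H (y n)) \<longlonglongrightarrow> H (chart c1 z)"
        by (rule continuous_on_tendsto_compose[OF H(1) y(2) cl[OF z]])
          (use y(1) closure_subset in \<open>auto intro!: always_eventually\<close>)
      then have "(\<lambda>n. \<phi> (y n)) \<longlonglongrightarrow> Fin c2" using H(2) y(1) eq by simp
      then have "(\<lambda>n. \<psi> (\<phi> (y n))) \<longlonglongrightarrow> \<psi> (Fin c2)"
        by (rule continuous_on_tendsto_compose[OF cont_psi _ D2.centre]) (use phi_in y(1) in auto)
      then have "y \<longlonglongrightarrow> Fin c1" using inverse_phi y(1) inverse_phi[OF D1.centre] centres by simp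
      then show False using y(2) LIMSEQ_unique chart_neq by metis
    qed
  qed
  have "continuous_on (closure (- K)) (\<lambda>z. H (chart c1 z))"
    by (rule continuous_on_compose2[OF H(1) continuous_on_chart]) (use cl in auto)
  then have "continuous_on (closure (- K)) (\<lambda>z. chart_inv c2 (H (chart c1 z)))"
  proof (rule continuous_on_compose2[OF continuous_on_chart_inv _ image_subsetI])
    show "H (chart c1 z) \<in> - {Fin c2}" if "z \<in> closure (- K)" for z using ne[OF that] by simp
  qed
  moreover have "chart_inv c2 (H (chart c1 z)) = planar z" if "z \<notin> K" for z
    using H(2)[OF chart_in] that by (simp add: planar_def)
  ultimately show ?thesis using that by blast
qed

end

text \<open>A convergent sum has at most \<open>infsum / c\<close> terms above \<open>c\<close>.
  This supplies the null condition of \<open>peano_compactum\<close>, so that only the Peano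
  property of the components is at stake.\<close>

lemma finite_large_components:
  fixes S :: "'a::metric_space set"
  assumes bd: "bounded S" and sm: "diameter summable_on nondegenerate_components S" and c: "c > 0"
  shows "finite {P \<in> components S. diameter P > c}"
proof (rule ccontr)
  let ?X = "{P \<in> components S. diameter P > c}"
  assume inf: "infinite ?X"
  have bP: "bounded P" if "P \<in> components S" for P using that bd bounded_subset in_components_subset by blast
  have sub: "?X \<subseteq> nondegenerate_components S"
  proof
    fix P assume P: "P \<in> ?X"
    then obtain x where x: "x \<in> P" using in_components_nonempty by blast
    have "\<exists>x\<in>P. \<exists>y\<in>P. x \<noteq> y"
    proof (rule ccontr)
      assume "\<not> ?thesis"
      then have "P = {x}" using x by blast
      then show False using P c by simp
    qed
    then show "P \<in> nondegenerate_components S" using P by (simp add: nondegenerate_components_def)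
  qed
  obtain n :: nat where n: "infsum diameter (nondegenerate_components S) / c < n" using reals_Archimedean2 by blast
  obtain F where F: "F \<subseteq> ?X" "finite F" "card F = n" using infinite_arbitrarily_large[OF inf] by blast
  have "n * c = (\<Sum>P\<in>F. c)" using F(3) by simp
  also have "\<dots> \<le> sum diameter F" using F(1) by (intro sum_mono) auto
  also have "\<dots> \<le> infsum diameter (nondegenerate_components S)"
    using F sub bP by (intro finite_sum_le_infsum sm) (auto simp: nondegenerate_components_def intro: diameter_ge_0)
  finally show False using n c by (simp add: field_simps)
qed

lemma summable_diameter_chart:
  assumes B: "bounded S" and sm: "diameter summable_on nondegenerate_components (chart c ` S)"
  shows "diameter summable_on nondegenerate_components S"
proof -
  obtain m M where mM: "m > 0" "M > 0"
    "\<And>z w. z \<in> S \<Longrightarrow> w \<in> S \<Longrightarrow> m * dist z w \<le> dist (chart c z) (chart c w)"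
    "\<And>z w. z \<in> S \<Longrightarrow> w \<in> S \<Longrightarrow> dist (chart c z) (chart c w) \<le> M * dist z w"
    using chart_bilipschitz[OF B, of c] by metis
  have PS: "P \<subseteq> S" if "P \<in> nondegenerate_components S" for P
    using that in_components_subset by (auto simp: nondegenerate_components_def)
  have "(diameter \<circ> (`) (chart c)) summable_on nondegenerate_components S"
    using sm unfolding nondegenerate_components_chart by (subst (asm) summable_on_reindex[OF inj_image_chart])
  then have "(\<lambda>P. 1 / m * diameter (chart c ` P)) summable_on nondegenerate_components S"
    by (intro summable_on_cmult_right) (simp add: o_def)
  then show ?thesis
  proof (rule summable_on_comparison_test)
    fix P assume P: "P \<in> nondegenerate_components S"
    have bP: "bounded P" using PS[OF P] B bounded_subset by blast
    show "0 \<le> diameter P" using bP diameter_ge_0 by blast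
    have bc: "bounded (chart c ` P)"
      by (rule diameter_image_Lipschitz(1)[of S "chart c" M P]) (use mM bP PS[OF P] in auto)
    have "diameter (chart_inv c ` chart c ` P) \<le> 1 / m * diameter (chart c ` P)"
    proof (rule diameter_image_Lipschitz(2)[OF _ bc order_refl])
      fix x y assume "x \<in> chart c ` P" "y \<in> chart c ` P"
      then obtain z w where zw: "z \<in> P" "w \<in> P" "x = chart c z" "y = chart c w" by blast
      then have "m * dist z w \<le> dist x y" using mM(3) PS[OF P] by blast
      then show "dist (chart_inv c x) (chart_inv c y) \<le> 1 / m * dist x y" using mM(1) zw by (simp add: field_simps)
    qed (use mM in simp)
    then show "diameter P \<le> 1 / m * diameter (chart c ` P)" by simp
  qed
qed

theorem theorem4p9:
  fixes \<Omega>1 \<Omega>2 :: "ecomplex set" and \<phi> :: "ecomplex \<Rightarrow> ecomplex"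
  assumes "generalized_jordan_domain \<Omega>1"
    and "domain \<Omega>2"
    and "conformal_homeomorphism \<Omega>1 \<Omega>2 \<phi>"
    and "sigma_finite_linear_measure (\<Union>(point_components (frontier \<Omega>2)))"
    and "countable (nondegenerate_components (frontier \<Omega>2))"
    and "diameter summable_on (nondegenerate_components (frontier \<Omega>2))"
  shows "extends_continuously \<Omega>1 \<Omega>2 \<phi> \<longleftrightarrow> peano_compactum (frontier \<Omega>2)"
proof (cases "\<Omega>1 = {}")
  case True
  \<comment> \<open>With both domains empty, both sides of the equivalence hold.\<close>
  then have "\<Omega>2 = {}" using assms(3) by (auto simp: conformal_homeomorphism_def homeomorphism_def)
  then show ?thesis using True
    by (auto simp: extends_continuously_def peano_compactum_def)
next
  case False
  have dom1: "domain \<Omega>1" using assms(1) by (simp add: generalized_jordan_domain_def)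
  obtain \<psi> where homeo: "homeomorphism \<Omega>1 \<Omega>2 \<phi> \<psi>" and hol: "sphere_holomorphic_on \<phi> \<Omega>1"
    using assms(3) by (auto simp: conformal_homeomorphism_def)
  obtain c1 c2 where c: "Fin c1 \<in> \<Omega>1" "\<phi> (Fin c1) = Fin c2"
  proof -
    obtain x where x: "x \<in> \<Omega>1" using False by blast
    \<comment> \<open>Both centres must be finite points. An auxiliary chart centred away from
      \<open>x\<close> shows the domain as a nonempty open, hence infinite, plane set
      \<open>W\<close>; besides the origin, which is \<open>Infty\<close>, only the point
      \<open>\<psi> Infty\<close> has to be avoided.\<close>
    define c :: complex where "c = (if x = Fin 0 then 1 else 0)"
    have xc: "x \<noteq> Fin c" by (auto simp: c_def)
    define W where "W = chart c -` \<Omega>1"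
    have "open W" unfolding W_def using dom1 open_vimage[OF _ continuous_on_chart] by (auto simp: domain_def)
    moreover have "chart_inv c x \<in> W" using x xc by (simp add: W_def)
    ultimately have "infinite W" using finite_imp_not_open by blast
    have "finite ({0, chart_inv c (\<psi> Infty)} :: complex set)" by simp
    then obtain z where z: "z \<in> W" "z \<noteq> 0" "z \<noteq> chart_inv c (\<psi> Infty)"
      using \<open>infinite W\<close> by (metis finite_subset insertI1 insert_iff subsetI)
    have e: "chart c z = Fin (1 / z + c)" using z by (simp add: chart_def)
    have zin: "Fin (1 / z + c) \<in> \<Omega>1" using z(1) e by (simp add: W_def)
    have "\<phi> (Fin (1 / z + c)) \<noteq> Infty"
    proof
      assume "\<phi> (Fin (1 / z + c)) = Infty"
      then have "\<psi> Infty = Fin (1 / z + c)" using homeo zin unfolding homeomorphism_def by metis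
      then show False using z(3) e by (metis chart_inv_chart)
    qed
    then obtain c2 where "\<phi> (Fin (1 / z + c)) = Fin c2" by (cases "\<phi> (Fin (1 / z + c))") auto
    then show ?thesis using that zin by blast
  qed
  have "\<phi> (Fin c1) \<in> \<Omega>2" using imageI[OF c(1), of \<phi>] homeo by (simp add: homeomorphism_def)
  then have "Fin c2 \<in> \<Omega>2" using c(2) by simp
  then interpret sphere_homeomorphism c1 \<Omega>1 c2 \<Omega>2 \<phi> \<psi>
    using dom1 assms(2) homeo c by unfold_locales
  interpret P: end_pair K L planar planar_inv by (rule end_pair_planar)
  have f1: "frontier \<Omega>1 = chart c1 ` frontier K" and f2: "frontier \<Omega>2 = chart c2 ` frontier L"
    using D1.frontier_chart D2.frontier_chart by auto
  have cL: "compact (frontier L)" using P.L(1) compact_frontier by blast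
  have jordan: "(\<exists>x. C = {x}) \<or> jordan_curve C" if C: "C \<in> components (frontier K)" for C
  proof -
    have "chart c1 ` C \<in> components (frontier \<Omega>1)" using C f1 components_chart_image by auto
    then have "(\<exists>x. chart c1 ` C = {x}) \<or> jordan_curve (chart c1 ` C)"
      using assms(1) by (auto simp: generalized_jordan_domain_def)
    then show ?thesis using jordan_curve_chart by (metis chart_inv_image_chart image_empty image_insert)
  qed
  have peano: "(\<forall>P\<in>components (frontier \<Omega>2). peano_continuum P) \<longleftrightarrow> (\<forall>P\<in>components (frontier L). peano_continuum P)"
    unfolding f2 components_chart_image using peano_continuum_chart by auto
  have sumL: "diameter summable_on nondegenerate_components (frontier L)"
    using summable_diameter_chart compact_imp_bounded[OF cL] assms(6) f2 by metis
  have "compact (frontier \<Omega>2)" unfolding f2 using cL continuous_on_chart compact_continuous_image by blast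
  then have pc: "peano_compactum (frontier \<Omega>2) \<longleftrightarrow> (\<forall>P\<in>components (frontier L). peano_continuum P)"
    unfolding peano_compactum_def using peano finite_large_components[OF _ assms(6)] compact_imp_bounded by blast
  show ?thesis unfolding pc
  proof
    assume "extends_continuously \<Omega>1 \<Omega>2 \<phi>"
    then obtain \<Phi> where "continuous_on (closure (- K)) \<Phi>" "\<And>z. z \<notin> K \<Longrightarrow> \<Phi> z = planar z"
      using planar_extension_if_extends by blast
    then show "\<forall>P\<in>components (frontier L). peano_continuum P"
      using P.peano_components_if_extension jordan by blast
  next
    assume pe: "\<forall>P\<in>components (frontier L). peano_continuum P"
    obtain B :: "nat \<Rightarrow> ecomplex set" where B: "\<Union>(point_components (frontier \<Omega>2)) = (\<Union>n. B n)"
      "\<And>n. linear_measure (B n) < \<infinity>"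
      using assms(4) unfolding sigma_finite_linear_measure_def by blast
    \<comment> \<open>The lower Lipschitz bound on the bounded set \<open>frontier L\<close> makes
      the inverse chart Lipschitz, so the pieces \<open>B n\<close> go to plane sets of finite
      linear measure.\<close>
    obtain m where m: "m > 0" "\<And>z w. z \<in> frontier L \<Longrightarrow> w \<in> frontier L \<Longrightarrow> m * dist z w \<le> dist (chart c2 z) (chart c2 w)"
      using chart_bilipschitz[OF compact_imp_bounded[OF cL], of c2] by metis
    have pts: "\<Union>(point_components (frontier L)) = (\<Union>n. chart_inv c2 ` B n)"
    proof -
      have "chart_inv c2 ` \<Union>(point_components (frontier \<Omega>2)) = \<Union>(point_components (frontier L))"
        unfolding f2 Union_point_components_chart by simp
      then show ?thesis unfolding B(1) by (simp add: image_UN)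
    qed
    have BL: "B n \<subseteq> chart c2 ` frontier L" for n
    proof -
      have "\<Union>(point_components (frontier \<Omega>2)) \<subseteq> frontier \<Omega>2"
        using in_components_subset by (auto simp: point_components_def)
      then show ?thesis using B(1) f2 by blast
    qed
    have fin: "linear_measure (chart_inv c2 ` B n) < \<infinity>" for n
    proof (rule linear_measure_Lipschitz_image[OF _ _ B(2)])
      fix x y assume "x \<in> B n" "y \<in> B n"
      then obtain z w where zw: "z \<in> frontier L" "w \<in> frontier L" "x = chart c2 z" "y = chart c2 w" using BL by blast
      then have "m * dist z w \<le> dist x y" using m(2) by blast
      then show "dist (chart_inv c2 x) (chart_inv c2 y) \<le> 1 / m * dist x y" using m(1) zw by (simp add: field_simps)
    qed (use m in simp)
    have cntK: "countable (nondegenerate_components (frontier K))"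
      using assms(1) unfolding generalized_jordan_domain_def f1 nondegenerate_components_chart
      using countable_image_inj_on[OF _ inj_image_chart] by blast
    have cntL: "countable (nondegenerate_components (frontier L))"
      using assms(5) unfolding f2 nondegenerate_components_chart
      using countable_image_inj_on[OF _ inj_image_chart] by blast
    interpret Q: extension_setup K L planar planar_inv "\<lambda>n. chart_inv c2 ` B n"
      using holomorphic_planar[OF hol] jordan cntK cntL sumL pts fin pe by unfold_locales auto
    show "extends_continuously \<Omega>1 \<Omega>2 \<phi>"
      using extends_if_planar_limits Q.limit_at_frontier by blast
  qed
qed

end
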